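(* Let $x^{\det}_t$, $t\in[-T,T]$, be the solution of the deterministic equation $\varepsilon\,\frac{d x^{\det}_t}{dt}=f(x^{\det}_t,t)$ with initial condition satisfying $x^{\det}_{-T}-x^\star(-T)\asymp\varepsilon$. Then: (i) The solution $x^{\det}_t$ and the curve $x^\star(t)$ cross once and only once during the time interval $[-T,T]$, and the crossing time $\tilde t$ satisfies $\tilde t-t^\star\asymp(\varepsilon/a_0)\wedge\varepsilon^{1/3}$. (ii) There exists a constant $c_0>0$ such that $$x^{\det}_t-x^\star(t)\asymp\begin{cases}\ \ \dfrac{\varepsilon}{t^2}&\text{for }-T\le t\le -c_0(\sqrt{a_0}\vee\varepsilon^{1/3}),\\[2mm] -\dfrac{\varepsilon}{t^2}&\text{for }c_0(\sqrt{a_0}\vee\varepsilon^{1/3})\le t\le T,\end{cases}$$ and thus $x^{\det}_t\asymp|t|$ in these time intervals. (iii) For $|t|\le c_0(\sqrt{a_0}\vee\varepsilon^{1/3})$, $$x^{\det}_t\asymp\begin{cases}\sqrt{a_0}&\text{if }a_0\ge\varepsilon^{2/3},\\ \varepsilon^{1/3}&\text{if }a_0\le\varepsilon^{2/3}.\end{cases}$$ (iv) The linearization of $f$ at $x^{\det}_t$ satisfies, for $t\in[-T,T]$, $$\bar a(t):=\partial_xf(x^{\det}_t,t)\asymp-(t^2\vee a_0\vee\varepsilon^{2/3}).$$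
   Context: Conventions. $\varepsilon>0$ is a small parameter, and all assertions are for sufficiently small $\varepsilon$. $a_0=a_0(\varepsilon)>0$ is a function of $\varepsilon$ with $a_0\to0$ as $\varepsilon\to0$. $y\vee z$, $y\wedge z$ denote maximum and minimum. For $\varphi\ge 0$, $\psi(t,\varepsilon)\asymp\varphi(t,\varepsilon)$ on an interval means that there are constants $c_\pm>0$, independent of $t,\varepsilon$ (hence of $a_0$), with $c_-\varphi\le\psi\le c_+\varphi$ for all $t$ in the interval and all small $\varepsilon$; $\psi\asymp-\varphi$ means $-\psi\asymp\varphi$. $\mathcal O(u)$ denotes a quantity bounded by $K|u|$ for small $u$, with $K$ independent of $\varepsilon,a_0$. Symmetric setting. $f:\mathbb R^2\to\mathbb R$ may depend on $\varepsilon$ through $a_0$ only, with all constants and derivative bounds below independent of $\varepsilon$. With $d>0$ a constant and $\mathcal M=[-d,d]\times\mathbb R$: $f\in\mathcal C^4(\mathcal M,\mathbb R)$; $f(x,t+1)=f(x,t)$ and $f(x,t)=-f(-x,t)$ on $\mathcal M$; there is a continuous $x^\star:\mathbb R\to(0,d]$ such that in $\mathcal M$, $f(x,t)=0$ iff $x=0$ or $x=\pm x^\star(t)$; for all $t$, $a(t):=\partial_xf(0,t)>0$ and $a^\star(t):=\partial_xf(x^\star(t),t)<0$; $\partial_{xxx}f(0,0)<0$ and $a(t)=a_0+a_1t^2+\mathcal O(t^3)$ near $t=0$, where $a_1>0$ and $\partial_{xxx}f(0,0)$ are fixed. Then $x^\star$ has a quadratic minimum at a time $t^\star=\mathcal O(a_0)$.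 $T\in(0,1/2)$ is a constant such that the derivatives of $a$ and $x^\star$ vanish only once in $[-T,T]$, and $x^\star,a,a^\star$ are bounded away from zero on $[T,1-T]$. These properties are summarized by: $x^\star(t)\asymp\sqrt{a_0}$ and $a(t)\asymp a_0$ for $|t|\le\sqrt{a_0}$; $x^\star(t)\asymp|t|$ and $a(t)\asymp t^2$ for $\sqrt{a_0}\le|t|\le T$; $x^\star(t)\asymp1$ and $a(t)\asymp1$ for $T\le t\le1-T$; $a^\star(t)\asymp-a(t)$ for all $t$.
   Formalization: "The derivatives of a and x* vanish only once in [-T,T]" is strengthened: at fixed distance from their zeros, |a'| and |x*'| have lower bounds independent of ε. Without this for x*, (ii) fails where x*' tends to 0 with a_0 at a fixed t. *)

theory Defs
  imports "HOL-Analysis.Analysis"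
begin

(* Two-parameter families g e t are indexed by the small parameter e > 0 first;
   "for all sufficiently small e > 0" is the filter at_right 0. The relation
   psi \<asymp> - phi is written as comparable_on I (- psi) phi. *)
definition comparable_on ::
  "(real \<Rightarrow> real set) \<Rightarrow> (real \<Rightarrow> real \<Rightarrow> real) \<Rightarrow> (real \<Rightarrow> real \<Rightarrow> real) \<Rightarrow> bool" where
  "comparable_on I \<psi> \<phi> \<longleftrightarrow>
     (\<exists>cm>0. \<exists>cp>0. \<forall>\<^sub>F \<epsilon> in at_right 0. \<forall>t\<in>I \<epsilon>.
        cm * \<phi> \<epsilon> t \<le> \<psi> \<epsilon> t \<and> \<psi> \<epsilon> t \<le> cp * \<phi> \<epsilon> t)"

(* Partial derivatives on the strip [-d,d] x R. The x-derivative is taken within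
   [-d,d], hence is one-sided at x = d and x = -d: values of f outside the strip
   play no role. *)
definition pdx :: "real \<Rightarrow> (real \<Rightarrow> real \<Rightarrow> real) \<Rightarrow> real \<Rightarrow> real \<Rightarrow> real" where
  "pdx d f x t = vector_derivative (\<lambda>y. f y t) (at x within {-d..d})"

definition pdt :: "(real \<Rightarrow> real \<Rightarrow> real) \<Rightarrow> real \<Rightarrow> real \<Rightarrow> real" where
  "pdt f x t = deriv (\<lambda>s. f x s) t"

(* f is n times continuously differentiable on the strip [-d,d] x R, and f and all
   its partial derivatives up to order n are bounded there by K. *)
primrec Ck_bounded :: "nat \<Rightarrow> real \<Rightarrow> real \<Rightarrow> (real \<Rightarrow> real \<Rightarrow> real) \<Rightarrow> bool" where
  "Ck_bounded 0 d K f \<longleftrightarrow>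
     continuous_on ({-d..d} \<times> UNIV) (\<lambda>(x, t). f x t) \<and>
     (\<forall>x\<in>{-d..d}. \<forall>t. \<bar>f x t\<bar> \<le> K)"
| "Ck_bounded (Suc n) d K f \<longleftrightarrow>
     (\<forall>x\<in>{-d..d}. \<forall>t. \<bar>f x t\<bar> \<le> K) \<and>
     (\<forall>x\<in>{-d..d}. \<forall>t.
        ((\<lambda>(y, s). f y s) has_derivative (\<lambda>(u, v). pdx d f x t * u + pdt f x t * v))
          (at (x, t) within {-d..d} \<times> UNIV)) \<and>
     Ck_bounded n d K (pdx d f) \<and> Ck_bounded n d K (pdt f)"

(* The derivative of g e vanishes exactly once in [-T,T], at s e, with a lower bound
   on its modulus away from s e that is independent of e. Without this uniformity
   the derivative could degenerate elsewhere in the limit e \<rightarrow> 0. *)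
definition deriv_vanishes_once ::
  "real \<Rightarrow> (real \<Rightarrow> real \<Rightarrow> real) \<Rightarrow> (real \<Rightarrow> real) \<Rightarrow> bool" where
  "deriv_vanishes_once T g s \<longleftrightarrow>
     (\<forall>\<^sub>F \<epsilon> in at_right 0. s \<epsilon> \<in> {-T..T} \<and>
        (\<forall>t\<in>{-T..T}. deriv (g \<epsilon>) t = 0 \<longleftrightarrow> t = s \<epsilon>)) \<and>
     (\<forall>\<delta>>0. \<exists>\<kappa>>0. \<forall>\<^sub>F \<epsilon> in at_right 0. \<forall>t\<in>{-T..T}.
        \<delta> \<le> \<bar>t - s \<epsilon>\<bar> \<longrightarrow> \<kappa> \<le> \<bar>deriv (g \<epsilon>) t\<bar>)"

(* F \<alpha> x t is the drift as a function of the parameter \<alpha> = a0 e, so that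
   F (a0 e) depends on e through a0 only. The functions a and a* of the symmetric
   setting are t \<mapsto> pdx d (F (a0 e)) 0 t and t \<mapsto> pdx d (F (a0 e)) (xstar e t) t.
   tstar is the critical point of xstar; f3 is the value of the third x-derivative
   at the origin. That xstar, a and a* are bounded away from zero on [T,1-T] is
   contained in xstar_outer, a_outer and astar_comparable. *)
locale symmetric_setting =
  fixes d T a1 f3 :: real
    and a0 :: "real \<Rightarrow> real"
    and F :: "real \<Rightarrow> real \<Rightarrow> real \<Rightarrow> real"
    and xstar :: "real \<Rightarrow> real \<Rightarrow> real"
    and tstar :: "real \<Rightarrow> real"
  assumes d_pos: "0 < d"
    and T_range: "0 < T" "T < 1/2"
    and a1_pos: "0 < a1"
    and f3_neg: "f3 < 0"
    and a0_pos: "\<forall>\<^sub>F \<epsilon> in at_right 0. 0 < a0 \<epsilon>"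
    and a0_tendsto: "(a0 \<longlongrightarrow> 0) (at_right 0)"
    and smooth: "\<exists>K. \<forall>\<^sub>F \<epsilon> in at_right 0. Ck_bounded 4 d K (F (a0 \<epsilon>))"
    and periodic: "\<forall>\<^sub>F \<epsilon> in at_right 0. \<forall>x\<in>{-d..d}. \<forall>t.
      F (a0 \<epsilon>) x (t + 1) = F (a0 \<epsilon>) x t"
    and odd_x: "\<forall>\<^sub>F \<epsilon> in at_right 0. \<forall>x\<in>{-d..d}. \<forall>t.
      F (a0 \<epsilon>) x t = - F (a0 \<epsilon>) (- x) t"
    and xstar_cont: "\<forall>\<^sub>F \<epsilon> in at_right 0. continuous_on UNIV (xstar \<epsilon>)"
    and xstar_range: "\<forall>\<^sub>F \<epsilon> in at_right 0. \<forall>t. xstar \<epsilon> t \<in> {0<..d}"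
    and zeros: "\<forall>\<^sub>F \<epsilon> in at_right 0. \<forall>x\<in>{-d..d}. \<forall>t.
      F (a0 \<epsilon>) x t = 0 \<longleftrightarrow> x = 0 \<or> x = xstar \<epsilon> t \<or> x = - xstar \<epsilon> t"
    and a_pos: "\<forall>\<^sub>F \<epsilon> in at_right 0. \<forall>t. 0 < pdx d (F (a0 \<epsilon>)) 0 t"
    and astar_neg: "\<forall>\<^sub>F \<epsilon> in at_right 0. \<forall>t. pdx d (F (a0 \<epsilon>)) (xstar \<epsilon> t) t < 0"
    and third_derivative:
      "\<forall>\<^sub>F \<epsilon> in at_right 0. pdx d (pdx d (pdx d (F (a0 \<epsilon>)))) 0 0 = f3"
    and a_expansion: "\<exists>K. \<exists>\<delta>>0. \<forall>\<^sub>F \<epsilon> in at_right 0. \<forall>t. \<bar>t\<bar> < \<delta> \<longrightarrow>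
      \<bar>pdx d (F (a0 \<epsilon>)) 0 t - (a0 \<epsilon> + a1 * t\<^sup>2)\<bar> \<le> K * \<bar>t\<bar> ^ 3"
    and a_critical: "deriv_vanishes_once T (\<lambda>\<epsilon> t. pdx d (F (a0 \<epsilon>)) 0 t) (\<lambda>\<epsilon>. 0)"
    and xstar_critical: "deriv_vanishes_once T xstar tstar"
    and xstar_inner: "comparable_on (\<lambda>\<epsilon>. {t. \<bar>t\<bar> \<le> sqrt (a0 \<epsilon>)})
      xstar (\<lambda>\<epsilon> t. sqrt (a0 \<epsilon>))"
    and a_inner: "comparable_on (\<lambda>\<epsilon>. {t. \<bar>t\<bar> \<le> sqrt (a0 \<epsilon>)})
      (\<lambda>\<epsilon> t. pdx d (F (a0 \<epsilon>)) 0 t) (\<lambda>\<epsilon> t. a0 \<epsilon>)"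
    and xstar_middle: "comparable_on (\<lambda>\<epsilon>. {t. sqrt (a0 \<epsilon>) \<le> \<bar>t\<bar> \<and> \<bar>t\<bar> \<le> T})
      xstar (\<lambda>\<epsilon> t. \<bar>t\<bar>)"
    and a_middle: "comparable_on (\<lambda>\<epsilon>. {t. sqrt (a0 \<epsilon>) \<le> \<bar>t\<bar> \<and> \<bar>t\<bar> \<le> T})
      (\<lambda>\<epsilon> t. pdx d (F (a0 \<epsilon>)) 0 t) (\<lambda>\<epsilon> t. t\<^sup>2)"
    and xstar_outer: "comparable_on (\<lambda>\<epsilon>. {T..1 - T}) xstar (\<lambda>\<epsilon> t. 1)"
    and a_outer: "comparable_on (\<lambda>\<epsilon>. {T..1 - T})
      (\<lambda>\<epsilon> t. pdx d (F (a0 \<epsilon>)) 0 t) (\<lambda>\<epsilon> t. 1)"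
    and astar_comparable: "comparable_on (\<lambda>\<epsilon>. UNIV)
      (\<lambda>\<epsilon> t. - pdx d (F (a0 \<epsilon>)) (xstar \<epsilon> t) t) (\<lambda>\<epsilon> t. pdx d (F (a0 \<epsilon>)) 0 t)"

end

theory Submission imports Defs
begin

text \<open>Everything is governed by the single scale \<open>\<mu> = max (sqrt a0) (\<epsilon>^(1/3))\<close>. Near
  the origin the drift is close to the cubic \<open>x (a0 + a1 t^2 - b x^2)\<close> with \<open>b = - f3 / 6\<close>;
  the equilibrium \<open>x\<^sup>*(t)\<close> has order \<open>max (sqrt a0) \<bar>t\<bar>\<close> and attracts at a rate of the order
  of its square. For \<open>\<bar>t\<bar> \<ge> \<mu>\<close> attraction wins over the motion of the equilibrium and the
  solution follows it with a lag of order \<open>\<epsilon> / t^2\<close>, above it while it decreases and below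
  it while it increases. For \<open>\<bar>t\<bar> \<le> \<mu>\<close> the solution is of order \<open>\<mu>\<close>, and the lag changes
  sign a time of order \<open>\<epsilon> / \<mu>^2\<close> after the minimum \<open>t\<^sup>*\<close>. In terms of \<open>\<mu>\<close> the quantities in
  the theorem become \<open>(\<epsilon> / a0) \<and> \<epsilon>^(1/3) = \<epsilon> / \<mu>^2\<close> and
  \<open>t^2 \<or> a0 \<or> \<epsilon>^(2/3) = (max \<mu> \<bar>t\<bar>)^2\<close>.

  These bounds are proved by explicit barriers. A curve \<open>z\<close> is not crossed by the solution
  if \<open>f (z, t) - \<epsilon> z'\<close> has a strict sign wherever the two meet (\<open>barrier_strict\<close>). Near the
  equilibrium, \<open>f = - k (x - x\<^sup>*)\<close> with \<open>k\<close> comparable to \<open>x (x + x\<^sup>*)\<close>, so the curves \<open>x\<^sup>*\<close>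
  plus or minus a multiple of \<open>\<epsilon> / t^2\<close> serve before and after the inner passage
  (\<open>before_upper\<close>, \<open>before_lower\<close>, \<open>after_upper\<close>, \<open>after_lower\<close>). On the inner passage,
  barriers at a distance from \<open>x\<^sup>*\<close> that is linear in \<open>t\<close> show that the solution remains
  above \<open>x\<^sup>*\<close> for a time of order \<open>\<epsilon> / \<mu>^2\<close> after \<open>t\<^sup>*\<close> (\<open>at_minimum\<close>, \<open>after_minimum\<close>) and
  not longer (\<open>crossing_time_upper\<close>). The crossing exists because the solution falls while
  it is above the equilibrium, and it is unique because \<open>x\<^sup>*\<close> itself is a barrier on either
  side of \<open>t\<^sup>*\<close> (\<open>crossing_exists\<close>).

  The negativity of the linearization does not follow from orders of magnitude. After the
  crossing the solution is below the equilibrium, and \<open>a0 + a1 t^2 - 3 b x^2\<close> is negative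
  only if \<open>b x^2\<close> exceeds a third of \<open>a0 + a1 t^2\<close>; that is a statement about constants. It
  is obtained from a subsolution of the equation for \<open>x^2\<close> which after rescaling is an
  explicit quadratic polynomial in time (\<open>scaled_subsolution\<close>, \<open>square_floor\<close>), valid for
  every ratio of \<open>a0\<close> to \<open>\<epsilon>^(2/3)\<close>. It yields \<open>20 (a0 + p t^2) \<le> 59 B x^2\<close>, where \<open>p\<close> and
  \<open>B\<close> are slightly perturbed values of \<open>a1\<close> and \<open>b\<close>, and \<open>59/20 < 3\<close>.

  It remains to derive the properties of the drift that the barriers use from the smoothness
  and symmetry of \<open>f\<close>. Oddness turns the Taylor expansions at \<open>x = 0\<close> into the cubic normal
  form; applied to increments of \<open>f / x\<close> as a function of \<open>x^2\<close>, it gives the bounds on \<open>k\<close>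
  (\<open>quotient_increment\<close>). The motion of the equilibrium is read off from the function
  \<open>\<psi> = \<partial>\<^sub>t f (x\<^sup>*, t) / x\<^sup>*\<close>, which has the sign of the derivative of \<open>x\<^sup>*\<close> and slope close
  to \<open>2 a1\<close> near the origin (\<open>\<psi>_slope\<close>, \<open>ts_bound\<close>). All constants are fixed before \<open>\<epsilon>\<close>, so
  the argument runs for a single \<open>\<epsilon>\<close> at a time, in the locales \<open>symmetric_snapshot\<close> and
  \<open>slow_passage\<close>, and only the last section speaks of limits.\<close>

section \<open>A comparison principle\<close>

text \<open>If \<open>w\<close> became negative, then at the last time before with \<open>w \<ge> 0\<close> it would
  vanish with \<open>w' \<le> 0\<close>; the same argument run to the left of a zero excludes that \<open>w\<close>
  returns to \<open>0\<close>. Only the sign of \<open>w'\<close> at the zeros of \<open>w\<close> matters, and this is what makes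
  explicit sub- and supersolutions cheap to verify.\<close>

lemma barrier_strict:
  fixes w w' :: "real \<Rightarrow> real"
  assumes der: "\<And>t. t \<in> {s..e} \<Longrightarrow> (w has_real_derivative w' t) (at t within {s..e})"
    and start: "0 \<le> w s"
    and contact: "\<And>t. t \<in> {s..e} \<Longrightarrow> w t = 0 \<Longrightarrow> 0 < w' t"
    and t: "s < t" "t \<le> e"
  shows "0 < w t"
proof -
  have cont: "continuous_on {s..e} w"
    by (rule DERIV_continuous_on[OF der])
  have nonneg: "0 \<le> w r" if r: "r \<in> {s..e}" for r
  proof (rule ccontr)
    assume neg: "\<not> 0 \<le> w r"
    define S where "S = {u \<in> {s..r}. w u \<in> {0..}}"
    have contr: "continuous_on {s..r} w"
      using cont r by (auto intro: continuous_on_subset)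
    have "closed S"
      unfolding S_def vimage_def[symmetric]
      using continuous_closed_preimage[OF contr closed_atLeastAtMost closed_atLeast[of 0]]
      by (simp add: vimage_def Int_def)
    have S0: "s \<in> S" using start r by (auto simp: S_def)
    have bdd: "bdd_above S" by (auto simp: S_def intro: bdd_aboveI[of _ r])
    define m where "m = Sup S"
    have mS: "m \<in> S" unfolding m_def
      by (rule closed_contains_Sup) (use S0 bdd \<open>closed S\<close> in auto)
    have m_lt: "m < r" using mS neg by (auto simp: S_def order.order_iff_strict)
    have above: "w u < 0" if "m < u" "u \<le> r" for u
    proof (rule ccontr)
      assume "\<not> w u < 0"
      then have "u \<in> S" using that mS by (auto simp: S_def)
      then show False using cSup_upper[OF _ bdd] that m_def by fastforce
    qed
    have "w m = 0"
    proof (rule ccontr)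
      assume "w m \<noteq> 0"
      then have "0 < w m" using mS by (auto simp: S_def)
      moreover have "continuous_on {m..r} w"
        using contr mS by (auto simp: S_def intro: continuous_on_subset)
      ultimately obtain u where u: "m \<le> u" "u \<le> r" "w u = 0"
        using IVT2'[of w r 0 m] neg m_lt by auto
      then have "m < u" using \<open>0 < w m\<close> by (cases "u = m") auto
      then show False using above[of u] u by auto
    qed
    moreover have min: "m \<in> {s..e}" using mS r by (auto simp: S_def)
    ultimately obtain \<delta> where \<delta>: "\<delta> > 0" "\<And>h. 0 < h \<Longrightarrow> m + h \<in> {s..e} \<Longrightarrow> h < \<delta> \<Longrightarrow> w m < w (m + h)"
      using has_real_derivative_pos_inc_right[OF der[OF min] contact[OF min]] by blast
    define h where "h = min (\<delta>/2) (r - m)"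
    have "w m < w (m + h)" using \<delta> m_lt r min by (intro \<delta>(2)) (auto simp: h_def)
    moreover have "w (m + h) < 0" using m_lt \<delta>(1) by (intro above) (auto simp: h_def)
    ultimately show False using \<open>w m = 0\<close> by simp
  qed
  show ?thesis
  proof (rule ccontr)
    assume "\<not> 0 < w t"
    then have w0: "w t = 0" using nonneg[of t] t by force
    have tin: "t \<in> {s..e}" using t by auto
    obtain \<delta> where \<delta>: "\<delta> > 0" "\<And>h. 0 < h \<Longrightarrow> t - h \<in> {s..e} \<Longrightarrow> h < \<delta> \<Longrightarrow> w (t - h) < w t"
      using has_real_derivative_pos_inc_left[OF der[OF tin] contact[OF tin w0]] by blast
    define h where "h = min (\<delta>/2) (t - s)"
    have "w (t - h) < w t" using \<delta> t by (intro \<delta>(2)) (auto simp: h_def)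
    moreover have "0 \<le> w (t - h)" using t \<delta>(1) by (intro nonneg) (auto simp: h_def)
    ultimately show False using w0 by simp
  qed
qed

section \<open>Slow passage: hypotheses, scales and barriers\<close>

text \<open>In the normal form \<open>x (a0 + a1 t^2 - b x^2)\<close> of the drift, the positive
  equilibrium has order \<open>width a0 t\<close> and the linear rate of attraction to it has order
  \<open>(width a0 t)^2\<close>.\<close>

definition width :: "real \<Rightarrow> real \<Rightarrow> real" where
  "width a0 t = max (sqrt a0) \<bar>t\<bar>"

text \<open>At distance \<open>t\<close> from the avoided bifurcation the solution relaxes at rate
  \<open>t^2 / \<epsilon>\<close>, so it follows the equilibrium as long as \<open>t^3\<close> is large compared with \<open>\<epsilon>\<close>; for
  \<open>\<bar>t\<bar>\<close> below \<open>sqrt a0\<close> the equilibrium keeps the order \<open>sqrt a0\<close>. The larger of the two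
  scales is the duration of the inner passage.\<close>

definition inner_scale :: "real \<Rightarrow> real \<Rightarrow> real" where
  "inner_scale a0 \<epsilon> = max (sqrt a0) (\<epsilon> powr (1/3))"

text \<open>All that the dynamical argument uses about the drift, for one value of \<open>\<epsilon>\<close> and
  with constants \<open>c\<close>, \<open>C\<close> that serve all small \<open>\<epsilon>\<close>. Near \<open>xs\<close> the drift is a restoring force
  whose rate \<open>k\<close> is comparable to \<open>\<xi> (\<xi> + xs t)\<close>; this keeps the right order as \<open>\<xi>\<close>
  approaches the equilibrium at \<open>0\<close>. For \<open>\<bar>t\<bar> \<le> D\<close> the drift is close to a cubic with
  relative error \<open>\<eta>\<close>. The equilibrium may touch the boundary \<open>x = d\<close> of the strip, but only
  after time \<open>D\<close>: before its crossing with \<open>xs\<close> the solution needs the margin \<open>R\<close> above it.\<close>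

locale slow_passage =
  fixes T d D R R0 c C b a1 \<eta> \<epsilon> a0 ts :: real
    and f fx :: "real \<Rightarrow> real \<Rightarrow> real" and xs xs' x :: "real \<Rightarrow> real"
  assumes eps: "0 < \<epsilon>" and a0: "0 < a0" and T: "T < 1/2" and D: "0 < D" "D \<le> T"
    and R: "0 < R" and R0: "0 < R0" "2 * R \<le> R0"
    and c: "0 < c" "c \<le> 1" and C: "1 \<le> C"
    and coeffs: "0 < b" "0 < \<eta>" "\<eta> < a1"
    and ts: "\<bar>ts\<bar> \<le> sqrt a0 / 2"
    and xs_bounds: "\<And>t. \<bar>t\<bar> \<le> T \<Longrightarrow> c * width a0 t \<le> xs t \<and> xs t \<le> C * width a0 t"
    and xs_le_d: "\<And>t. \<bar>t\<bar> \<le> T \<Longrightarrow> xs t \<le> d"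
    and room: "\<And>t. - T \<le> t \<Longrightarrow> t \<le> D \<Longrightarrow> xs t \<le> d - R"
    and xs_small: "\<And>t. \<bar>t\<bar> \<le> D \<Longrightarrow> xs t \<le> R0 / 2"
    and xs_deriv: "\<And>t. \<bar>t\<bar> \<le> T \<Longrightarrow> (xs has_real_derivative xs' t) (at t)"
    and slope_right: "\<And>t. ts \<le> t \<Longrightarrow> t \<le> T \<Longrightarrow>
          c * (t - ts) \<le> xs' t * width a0 t \<and> xs' t * width a0 t \<le> C * (t - ts)"
    and slope_left: "\<And>t. - T \<le> t \<Longrightarrow> t \<le> ts \<Longrightarrow>
          c * (ts - t) \<le> - xs' t * width a0 t \<and> - xs' t * width a0 t \<le> C * (ts - t)"
    and chord: "\<And>\<xi> t. \<bar>t\<bar> \<le> T \<Longrightarrow> 0 < \<xi> \<Longrightarrow> \<xi> \<le> d \<Longrightarrow> \<bar>\<xi> - xs t\<bar> \<le> R \<Longrightarrow>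
          \<exists>k. c * \<xi> * (\<xi> + xs t) \<le> k \<and> k \<le> C * \<xi> * (\<xi> + xs t) \<and> f \<xi> t = - k * (\<xi> - xs t)"
    and normal_form: "\<And>\<xi> t. \<bar>t\<bar> \<le> D \<Longrightarrow> 0 < \<xi> \<Longrightarrow> \<xi> \<le> R0 \<Longrightarrow>
          \<bar>f \<xi> t - \<xi> * (a0 + a1 * t\<^sup>2 - b * \<xi>\<^sup>2)\<bar> \<le> \<eta> * \<xi> * (t\<^sup>2 + \<xi>\<^sup>2)"
    and normal_form_deriv: "\<And>\<xi> t. \<bar>t\<bar> \<le> D \<Longrightarrow> 0 < \<xi> \<Longrightarrow> \<xi> \<le> R0 \<Longrightarrow>
          \<bar>fx \<xi> t - (a0 + a1 * t\<^sup>2 - 3 * b * \<xi>\<^sup>2)\<bar> \<le> \<eta> * (t\<^sup>2 + \<xi>\<^sup>2)"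
    and outer_slope: "\<And>\<xi> t. D \<le> \<bar>t\<bar> \<Longrightarrow> \<bar>t\<bar> \<le> T \<Longrightarrow> 0 < \<xi> \<Longrightarrow> \<xi> \<le> d \<Longrightarrow> \<bar>\<xi> - xs t\<bar> \<le> R \<Longrightarrow>
          c \<le> - fx \<xi> t \<and> - fx \<xi> t \<le> C"
    and solution: "\<And>t. \<bar>t\<bar> \<le> T \<Longrightarrow> (x has_real_derivative f (x t) t / \<epsilon>) (at t within {- T..T})"
    and initial: "c * \<epsilon> \<le> x (- T) - xs (- T)" "x (- T) - xs (- T) \<le> C * \<epsilon>"
begin

abbreviation "\<mu> \<equiv> inner_scale a0 \<epsilon>"
abbreviation "\<rho> \<equiv> width a0"

lemma T_pos: "0 < T" using D by linarith

lemma cube_root: "(\<epsilon> powr (1/3)) ^ 3 = \<epsilon>" "0 < \<epsilon> powr (1/3)"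
  using eps by (simp_all add: powr_realpow[symmetric] powr_powr)

lemma mu_pos: "0 < \<mu>" using a0 by (simp add: inner_scale_def less_max_iff_disj)

lemma sqrt_le_mu: "sqrt a0 \<le> \<mu>" by (simp add: inner_scale_def)

lemma eps_le_mu3: "\<epsilon> \<le> \<mu> ^ 3"
  using cube_root power_mono[of "\<epsilon> powr (1/3)" \<mu> 3] by (simp add: inner_scale_def)

lemma ts_mu: "\<bar>ts\<bar> \<le> \<mu> / 2" using ts sqrt_le_mu by linarith

lemma rho_pos: "0 < \<rho> t" using a0 by (simp add: width_def less_max_iff_disj)

lemma rho_ge: "\<bar>t\<bar> \<le> \<rho> t" "sqrt a0 \<le> \<rho> t" by (simp_all add: width_def)

lemma rho_outer: "\<mu> \<le> \<bar>t\<bar> \<Longrightarrow> \<rho> t = \<bar>t\<bar>"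
  using sqrt_le_mu by (simp add: width_def)

lemma rho_le_mu: "\<bar>t\<bar> \<le> \<mu> \<Longrightarrow> \<rho> t \<le> \<mu>"
  using sqrt_le_mu by (simp add: width_def)

lemma xs_pos: "\<bar>t\<bar> \<le> T \<Longrightarrow> 0 < xs t"
  using xs_bounds[of t] mult_pos_pos[OF c(1) rho_pos[of t]] by linarith

lemma ratio3_le_1: "\<epsilon> / \<mu> ^ 3 \<le> 1" using eps_le_mu3 mu_pos by simp

lemma ratio2_le_mu: "\<epsilon> / \<mu>\<^sup>2 \<le> \<mu>"
  using eps_le_mu3 mu_pos by (simp add: divide_le_eq power3_eq_cube power2_eq_square)

lemma eps_over_sq: assumes "\<mu> \<le> \<bar>t\<bar>" shows "\<epsilon> / t\<^sup>2 \<le> \<bar>t\<bar>" "\<epsilon> / t\<^sup>2 \<le> \<mu>"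
proof -
  have "\<mu>\<^sup>2 \<le> t\<^sup>2" using assms mu_pos by (simp add: abs_le_square_iff[symmetric])
  moreover have "0 < t\<^sup>2" using assms mu_pos by auto
  ultimately have "\<epsilon> / t\<^sup>2 \<le> \<epsilon> / \<mu>\<^sup>2" using mu_pos eps by (intro divide_left_mono) auto
  then show "\<epsilon> / t\<^sup>2 \<le> \<mu>" using ratio2_le_mu by linarith
  then show "\<epsilon> / t\<^sup>2 \<le> \<bar>t\<bar>" using assms by linarith
qed

lemma xs_slope_le: assumes "\<bar>t\<bar> \<le> T" shows "\<bar>xs' t\<bar> \<le> 2 * C"
proof -
  have tst: "\<bar>t - ts\<bar> \<le> 2 * \<rho> t" using rho_ge[of t] ts a0 by linarith
  have "\<bar>xs' t\<bar> * \<rho> t = \<bar>xs' t * \<rho> t\<bar>" using rho_pos[of t] by (simp add: abs_mult)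
  also have "\<dots> \<le> C * \<bar>t - ts\<bar>"
  proof (cases "ts \<le> t")
    case True
    moreover have "0 \<le> c * (t - ts)" using True c by simp
    ultimately show ?thesis using slope_right[of t] assms by linarith
  next
    case False
    moreover have "0 \<le> c * (ts - t)" using False c by simp
    ultimately show ?thesis using slope_left[of t] assms by (auto simp: abs_if split: if_splits)
  qed
  also have "\<dots> \<le> C * (2 * \<rho> t)" using tst C by (intro mult_left_mono) auto
  finally show ?thesis using rho_pos[of t] by simp
qed

lemma barrier_below:
  assumes "- T \<le> s" "e \<le> T"
    and dz: "\<And>t. t \<in> {s..e} \<Longrightarrow> (z has_real_derivative z' t) (at t)"
    and start: "z s \<le> x s"
    and contact: "\<And>t. t \<in> {s..e} \<Longrightarrow> x t = z t \<Longrightarrow> \<epsilon> * z' t < f (z t) t"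
    and t: "s < t" "t \<le> e"
  shows "z t < x t"
proof -
  have "0 < x t - z t"
  proof (rule barrier_strict[where w = "\<lambda>t. x t - z t" and w' = "\<lambda>t. f (x t) t / \<epsilon> - z' t"
        and s = s and e = e])
    fix u assume u: "u \<in> {s..e}"
    have "(x has_real_derivative f (x u) u / \<epsilon>) (at u within {s..e})"
      by (rule has_field_derivative_subset[OF solution]) (use assms(1,2) u in auto)
    then show "((\<lambda>t. x t - z t) has_real_derivative f (x u) u / \<epsilon> - z' u) (at u within {s..e})"
      using dz[OF u] by (intro DERIV_diff) (auto intro: has_field_derivative_at_within)
    assume "x u - z u = 0"
    then show "0 < f (x u) u / \<epsilon> - z' u"
      using contact[OF u] eps by (simp add: field_simps)
  qed (use start t in auto)
  then show ?thesis by simp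
qed

lemma barrier_above:
  assumes "- T \<le> s" "e \<le> T"
    and dz: "\<And>t. t \<in> {s..e} \<Longrightarrow> (z has_real_derivative z' t) (at t)"
    and start: "x s \<le> z s"
    and contact: "\<And>t. t \<in> {s..e} \<Longrightarrow> x t = z t \<Longrightarrow> f (z t) t < \<epsilon> * z' t"
    and t: "s < t" "t \<le> e"
  shows "x t < z t"
proof -
  have "0 < z t - x t"
  proof (rule barrier_strict[where w = "\<lambda>t. z t - x t" and w' = "\<lambda>t. z' t - f (x t) t / \<epsilon>"
        and s = s and e = e])
    fix u assume u: "u \<in> {s..e}"
    have "(x has_real_derivative f (x u) u / \<epsilon>) (at u within {s..e})"
      by (rule has_field_derivative_subset[OF solution]) (use assms(1,2) u in auto)
    then show "((\<lambda>t. z t - x t) has_real_derivative z' u - f (x u) u / \<epsilon>) (at u within {s..e})"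
      using dz[OF u] by (intro DERIV_diff) (auto intro: has_field_derivative_at_within)
    assume "z u - x u = 0"
    then show "0 < z' u - f (x u) u / \<epsilon>"
      using contact[OF u] eps by (simp add: field_simps)
  qed (use start t in auto)
  then show ?thesis by simp
qed

lemma f_at_xs: "\<bar>t\<bar> \<le> T \<Longrightarrow> f (xs t) t = 0"
  using chord[of t "xs t"] xs_pos[of t] xs_le_d[of t] R by auto

lemma slope_neg: assumes "- T \<le> t" "t < ts" shows "xs' t < 0"
proof -
  have "0 < c * (ts - t)" using assms c by simp
  then have "0 < - xs' t * \<rho> t" using slope_left[of t] assms by linarith
  then show ?thesis using rho_pos[of t] by (simp add: mult_less_0_iff)
qed

lemma slope_pos: assumes "ts < t" "t \<le> T" shows "0 < xs' t"
proof -
  have "0 < c * (t - ts)" using assms c by simp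
  then have "0 < xs' t * \<rho> t" using slope_right[of t] assms by linarith
  then show ?thesis using rho_pos[of t] by (simp add: zero_less_mult_iff)
qed

text \<open>While \<open>xs\<close> decreases it is itself a lower barrier, since the drift vanishes on
  it.\<close>

lemma above_before_minimum:
  assumes "ts \<le> T" "- T \<le> t" "t < ts" shows "xs t < x t"
proof (cases "t = - T")
  case True
  show ?thesis unfolding True using initial mult_pos_pos[OF c(1) eps] by linarith
next
  case False
  show ?thesis
  proof (rule barrier_below[where s = "- T" and e = t and z = xs and z' = xs'])
    fix u assume u: "u \<in> {- T..t}"
    then have uT: "\<bar>u\<bar> \<le> T" using assms by auto
    show "(xs has_real_derivative xs' u) (at u)" by (rule xs_deriv[OF uT])
    show "\<epsilon> * xs' u < f (xs u) u"
      using slope_neg[of u] u assms f_at_xs[OF uT] eps by (simp add: mult_pos_neg)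
  next
    show "xs (- T) \<le> x (- T)" using initial mult_pos_pos[OF c(1) eps] by linarith
  qed (use assms False in auto)
qed

lemma DERIV_inverse_square:
  fixes t :: real assumes "t \<noteq> 0"
  shows "((\<lambda>t. K * \<epsilon> / t\<^sup>2) has_real_derivative - (2 * K * \<epsilon> / t ^ 3)) (at t)"
proof -
  have "((\<lambda>t. K * \<epsilon> / t\<^sup>2) has_real_derivative
      (0 * t\<^sup>2 - K * \<epsilon> * (of_nat 2 * (1 * t ^ (2 - Suc 0)))) / (t\<^sup>2 * t\<^sup>2)) (at t)"
    by (rule DERIV_divide DERIV_const DERIV_power DERIV_ident | use assms in simp)+
  also have "(0 * t\<^sup>2 - K * \<epsilon> * (of_nat 2 * (1 * t ^ (2 - Suc 0)))) / (t\<^sup>2 * t\<^sup>2) = - (2 * K * \<epsilon> / t ^ 3)"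
    using assms by (simp add: eval_nat_numeral)
  finally show ?thesis .
qed

text \<open>At the barrier \<open>xs + C1 \<epsilon> / t^2\<close> the restoring force is at least
  \<open>c^3 t^2 \<cdot> C1 \<epsilon> / t^2\<close>, a constant multiple of \<open>\<epsilon>\<close>, and therefore beats the motion \<open>\<epsilon> xs'\<close>
  of the equilibrium when \<open>C1\<close> is large; the barrier increases relative to \<open>xs\<close> for \<open>t < 0\<close>,
  which only helps.\<close>

lemma before_upper:
  assumes C1: "C \<le> C1" "2 * C < c ^ 3 * C1" "C1 * \<mu> \<le> R"
    and t: "- T \<le> t" "t \<le> - \<mu>"
  shows "x t \<le> xs t + C1 * \<epsilon> / t\<^sup>2"
proof -
  have C1_pos: "0 < C1" using C1 C by linarith
  have start: "x (- T) \<le> xs (- T) + C1 * \<epsilon> / (- T)\<^sup>2"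
  proof -
    have "T\<^sup>2 \<le> 1" using T T_pos by (simp add: power_le_one)
    then have "C1 * \<epsilon> \<le> C1 * \<epsilon> / T\<^sup>2"
      using C1_pos eps T_pos by (simp add: le_divide_eq mult_left_le)
    moreover have "C * \<epsilon> \<le> C1 * \<epsilon>" using C1 eps by simp
    ultimately show ?thesis using initial by simp
  qed
  show ?thesis
  proof (cases "t = - T")
    case True
    then show ?thesis using start by simp
  next
    case False
    have "x t < xs t + C1 * \<epsilon> / t\<^sup>2"
    proof (rule barrier_above[where s = "- T" and e = "t" and
          z' = "\<lambda>t. xs' t + - (2 * C1 * \<epsilon> / t ^ 3)"])
      fix u assume u: "u \<in> {- T..t}"
      then have uT: "\<bar>u\<bar> \<le> T" and um: "u \<le> - \<mu>" using t mu_pos T_pos by auto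
      have u0: "u < 0" using um mu_pos by linarith
      show "((\<lambda>t. xs t + C1 * \<epsilon> / t\<^sup>2) has_real_derivative xs' u + - (2 * C1 * \<epsilon> / u ^ 3)) (at u)"
        using u0 by (intro DERIV_add xs_deriv[OF uT] DERIV_inverse_square) auto
      define z where "z = C1 * \<epsilon> / u\<^sup>2"
      have z: "0 < z" "z \<le> R"
      proof -
        show "0 < z" using C1_pos eps u0 by (auto simp: z_def)
        have "z = C1 * (\<epsilon> / u\<^sup>2)" by (simp add: z_def)
        also have "\<dots> \<le> C1 * \<mu>" using eps_over_sq[of u] um mu_pos C1_pos by (intro mult_left_mono) auto
        finally show "z \<le> R" using C1 by linarith
      qed
      have xsp: "0 < xs u" by (rule xs_pos[OF uT])
      obtain k where k: "c * (xs u + z) * (xs u + z + xs u) \<le> k" "f (xs u + z) u = - k * z"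
        using chord[OF uT, of "xs u + z"] z xsp room[of u] u uT um mu_pos D by force
      \<comment> \<open>the restoring rate is at least \<open>c^3 u^2\<close>, since \<open>xs u \<ge> c \<bar>u\<bar>\<close> outside the inner
        region\<close>
      have "c ^ 3 * u\<^sup>2 = c * (c * \<bar>u\<bar>) * (c * \<bar>u\<bar>)" by (simp add: power3_eq_cube power2_eq_square)
      also have "\<dots> \<le> c * (xs u + z) * (xs u + z + xs u)"
        using xs_bounds[OF uT] rho_outer[of u] um u0 c z xsp by (intro mult_mono) (auto simp: mult_le_0_iff)
      finally have "c ^ 3 * u\<^sup>2 * z \<le> k * z" using k z by (intro mult_right_mono) auto
      moreover have "c ^ 3 * u\<^sup>2 * z = c ^ 3 * C1 * \<epsilon>" using u0 by (simp add: z_def)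
      moreover have "2 * C * \<epsilon> < c ^ 3 * C1 * \<epsilon>" using C1 eps by simp
      moreover have "- (2 * C * \<epsilon>) \<le> \<epsilon> * xs' u"
      proof -
        have "- (2 * C) \<le> xs' u" using xs_slope_le[OF uT] by linarith
        from mult_left_mono[OF this, of \<epsilon>] show ?thesis using eps by (simp add: algebra_simps)
      qed
      moreover have "0 \<le> - (2 * C1 * \<epsilon> / u ^ 3)"
        using u0 C1_pos eps by (simp add: divide_nonneg_neg)
      then have "0 \<le> \<epsilon> * - (2 * C1 * \<epsilon> / u ^ 3)" using eps by (intro mult_nonneg_nonneg) auto
      ultimately show "f (xs u + C1 * \<epsilon> / u\<^sup>2) u < \<epsilon> * (xs' u + - (2 * C1 * \<epsilon> / u ^ 3))"
        using k(2) unfolding z_def[symmetric] distrib_left by linarith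
    qed (use start False t mu_pos T_pos in auto)
    then show ?thesis by simp
  qed
qed

text \<open>Here the motion of the equilibrium is the driving term: before the inner passage
  \<open>xs' \<le> - c / 2\<close>, so that \<open>xs\<close> drops away from the solution at a speed that both the
  restoring force at the barrier and the growth of \<open>\<epsilon> / t^2\<close> fail to match when \<open>c1\<close> is
  small. The condition \<open>c1 \<le> c T^2\<close> places the initial value above the barrier.\<close>

lemma before_lower:
  assumes c1: "0 < c1" "c1 \<le> c * T\<^sup>2" "c1 * (C * (C + 1) * (2 * C + 1) + 2) < c / 2"
    and small: "\<mu> \<le> R"
    and t: "- T \<le> t" "t \<le> - \<mu>"
  shows "xs t + c1 * \<epsilon> / t\<^sup>2 \<le> x t"
proof -
  have start: "xs (- T) + c1 * \<epsilon> / (- T)\<^sup>2 \<le> x (- T)"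
  proof -
    have "c1 * \<epsilon> / T\<^sup>2 \<le> c * \<epsilon>"
      using c1 eps T_pos by (simp add: divide_le_eq mult.commute mult.left_commute)
    then show ?thesis using initial by simp
  qed
  have "c * T\<^sup>2 \<le> 1 * 1" using c T T_pos by (intro mult_mono) (auto simp: power_le_one)
  then have c1_le: "c1 \<le> 1" using c1 by linarith
  show ?thesis
  proof (cases "t = - T")
    case True
    then show ?thesis using start by simp
  next
    case False
    have "xs t + c1 * \<epsilon> / t\<^sup>2 < x t"
    proof (rule barrier_below[where s = "- T" and e = "t" and
          z' = "\<lambda>t. xs' t + - (2 * c1 * \<epsilon> / t ^ 3)"])
      fix u assume u: "u \<in> {- T..t}"
      then have uT: "\<bar>u\<bar> \<le> T" and um: "u \<le> - \<mu>" using t mu_pos T_pos by auto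
      have u0: "u < 0" using um mu_pos by linarith
      have rho: "\<rho> u = \<bar>u\<bar>" using rho_outer[of u] um u0 by auto
      show "((\<lambda>t. xs t + c1 * \<epsilon> / t\<^sup>2) has_real_derivative xs' u + - (2 * c1 * \<epsilon> / u ^ 3)) (at u)"
        using u0 by (intro DERIV_add xs_deriv[OF uT] DERIV_inverse_square) auto
      define z where "z = c1 * \<epsilon> / u\<^sup>2"
      have "z = c1 * (\<epsilon> / u\<^sup>2)" by (simp add: z_def)
      also have "\<dots> \<le> 1 * (\<epsilon> / u\<^sup>2)" using c1_le eps by (intro mult_right_mono) auto
      finally have z1: "z \<le> \<epsilon> / u\<^sup>2" by simp
      have z: "0 < z" "z \<le> R" "z \<le> \<bar>u\<bar>"
        using z1 eps_over_sq[of u] um u0 small c1 eps by (auto simp: z_def)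
      have xsp: "0 < xs u" by (rule xs_pos[OF uT])
      obtain k where k: "k \<le> C * (xs u + z) * (xs u + z + xs u)" "f (xs u + z) u = - k * z"
        using chord[OF uT, of "xs u + z"] z xsp room[of u] u uT um mu_pos D by force
      have xsu: "xs u \<le> C * \<bar>u\<bar>" using xs_bounds[OF uT] rho by auto
      have "C * (xs u + z) * (xs u + z + xs u) \<le> C * ((C + 1) * \<bar>u\<bar>) * ((2 * C + 1) * \<bar>u\<bar>)"
        using xsu C z xsp by (intro mult_mono) (auto simp: algebra_simps)
      also have "\<dots> = C * (C + 1) * (2 * C + 1) * u\<^sup>2"
        by (simp add: power2_eq_square algebra_simps)
      finally have "k * z \<le> C * (C + 1) * (2 * C + 1) * u\<^sup>2 * z" using k z by (intro mult_right_mono) auto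
      also have "\<dots> = c1 * (C * (C + 1) * (2 * C + 1)) * \<epsilon>" using u0 by (simp add: z_def)
      finally have kz: "k * z \<le> c1 * (C * (C + 1) * (2 * C + 1)) * \<epsilon>" .
      have "- (2 * c1 * \<epsilon> / u ^ 3) \<le> 2 * c1"
      proof -
        have "\<epsilon> / u\<^sup>2 / \<bar>u\<bar> \<le> 1" using eps_over_sq(1)[of u] um u0 by (simp only: divide_le_eq) auto
        then have "2 * c1 * (\<epsilon> / u\<^sup>2 / \<bar>u\<bar>) \<le> 2 * c1 * 1" using c1 by (intro mult_left_mono) auto
        moreover have "2 * c1 * (\<epsilon> / u\<^sup>2 / \<bar>u\<bar>) = - (2 * c1 * \<epsilon> / u ^ 3)"
          using u0 by (simp add: eval_nat_numeral)
        ultimately show ?thesis by simp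
      qed
      moreover have "xs' u \<le> - c / 2"
      proof -
        have tsu: "\<bar>u\<bar> / 2 \<le> ts - u" using ts_mu um u0 by linarith
        then have "c * (\<bar>u\<bar> / 2) \<le> c * (ts - u)" using c by simp
        also have "\<dots> \<le> - xs' u * \<bar>u\<bar>" using slope_left[of u] tsu u u0 rho by auto
        finally have "(c / 2) * \<bar>u\<bar> \<le> - xs' u * \<bar>u\<bar>" by simp
        then show ?thesis using u0 mult_le_cancel_right[of "c/2" "\<bar>u\<bar>" "- xs' u"] by auto
      qed
      ultimately have "xs' u + - (2 * c1 * \<epsilon> / u ^ 3) < - (c1 * (C * (C + 1) * (2 * C + 1)))"
        using c1(3) by (simp add: algebra_simps)
      then have "\<epsilon> * (xs' u + - (2 * c1 * \<epsilon> / u ^ 3)) < \<epsilon> * - (c1 * (C * (C + 1) * (2 * C + 1)))"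
        using eps by (intro mult_strict_left_mono) auto
      then show "\<epsilon> * (xs' u + - (2 * c1 * \<epsilon> / u ^ 3)) < f (xs u + c1 * \<epsilon> / u\<^sup>2) u"
        using k(2) kz unfolding z_def[symmetric] by (simp add: algebra_simps)
    qed (use start False t mu_pos T_pos in auto)
    then show ?thesis by simp
  qed
qed

section \<open>The inner passage and the delay of the crossing\<close>

text \<open>An upper bound for the restoring rate in the inner region, in units of \<open>\<mu>^2\<close>.\<close>

definition K0 :: real where "K0 = C * (C + 1) * (2 * C + 1)"

lemma chord_inner:
  assumes t: "\<bar>t\<bar> \<le> \<mu>" and small: "\<mu> \<le> R" "\<mu> \<le> D" and z: "0 \<le> z" "z \<le> \<mu>"
  shows "- (K0 * \<mu>\<^sup>2) * z \<le> f (xs t + z) t"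
proof -
  have tT: "\<bar>t\<bar> \<le> T" using t small D by linarith
  have xsp: "0 < xs t" by (rule xs_pos[OF tT])
  obtain k where k: "k \<le> C * (xs t + z) * (xs t + z + xs t)" "f (xs t + z) t = - k * z"
    using chord[OF tT, of "xs t + z"] z xsp room[of t] tT t small by force
  have "C * \<rho> t \<le> C * \<mu>" using rho_le_mu[OF t] C by simp
  then have xsu: "xs t \<le> C * \<mu>" using xs_bounds[OF tT] by linarith
  have "C * (xs t + z) * (xs t + z + xs t) \<le> C * ((C + 1) * \<mu>) * ((2 * C + 1) * \<mu>)"
    using xsu C z xsp mu_pos by (intro mult_mono) (auto simp: algebra_simps)
  also have "\<dots> = K0 * \<mu>\<^sup>2" by (simp add: K0_def power2_eq_square algebra_simps)
  finally have "k * z \<le> K0 * \<mu>\<^sup>2 * z" using k z by (intro mult_right_mono) auto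
  then show ?thesis using k by simp
qed

text \<open>If \<open>\<mu> = sqrt a0\<close>, the lag behind the equilibrium should be about \<open>\<epsilon> \<bar>xs'\<bar> / \<mu>^2\<close>
  for \<open>\<bar>t\<bar> \<le> \<mu>\<close>, and \<open>xs'\<close> has order \<open>(t - ts) / \<mu>\<close>. This suggests the linear lower barrier
  with slope of order \<open>\<epsilon> / \<mu>^3\<close>. It is made to vanish a time \<open>h \<epsilon> / \<mu>^2\<close> after \<open>ts\<close>, so that
  a positive gap of order \<open>\<epsilon>^2 / \<mu>^5\<close> is left at \<open>ts\<close>: it is this gap that delays the
  crossing.\<close>

lemma at_minimum:
  assumes g: "0 < g" "0 < h" "g * (3/2 + h) \<le> c1" "g * (3/2 + h) \<le> 1" "K0 * g \<le> c" "K0 * h < 1"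
    and small: "\<mu> \<le> R" "\<mu> \<le> D"
    and start: "xs (- \<mu>) + c1 * \<epsilon> / \<mu>\<^sup>2 \<le> x (- \<mu>)"
  shows "xs ts + g * h * \<epsilon>\<^sup>2 / \<mu> ^ 5 < x ts"
proof -
  \<comment> \<open>\<open>q \<le> 1\<close> is the ratio of the lag \<open>\<epsilon> / \<mu>^2\<close> to \<open>\<mu>\<close>; all quantities below are
    written in terms of \<open>q\<close> and \<open>\<mu>\<close>\<close>
  define q where "q = \<epsilon> / \<mu> ^ 3"
  have q: "0 < q" "q \<le> 1" using ratio3_le_1 eps mu_pos by (auto simp: q_def)
  have q2: "\<epsilon> / \<mu>\<^sup>2 = q * \<mu>" using mu_pos by (simp add: q_def eval_nat_numeral)
  have q5: "\<epsilon>\<^sup>2 / \<mu> ^ 5 = q * (q * \<mu>)" using mu_pos by (simp add: q_def eval_nat_numeral)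
  define z where "z = (\<lambda>t. g * q * (ts + h * q * \<mu> - t))"
  have z_le: "z t \<le> g * (3/2 + h) * (q * \<mu>)" and z_ge: "0 \<le> z t" if t: "- \<mu> \<le> t" "t \<le> ts" for t
  proof -
    have "h * q * \<mu> \<le> h * 1 * \<mu>" using q g mu_pos by (intro mult_mono) auto
    then have "ts + h * q * \<mu> - t \<le> (3/2 + h) * \<mu>" using ts_mu t by (simp add: algebra_simps)
    then have "g * q * (ts + h * q * \<mu> - t) \<le> g * q * ((3/2 + h) * \<mu>)"
      using g q by (intro mult_left_mono) auto
    then show "z t \<le> g * (3/2 + h) * (q * \<mu>)" by (simp add: z_def algebra_simps)
    have "0 \<le> h * q * \<mu>" using g q mu_pos by simp
    then show "0 \<le> z t" unfolding z_def using g q t by (intro mult_nonneg_nonneg) auto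
  qed
  have qm: "0 < q * \<mu>" "q * \<mu> \<le> \<mu>" using q mu_pos by (auto simp: mult_le_cancel_right1)
  have "xs ts + z ts < x ts"
  proof (rule barrier_below[where s = "- \<mu>" and e = ts and z' = "\<lambda>t. xs' t + - (g * q)"])
    fix t assume t: "t \<in> {- \<mu>..ts}"
    have tm: "\<bar>t\<bar> \<le> \<mu>" using t ts_mu mu_pos by auto
    have tT: "\<bar>t\<bar> \<le> T" using tm small D by linarith
    show "((\<lambda>t. xs t + z t) has_real_derivative xs' t + - (g * q)) (at t)"
      unfolding z_def by (intro DERIV_add xs_deriv[OF tT]) (auto intro!: derivative_eq_intros)
    have "z t \<le> 1 * (q * \<mu>)" using z_le[of t] t g qm by (intro order_trans[OF z_le] mult_right_mono) auto
    then have "- (K0 * \<mu>\<^sup>2) * z t \<le> f (xs t + z t) t"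
      using qm z_ge[of t] t by (intro chord_inner[OF tm small]) auto
    moreover have "\<epsilon> * (xs' t + - (g * q)) < - (K0 * \<mu>\<^sup>2) * z t"
    proof -
      have eX: "\<epsilon> * X = \<mu>\<^sup>2 * ((q * \<mu>) * X)" for X
    using mu_pos by (simp add: q_def eval_nat_numeral)
      have "c * (ts - t) \<le> - xs' t * \<rho> t" using slope_left[of t] t tT by auto
      also have "\<dots> \<le> - xs' t * \<mu>"
      proof (intro mult_left_mono rho_le_mu[OF tm])
        have "0 \<le> - xs' t * \<rho> t" using \<open>c * (ts - t) \<le> - xs' t * \<rho> t\<close> t c
          by (intro order_trans[OF _ \<open>c * (ts - t) \<le> - xs' t * \<rho> t\<close>] mult_nonneg_nonneg) auto
        then show "0 \<le> - xs' t" using rho_pos[of t] by (simp add: mult_le_0_iff)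
      qed
      finally have s1: "c * (ts - t) \<le> - xs' t * \<mu>" .
      have "K0 * z t = (K0 * g) * q * (ts - t) + (K0 * h) * (g * q * q * \<mu>)"
        by (simp add: z_def algebra_simps)
      also have "\<dots> < c * q * (ts - t) + 1 * (g * q * q * \<mu>)"
        using g q t mu_pos by (intro add_le_less_mono mult_right_mono mult_strict_right_mono) auto
      also have "\<dots> \<le> q * (- xs' t * \<mu>) + g * q * q * \<mu>"
        using mult_left_mono[OF s1, of q] q by (simp add: algebra_simps)
      finally have "K0 * z t < - (q * \<mu>) * (xs' t + - (g * q))" by (simp add: algebra_simps)
      then have "\<mu>\<^sup>2 * (K0 * z t) < \<mu>\<^sup>2 * (- (q * \<mu>) * (xs' t + - (g * q)))"
        using mu_pos by (intro mult_strict_left_mono) auto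
      then show ?thesis unfolding eX by (simp add: algebra_simps)
    qed
    ultimately show "\<epsilon> * (xs' t + - (g * q)) < f (xs t + z t) t" by linarith
  next
    have "z (- \<mu>) \<le> c1 * (q * \<mu>)"
      using ts_mu mu_pos g qm by (intro order_trans[OF z_le] mult_right_mono) auto
    then show "xs (- \<mu>) + z (- \<mu>) \<le> x (- \<mu>)" using start unfolding times_divide_eq_right[symmetric] q2 by linarith
  qed (use ts_mu mu_pos small D in auto)
  then show ?thesis unfolding times_divide_eq_right[symmetric] q5 by (simp add: z_def algebra_simps)
qed

text \<open>After \<open>ts\<close> the equilibrium rises, and the gap left at \<open>ts\<close> is consumed at a
  speed of order at most \<open>\<epsilon> / \<mu>^3\<close>, which takes a time of order \<open>\<epsilon> / \<mu>^2\<close>. This is the lower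
  bound for the crossing time.\<close>

lemma after_minimum:
  assumes g: "0 < G" "G \<le> 1" "K0 * G + 2 * C < M" "M * m \<le> G" "0 < m" "m \<le> 1/2"
    and small: "\<mu> \<le> R" "\<mu> \<le> D"
    and start: "xs ts + G * \<epsilon>\<^sup>2 / \<mu> ^ 5 < x ts"
    and t: "ts \<le> t" "t \<le> ts + m * \<epsilon> / \<mu>\<^sup>2"
  shows "xs t < x t"
proof -
  define q where "q = \<epsilon> / \<mu> ^ 3"
  have q: "0 < q" "q \<le> 1" using ratio3_le_1 eps mu_pos by (auto simp: q_def)
  have q2: "\<epsilon> / \<mu>\<^sup>2 = q * \<mu>" using mu_pos by (simp add: q_def eval_nat_numeral)
  have q5: "\<epsilon>\<^sup>2 / \<mu> ^ 5 = q * (q * \<mu>)" using mu_pos by (simp add: q_def eval_nat_numeral)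
  have eX: "\<epsilon> * X = \<mu>\<^sup>2 * ((q * \<mu>) * X)" for X
    using mu_pos by (simp add: q_def eval_nat_numeral)
  have qm: "0 < q * \<mu>" "q * \<mu> \<le> \<mu>" using q mu_pos by (auto simp: mult_le_cancel_right1)
  have "0 \<le> K0 * G" using g C by (simp add: K0_def)
  then have M: "0 < M" using g C by linarith
  define z where "z = (\<lambda>t. G * q * (q * \<mu>) - M * q * (t - ts))"
  have start': "xs ts + z ts < x ts"
    using start unfolding times_divide_eq_right[symmetric] q5 by (simp add: z_def algebra_simps)
  have z_ge: "0 \<le> z u" if u: "ts \<le> u" "u \<le> ts + m * (q * \<mu>)" for u
  proof -
    have "M * q * (u - ts) \<le> M * q * (m * (q * \<mu>))" using u M q by (intro mult_left_mono) auto
    also have "\<dots> = (M * m) * (q * (q * \<mu>))" by (simp add: algebra_simps)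
    also have "\<dots> \<le> G * (q * (q * \<mu>))" using g q mu_pos by (intro mult_right_mono) auto
    finally show ?thesis by (simp add: z_def algebra_simps)
  qed
  have te: "t \<le> ts + m * (q * \<mu>)" using t unfolding times_divide_eq_right[symmetric] q2 by simp
  have mq: "m * (q * \<mu>) \<le> \<mu> / 2"
    using mult_mono[OF g(6) qm(2)] g qm mu_pos by simp
  show ?thesis
  proof (cases "t = ts")
    case True
    then show ?thesis using start' z_ge[of ts] g qm by (simp add: mult_nonneg_nonneg)
  next
    case False
    have "xs t + z t < x t"
    proof (rule barrier_below[where s = ts and e = t and z' = "\<lambda>t. xs' t + - (M * q)"])
      fix u assume u: "u \<in> {ts..t}"
      have um: "\<bar>u\<bar> \<le> \<mu>" using u te mq ts_mu by auto
      have uT: "\<bar>u\<bar> \<le> T" using um small D by linarith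
      show "((\<lambda>t. xs t + z t) has_real_derivative xs' u + - (M * q)) (at u)"
        unfolding z_def by (intro DERIV_add xs_deriv[OF uT]) (auto intro!: derivative_eq_intros)
      have zu: "0 \<le> z u" using z_ge[of u] u te by auto
      have zG: "z u \<le> G * q * (q * \<mu>)" using u M q by (simp add: z_def)
      also have "\<dots> \<le> 1 * 1 * \<mu>" using g q qm by (intro mult_mono) auto
      finally have "- (K0 * \<mu>\<^sup>2) * z u \<le> f (xs u + z u) u"
        using zu by (intro chord_inner[OF um small]) auto
      moreover have "\<epsilon> * (xs' u + - (M * q)) < - (K0 * \<mu>\<^sup>2) * z u"
      proof -
        have K0: "0 \<le> K0" using C by (simp add: K0_def)
        \<comment> \<open>if \<open>q = 1\<close> the speed bound for \<open>xs\<close> suffices; otherwise \<open>\<mu> = sqrt a0\<close> and \<open>xs'\<close>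
          is small because \<open>u - ts\<close> is at most \<open>m q \<mu>\<close>\<close>
        have xq: "xs' u \<le> 2 * C * q"
        proof (cases "sqrt a0 \<le> \<epsilon> powr (1/3)")
          case True
          then have "\<mu> ^ 3 = \<epsilon>" using cube_root by (simp add: inner_scale_def max_absorb2)
          then have "q = 1" using eps by (simp add: q_def)
          then show ?thesis using xs_slope_le[OF uT] by simp
        next
          case False
          then have mu: "\<mu> = sqrt a0" by (simp add: inner_scale_def)
          have su: "0 \<le> c * (u - ts)" using u c by simp
          have "u \<le> T" using uT by linarith
          then have s0: "0 \<le> xs' u * \<rho> u" using slope_right[of u] u su by force
          then have x0: "0 \<le> xs' u" using rho_pos[of u] by (simp add: zero_le_mult_iff)
          have "xs' u * \<mu> \<le> xs' u * \<rho> u" using x0 rho_ge(2) mu by (intro mult_left_mono) auto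
          also have "\<dots> \<le> C * (u - ts)" using slope_right[of u] u uT by auto
          also have "\<dots> \<le> C * (m * (q * \<mu>))" using u te C by (intro mult_left_mono) auto
          also have "\<dots> \<le> C * (1 * (q * \<mu>))" using g qm C by (intro mult_left_mono mult_right_mono) auto
          finally have "xs' u * \<mu> \<le> (C * q) * \<mu>" by (simp add: algebra_simps)
          then have "xs' u \<le> C * q" using mu_pos by simp
          moreover have "0 \<le> C * q" using C q by simp
          ultimately show ?thesis by simp
        qed
        have "K0 * z u \<le> K0 * (G * q * (q * \<mu>))" using zG K0 by (intro mult_left_mono) auto
        also have "\<dots> = (K0 * G) * (q * (q * \<mu>))" by (simp add: algebra_simps)
        also have "\<dots> < (M - 2 * C) * (q * (q * \<mu>))" using g q qm by (intro mult_strict_right_mono) auto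
        also have "\<dots> = (q * \<mu>) * (M * q - 2 * C * q)" by (simp add: algebra_simps)
        also have "\<dots> \<le> (q * \<mu>) * (M * q - xs' u)" using qm xq by (intro mult_left_mono) auto
        finally have "\<mu>\<^sup>2 * (K0 * z u) < \<mu>\<^sup>2 * ((q * \<mu>) * (M * q - xs' u))"
          using mu_pos by (intro mult_strict_left_mono) auto
        then show ?thesis unfolding eX by (simp add: algebra_simps)
      qed
      ultimately show "\<epsilon> * (xs' u + - (M * q)) < f (xs u + z u) u" by linarith
    qed (use start' False t te mq ts_mu small D in auto)
    then show ?thesis using z_ge[of t] t te by auto
  qed
qed

text \<open>Above the equilibrium the drift is negative, so constants are upper barriers.\<close>

lemma falls_while_above:
  assumes X: "x (- \<mu>) \<le> X" "X \<le> R" and e: "\<mu> \<le> T" "e \<le> D"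
    and above: "\<And>u. - \<mu> \<le> u \<Longrightarrow> u \<le> e \<Longrightarrow> xs u < x u"
    and t: "- \<mu> \<le> t" "t \<le> e"
  shows "x t \<le> X"
proof (cases "t = - \<mu>")
  case False
  have "x t < X"
  proof (rule barrier_above[where z = "\<lambda>_. X" and z' = "\<lambda>_. 0" and s = "- \<mu>" and e = t])
    fix u assume u: "u \<in> {- \<mu>..t}" and xu: "x u = X"
    have uT: "\<bar>u\<bar> \<le> T" using u e t D by auto
    have xsu: "0 < xs u" "xs u < X" using above[of u] xs_pos[OF uT] u t xu by auto
    have "X \<le> d" using xsu X room[of u] uT u t e D by auto
    then obtain k where k: "c * X * (X + xs u) \<le> k" "f X u = - k * (X - xs u)"
      using chord[OF uT, of X] xsu X by force
    have "0 < c * X * (X + xs u)" using c xsu by (intro mult_pos_pos) auto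
    then show "f X u < \<epsilon> * 0" using k xsu by (simp add: mult_pos_neg)
  qed (use X e t False D in auto)
  then show ?thesis by simp
qed (use X in auto)

end

section \<open>Existence and uniqueness of the crossing, and a quantitative floor for the solution\<close>

text \<open>The identity in the proof writes the quartic as a sum of squares and a positive
  constant. Near \<open>s = 2/3\<close> it drops to about a tenth of its value at \<open>0\<close>.\<close>

lemma quartic_pos: "0 < 1160 * s ^ 4 - 414 * s ^ 3 - 662 * s\<^sup>2 + 64 * s + (159::real)"
proof -
  have eq: "1160 * s ^ 4 - 414 * s ^ 3 - 662 * s\<^sup>2 + 64 * s + 159 =
     1160 * (s\<^sup>2 - 207/1160 * s - 33/100)\<^sup>2 + 66 * (s - 11/20)\<^sup>2 + (s / 10 - 1 / 10)\<^sup>2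
      + (77327/1160 - 66 - 1/100) * s\<^sup>2 + (8169/250 - 66 * 121/400 - 1/100)"
    by (simp add: power2_eq_square power3_eq_cube power4_eq_xxxx field_simps)
  show ?thesis unfolding eq by (intro add_nonneg_pos add_nonneg_nonneg) auto
qed

text \<open>In the variables \<open>s = t / \<theta>\<close> and \<open>v = B x^2 / (p \<theta>^2)\<close> with \<open>p \<theta>^3 = \<epsilon>\<close>, the
  lower bound \<open>x (A - B x^2)\<close> of the drift turns into \<open>v' = 2 v (\<alpha> + s^2 - v)\<close>, where
  \<open>\<alpha> = a0 / (p \<theta>^2) \<ge> 0\<close>. The inequality says that \<open>v = (20 (\<alpha> + s^2) - 23 s + 22) / 49\<close> is
  a strict subsolution, uniformly in \<open>\<alpha>\<close>, that is, in all regimes of \<open>a0\<close> against \<open>\<epsilon>\<close> at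
  once.

  The coefficients matter here. The linearization at the solution is negative only if
  \<open>v > (\<alpha> + s^2) / 3\<close>, and the worst case \<open>\<alpha> = 0\<close>, in which \<open>v\<close> lags behind \<open>s^2\<close> after
  passing \<open>s = 0\<close>, leaves limited room. This is the one place where orders of magnitude are
  not enough. The term \<open>- 23 s + 22\<close> moves the minimum of \<open>v\<close> to a positive time and keeps
  its value there positive, as it is for the solution itself.\<close>

lemma scaled_subsolution:
  fixes s \<alpha> :: real
  assumes "0 \<le> \<alpha>"
  shows "49 * (40 * s - 23) <
    2 * (20 * (\<alpha> + s\<^sup>2) - 23 * s + 22) * (29 * (\<alpha> + s\<^sup>2) + 23 * s - 22)"
proof -
  have eq: "2 * (20 * (\<alpha> + s\<^sup>2) - 23 * s + 22) * (29 * (\<alpha> + s\<^sup>2) + 23 * s - 22) - 49 * (40 * s - 23)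
    = (1160 * s ^ 4 - 414 * s ^ 3 - 662 * s\<^sup>2 + 64 * s + 159)
      + 2 * \<alpha> * (1000 * s\<^sup>2 + 160 * (s - 207/320)\<^sup>2 + (198 - 207\<^sup>2/640)) + 1160 * \<alpha>\<^sup>2"
    by (simp add: power2_eq_square power3_eq_cube power4_eq_xxxx field_simps)
  have "0 \<le> 2 * \<alpha> * (1000 * s\<^sup>2 + 160 * (s - 207/320)\<^sup>2 + (198 - 207\<^sup>2/640)) + 1160 * \<alpha>\<^sup>2"
    using assms by (intro add_nonneg_nonneg mult_nonneg_nonneg) auto
  then show ?thesis using quartic_pos[of s] eq by linarith
qed

context slow_passage
begin

text \<open>As long as \<open>x > xs\<close> on the inner passage, \<open>x\<close> stays below its value at \<open>- \<mu>\<close>,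
  while \<open>xs\<close> grows at least like \<open>c t\<close>; so the two meet before \<open>L \<mu>\<close>. The first meeting
  occurs after \<open>ts\<close>, where \<open>xs\<close> increases and is an upper barrier. Hence it is the only one.\<close>

lemma crossing_exists:
  assumes after: "\<And>t. ts \<le> t \<Longrightarrow> t \<le> ts + m * \<epsilon> / \<mu>\<^sup>2 \<Longrightarrow> xs t < x t" "0 < m" "m \<le> 1/2"
    and X: "x (- \<mu>) \<le> X" "X \<le> R" "X \<le> c * (L * \<mu>)"
    and L: "1 \<le> L" "L * \<mu> \<le> D"
  shows "\<exists>tc. ts + m * \<epsilon> / \<mu>\<^sup>2 < tc \<and> tc \<le> L * \<mu> \<and> x tc = xs tc \<and>
    (\<forall>t. - T \<le> t \<and> t < tc \<longrightarrow> xs t < x t) \<and> (\<forall>t. tc < t \<and> t \<le> T \<longrightarrow> x t < xs t)"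
proof -
  have muL: "\<mu> \<le> L * \<mu>" using L mu_pos by simp
  have tsT: "ts \<le> T" "- T < ts" using ts_mu muL L D mu_pos by linarith+
  define e where "e = ts + m * \<epsilon> / \<mu>\<^sup>2"
  have "m * (\<epsilon> / \<mu>\<^sup>2) \<le> (1/2) * \<mu>"
    using after ratio2_le_mu eps mu_pos by (intro mult_mono) auto
  moreover have "0 < m * (\<epsilon> / \<mu>\<^sup>2)" using after eps mu_pos by simp
  moreover have "e = ts + m * (\<epsilon> / \<mu>\<^sup>2)" by (simp add: e_def)
  ultimately have e: "ts < e" "e \<le> \<mu>" using ts_mu by linarith+
  have early: "xs t < x t" if "- T \<le> t" "t \<le> e" for t
    using that above_before_minimum[OF tsT(1), of t] after(1)[of t] by (cases "t < ts") (auto simp: e_def)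
  have "\<exists>t. - T \<le> t \<and> t \<le> L * \<mu> \<and> x t \<le> xs t"
  proof (rule ccontr)
    assume no: "\<not> ?thesis"
    have \<mu>T: "\<mu> \<le> D" "\<mu> \<le> T" using muL L D by linarith+
    have ab: "xs u < x u" if "- \<mu> \<le> u" "u \<le> L * \<mu>" for u
    proof -
      have "- T \<le> u" using that \<mu>T by linarith
      then show ?thesis using no that by force
    qed
    have L0: "- \<mu> \<le> L * \<mu>" using muL mu_pos by linarith
    have "x (L * \<mu>) \<le> X"
      by (rule falls_while_above[OF X(1,2) \<mu>T(2) L(2) ab L0 order_refl])
    also have "\<dots> \<le> c * \<rho> (L * \<mu>)" using X rho_outer[of "L * \<mu>"] muL mu_pos by simp
    also have "\<dots> \<le> xs (L * \<mu>)" using xs_bounds[of "L * \<mu>"] L D mu_pos by simp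
    finally have "x (L * \<mu>) \<le> xs (L * \<mu>)" .
    moreover have "- T \<le> L * \<mu>" using muL mu_pos T_pos by linarith
    ultimately show False using no by blast
  qed
  then obtain t0 where t0: "- T \<le> t0" "t0 \<le> L * \<mu>" "x t0 \<le> xs t0" by blast
  have contx: "continuous_on {- T..T} x"
    by (rule DERIV_continuous_on[OF solution]) auto
  have contxs: "continuous_on {- T..T} xs"
    by (rule DERIV_continuous_on[where D = xs']) (auto intro!: has_field_derivative_at_within[OF xs_deriv])
  have cont: "continuous_on {- T..T} (\<lambda>t. x t - xs t)"
    by (intro continuous_on_diff contx contxs)
  define S where "S = {t \<in> {- T..L * \<mu>}. x t - xs t \<in> {..0}}"
  have "closed S"
    using continuous_closed_preimage[OF continuous_on_subset[OF cont, of "{- T..L * \<mu>}"] closed_atLeastAtMost closed_atMost[of 0]] L D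
    by (simp add: S_def vimage_def Int_def)
  have bdd: "bdd_below S" by (auto simp: S_def intro: bdd_belowI[of _ "- T"])
  define tc where "tc = Inf S"
  have "t0 \<in> S" using t0 by (auto simp: S_def)
  then have tcS: "tc \<in> S" unfolding tc_def
    by (intro closed_contains_Inf bdd \<open>closed S\<close>) auto
  have tcT: "- T \<le> tc" "tc \<le> T" using tcS L D by (auto simp: S_def)
  have before: "xs t < x t" if "- T \<le> t" "t < tc" for t
  proof (rule ccontr)
    assume "\<not> xs t < x t"
    then have "t \<in> S" using that tcS by (auto simp: S_def)
    then show False using cInf_lower[OF _ bdd] that tc_def by fastforce
  qed
  have e_tc: "e < tc"
    using early[of tc] tcS by (force simp: S_def)
  have eq: "x tc = xs tc"
  proof (rule ccontr)
    assume "x tc \<noteq> xs tc"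
    then have lt: "x tc - xs tc < 0" using tcS by (auto simp: S_def)
    have Te: "- T \<le> e" using e tsT by linarith
    have "\<exists>u\<ge>e. u \<le> tc \<and> x u - xs u = 0"
      using early[of e] Te lt e_tc tcT
      by (intro IVT2' continuous_on_subset[OF cont]) auto
    then obtain u where u: "e \<le> u" "u \<le> tc" "x u = xs u" by auto
    then have "u < tc" using lt by (cases "u = tc") auto
    then show False using before[of u] u Te by auto
  qed
  have later: "x t < xs t" if t: "tc < t" "t \<le> T" for t
  proof (rule barrier_above[where s = tc and e = t and z' = xs'])
    fix u assume u: "u \<in> {tc..t}"
    then have uT: "\<bar>u\<bar> \<le> T" using tcT t by auto
    show "(xs has_real_derivative xs' u) (at u)" by (rule xs_deriv[OF uT])
    show "f (xs u) u < \<epsilon> * xs' u"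
      using slope_pos[of u] u e_tc e uT f_at_xs[OF uT] eps by simp
  qed (use t tcT eq in auto)
  show ?thesis using e_tc eq before later tcS by (intro exI[of _ tc]) (auto simp: e_def S_def)
qed

text \<open>Worst-case coefficients: near the bifurcation the drift is at least
  \<open>x (a0 + p t^2 - B x^2)\<close>.\<close>

definition p :: real where "p = a1 - \<eta>"
definition B :: real where "B = b + \<eta>"

definition A :: "real \<Rightarrow> real" where "A t = a0 + p * t\<^sup>2"

lemma B_pos: "0 < B" and p_pos: "0 < p" using coeffs by (auto simp: p_def B_def)

lemma drift_lower:
  assumes "\<bar>t\<bar> \<le> D" "0 < \<xi>" "\<xi> \<le> R0"
  shows "\<xi> * (A t - B * \<xi>\<^sup>2) \<le> f \<xi> t"
  using normal_form[OF assms] by (simp add: A_def p_def B_def algebra_simps abs_le_iff)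

lemma xs_square: assumes "\<bar>t\<bar> \<le> D" shows "A t \<le> B * (xs t)\<^sup>2"
proof -
  have tT: "\<bar>t\<bar> \<le> T" using assms D by linarith
  have "xs t * (A t - B * (xs t)\<^sup>2) \<le> 0"
    using drift_lower[OF assms xs_pos[OF tT]] xs_small[OF assms] R0 f_at_xs[OF tT] by simp
  then show ?thesis using xs_pos[OF tT] by (simp add: mult_le_0_iff)
qed

text \<open>Lower bounds for \<open>x^2\<close> instead of \<open>x\<close>: for \<open>u = x^2\<close> the lower drift is the
  logistic right-hand side \<open>2 u (A - B u) / \<epsilon>\<close>, for which polynomials can serve as
  subsolutions.\<close>

lemma square_barrier:
  assumes se: "- D \<le> s" "e \<le> D"
    and k_pos: "\<And>t. t \<in> {s..e} \<Longrightarrow> 0 < \<kappa> t" and k_le: "\<And>t. t \<in> {s..e} \<Longrightarrow> \<kappa> t \<le> R0\<^sup>2"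
    and dk: "\<And>t. t \<in> {s..e} \<Longrightarrow> (\<kappa> has_real_derivative \<kappa>' t) (at t)"
    and sub: "\<And>t. t \<in> {s..e} \<Longrightarrow> \<epsilon> * \<kappa>' t < 2 * \<kappa> t * (A t - B * \<kappa> t)"
    and start: "0 < x s" "\<kappa> s \<le> (x s)\<^sup>2"
    and t: "s < t" "t \<le> e"
  shows "0 < x t \<and> \<kappa> t \<le> (x t)\<^sup>2"
proof -
  have "sqrt (\<kappa> t) < x t"
  proof (rule barrier_below[where s = s and e = e and z' = "\<lambda>t. inverse (sqrt (\<kappa> t)) / 2 * \<kappa>' t"])
    fix u assume u: "u \<in> {s..e}"
    have ku: "0 < \<kappa> u" by (rule k_pos[OF u])
    show "((\<lambda>t. sqrt (\<kappa> t)) has_real_derivative inverse (sqrt (\<kappa> u)) / 2 * \<kappa>' u) (at u)"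
      by (rule DERIV_chain2[OF DERIV_real_sqrt[OF ku] dk[OF u]])
    define r where "r = sqrt (\<kappa> u)"
    have r: "0 < r" "\<kappa> u = r\<^sup>2" "r \<le> R0"
      using ku k_le[OF u] R0 by (auto simp: r_def real_le_lsqrt)
    have "\<epsilon> * \<kappa>' u < 2 * r * (r * (A u - B * r\<^sup>2))" using sub[OF u] r by (simp add: power2_eq_square algebra_simps)
    also have "\<dots> \<le> 2 * r * f r u"
      using r u se by (intro mult_left_mono drift_lower) auto
    finally show "\<epsilon> * (inverse (sqrt (\<kappa> u)) / 2 * \<kappa>' u) < f (sqrt (\<kappa> u)) u"
      using r by (simp add: r_def[symmetric] field_simps)
  next
    show "sqrt (\<kappa> s) \<le> x s" using start by (simp add: real_le_lsqrt)
  qed (use se D t in auto)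
  moreover have k: "0 < sqrt (\<kappa> t)" using k_pos[of t] t by simp
  ultimately show ?thesis
    by (intro conjI) (linarith, simp add: sqrt_le_D less_imp_le)
qed

text \<open>Up to \<open>t1 = 23/20 \<theta>\<close> the rescaled subsolution \<open>\<kappa>\<close> is a lower barrier for \<open>x^2\<close>.
  It satisfies \<open>20 A \<le> 59 B \<kappa>\<close> there, and this inequality fails soon after \<open>t1\<close> when \<open>a0\<close> is
  negligible. From \<open>t1\<close> on, \<open>20 A / (59 B)\<close> itself is a subsolution. The ratio \<open>59/20 < 3\<close>
  is what makes \<open>A - 3 B x^2\<close>, which controls the linearization, negative.\<close>

lemma square_floor:
  assumes th: "0 < \<theta>" "p * \<theta> ^ 3 = \<epsilon>" "2 * \<theta> \<le> D" and room: "a0 + p * D\<^sup>2 \<le> B * R0\<^sup>2"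
    and start: "xs (- D) < x (- D)"
    and t: "\<bar>t\<bar> \<le> D"
  shows "0 < x t" "20 * A t \<le> 59 * B * (x t)\<^sup>2" "3 * p * \<theta>\<^sup>2 \<le> 10 * B * (x t)\<^sup>2"
proof -
  note pB = B_pos p_pos
  have x0: "0 < x (- D)" using start xs_pos[of "- D"] D by auto
  have "(xs (- D))\<^sup>2 \<le> (x (- D))\<^sup>2" using start xs_pos[of "- D"] D by (intro power_mono) auto
  then have "B * (xs (- D))\<^sup>2 \<le> B * (x (- D))\<^sup>2" using pB by simp
  then have xA: "A (- D) \<le> B * (x (- D))\<^sup>2" using xs_square[of "- D"] D by auto
  have thD: "\<theta>\<^sup>2 \<le> D\<^sup>2 / 4"
    using power_mono[OF th(3), of 2] th(1) by (simp add: power_mult_distrib)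
  have thD1: "\<theta> * D \<le> D\<^sup>2 / 2"
    using mult_right_mono[OF th(3), of D] D by (simp add: power2_eq_square)
  have A_ge: "p * u\<^sup>2 \<le> A u" "a0 \<le> A u" for u using a0 p_pos by (auto simp: A_def)
  define \<kappa> where "\<kappa> = (\<lambda>t. (20 * A t - 23 * p * \<theta> * t + 22 * p * \<theta>\<^sup>2) / (49 * B))"
  define t1 where "t1 = 23/20 * \<theta>"
  have t1: "- D < t1" "t1 < D" using th D by (auto simp: t1_def)
  have kD: "\<kappa> (- D) \<le> (x (- D))\<^sup>2"
  proof -
    have "23 * p * (\<theta> * D) + 22 * p * \<theta>\<^sup>2 \<le> 23 * p * (D\<^sup>2/2) + 22 * p * (D\<^sup>2/4)"
      using thD thD1 pB by (intro add_mono mult_left_mono) auto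
    also have "\<dots> \<le> 29 * (p * D\<^sup>2)" using pB by simp
    also have "\<dots> \<le> 29 * A (- D)" using A_ge(1)[of "- D"] by simp
    finally have "20 * A (- D) - 23 * p * \<theta> * (- D) + 22 * p * \<theta>\<^sup>2 \<le> 49 * (B * (x (- D))\<^sup>2)"
      using xA by (simp add: algebra_simps)
    then show ?thesis using pB by (simp add: \<kappa>_def divide_le_eq algebra_simps)
  qed
  have scale: "A u = p * \<theta>\<^sup>2 * (a0 / (p * \<theta>\<^sup>2) + (u / \<theta>)\<^sup>2)" for u
    using th(1) pB by (simp add: A_def field_simps)
  have k_pos: "0 < \<kappa> u" for u
  proof -
    have "23 * p * \<theta> * u \<le> 20 * (p * u\<^sup>2) + 21 * p * \<theta>\<^sup>2"
    proof -
      have "0 \<le> p * (20 * (u - 23/40 * \<theta>)\<^sup>2 + (21 - 23\<^sup>2 / 80) * \<theta>\<^sup>2)" using pB by simp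
      then show ?thesis by (simp add: power2_eq_square algebra_simps)
    qed
    also have "\<dots> < 20 * A u + 22 * p * \<theta>\<^sup>2" using A_ge(1)[of u] pB th by (intro add_le_less_mono) auto
    finally show ?thesis using pB by (simp add: \<kappa>_def)
  qed
  have k_le: "\<kappa> u \<le> R0\<^sup>2" if u: "u \<in> {- D..D}" for u
  proof -
    have "u\<^sup>2 \<le> D\<^sup>2" using u D by (auto simp: abs_le_square_iff[symmetric])
    then have Au: "A u \<le> a0 + p * D\<^sup>2" using pB by (simp add: A_def)
    have "(23 * p * \<theta>) * - u \<le> (23 * p * \<theta>) * D" using u pB th by (intro mult_left_mono) auto
    then have "- (23 * p * \<theta> * u) \<le> 23 * p * \<theta> * D" by simp
    also have "\<dots> \<le> 23 * p * (D\<^sup>2 / 2)"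
      using mult_left_mono[OF thD1, of "23 * p"] pB by (simp only: mult.assoc)
    finally have 1: "- (23 * p * \<theta> * u) \<le> 23 * p * (D\<^sup>2 / 2)" .
    have 2: "22 * p * \<theta>\<^sup>2 \<le> 22 * p * (D\<^sup>2/4)" using thD pB by simp
    have "20 * A u - 23 * p * \<theta> * u + 22 * p * \<theta>\<^sup>2 \<le> 49 * (a0 + p * D\<^sup>2)"
    proof -
      have "0 \<le> p * D\<^sup>2" using pB by simp
      then show ?thesis using 1 2 Au a0 unfolding distrib_left by linarith
    qed
    also have "\<dots> \<le> 49 * (B * R0\<^sup>2)" using room by simp
    finally show ?thesis using pB by (simp add: \<kappa>_def divide_le_eq algebra_simps)
  qed
  have dk: "(\<kappa> has_real_derivative (40 * p * u - 23 * p * \<theta>) / (49 * B)) (at u)" for u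
    unfolding \<kappa>_def A_def
    by (rule DERIV_cdivide) (auto intro!: derivative_eq_intros)
  have sub: "\<epsilon> * ((40 * p * u - 23 * p * \<theta>) / (49 * B)) < 2 * \<kappa> u * (A u - B * \<kappa> u)" for u
  proof -
    define s \<alpha> where "s = u / \<theta>" and "\<alpha> = a0 / (p * \<theta>\<^sup>2)"
    have us: "u = \<theta> * s" using th by (simp add: s_def)
    have Au: "A u = p * \<theta>\<^sup>2 * (\<alpha> + s\<^sup>2)" by (simp add: scale s_def \<alpha>_def)
    have "0 \<le> \<alpha>" using a0 pB by (simp add: \<alpha>_def)
    have k: "\<kappa> u = p * \<theta>\<^sup>2 * (20 * (\<alpha> + s\<^sup>2) - 23 * s + 22) / (49 * B)"
    proof -
      have "20 * A u - 23 * p * \<theta> * u + 22 * p * \<theta>\<^sup>2 = p * \<theta>\<^sup>2 * (20 * (\<alpha> + s\<^sup>2) - 23 * s + 22)"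
        unfolding Au by (simp add: us power2_eq_square algebra_simps)
      then show ?thesis by (simp add: \<kappa>_def)
    qed
    have k2: "A u - B * \<kappa> u = p * \<theta>\<^sup>2 * (29 * (\<alpha> + s\<^sup>2) + 23 * s - 22) / 49"
    proof -
      have "B * \<kappa> u = p * \<theta>\<^sup>2 * (20 * (\<alpha> + s\<^sup>2) - 23 * s + 22) / 49" using pB by (simp add: k)
      then show ?thesis unfolding Au by (simp add: algebra_simps)
    qed
    have k': "\<epsilon> * ((40 * p * u - 23 * p * \<theta>) / (49 * B)) = (p\<^sup>2 * \<theta> ^ 4 / (49 * 49 * B)) * (49 * (40 * s - 23))"
    proof -
      have "\<epsilon> * (40 * p * u - 23 * p * \<theta>) = p\<^sup>2 * \<theta> ^ 4 * (40 * s - 23)"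
        unfolding th(2)[symmetric] us by (simp add: power2_eq_square power3_eq_cube power4_eq_xxxx algebra_simps)
      then have "\<epsilon> * ((40 * p * u - 23 * p * \<theta>) / (49 * B)) = p\<^sup>2 * \<theta> ^ 4 * (40 * s - 23) / (49 * B)" by simp
      moreover have "p\<^sup>2 * \<theta> ^ 4 * Y / (49 * B) = (p\<^sup>2 * \<theta> ^ 4 / (49 * 49 * B)) * (49 * Y)" for Y
        by simp
      ultimately show ?thesis by simp
    qed
    have "\<dots> < (p\<^sup>2 * \<theta> ^ 4 / (49 * 49 * B)) * (2 * (20 * (\<alpha> + s\<^sup>2) - 23 * s + 22) * (29 * (\<alpha> + s\<^sup>2) + 23 * s - 22))"
      using pB th by (intro mult_strict_left_mono scaled_subsolution \<open>0 \<le> \<alpha>\<close>) auto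
    also have "\<dots> = 2 * \<kappa> u * (A u - B * \<kappa> u)"
      unfolding k2 unfolding k by (simp add: power2_eq_square power4_eq_xxxx)
    finally show ?thesis unfolding k' .
  qed
  have first: "0 < x u \<and> \<kappa> u \<le> (x u)\<^sup>2" if u: "- D \<le> u" "u \<le> t1" for u
  proof (cases "u = - D")
    case True
    then show ?thesis using x0 kD by simp
  next
    case False
    then show ?thesis
      using square_barrier[of "- D" t1 \<kappa> "\<lambda>u. (40 * p * u - 23 * p * \<theta>) / (49 * B)" u]
        k_pos k_le dk sub x0 kD u t1 by auto
  qed
  have Bk: "B * \<kappa> u = (20 * A u - 23 * p * \<theta> * u + 22 * p * \<theta>\<^sup>2) / 49" for u
    using pB by (simp add: \<kappa>_def)
  \<comment> \<open>the quadratic \<open>200 s^2 - 1357 s + 1298\<close> is positive up to a point just beyond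
    \<open>s = 23/20\<close>, and this determines \<open>t1\<close>\<close>
  have kA: "20 * A u \<le> 59 * (B * \<kappa> u)" if u: "u \<le> t1" for u
  proof -
    have "0 \<le> p * (200 * (u - t1)\<^sup>2 + 897 * \<theta> * (t1 - u) + (39/20) * \<theta>\<^sup>2)"
      using u pB th by (intro mult_nonneg_nonneg add_nonneg_nonneg) (auto simp: power2_eq_square)
    also have "\<dots> = 200 * (p * u\<^sup>2) - 1357 * p * \<theta> * u + 1298 * p * \<theta>\<^sup>2"
      by (simp add: t1_def power2_eq_square field_simps)
    also have "\<dots> \<le> 200 * A u - 1357 * p * \<theta> * u + 1298 * p * \<theta>\<^sup>2" using A_ge(1)[of u] by simp
    finally show ?thesis unfolding Bk by (simp add: field_simps)
  qed
  have ktheta: "3 * p * \<theta>\<^sup>2 \<le> 10 * (B * \<kappa> u)" for u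
  proof -
    have "0 \<le> p * (200 * (u - 23/40 * \<theta>)\<^sup>2 + (73 - 200 * (23/40)\<^sup>2) * \<theta>\<^sup>2)"
      using pB by (intro mult_nonneg_nonneg add_nonneg_nonneg) (auto simp: power2_eq_square)
    also have "\<dots> = 200 * (p * u\<^sup>2) - 230 * p * \<theta> * u + 73 * p * \<theta>\<^sup>2"
      by (simp add: power2_eq_square field_simps)
    also have "\<dots> \<le> 200 * A u - 230 * p * \<theta> * u + 73 * p * \<theta>\<^sup>2" using A_ge(1)[of u] by simp
    finally show ?thesis unfolding Bk by (simp add: field_simps)
  qed
  show "0 < x t" "20 * A t \<le> 59 * B * (x t)\<^sup>2" "3 * p * \<theta>\<^sup>2 \<le> 10 * B * (x t)\<^sup>2"
  proof (atomize(full), cases "t \<le> t1")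
    case True
    then have f: "0 < x t" "B * \<kappa> t \<le> B * (x t)\<^sup>2" using first[of t] t pB by auto
    then show "0 < x t \<and> 20 * A t \<le> 59 * B * (x t)\<^sup>2 \<and> 3 * p * \<theta>\<^sup>2 \<le> 10 * B * (x t)\<^sup>2"
      using kA[OF True] ktheta[of t] by (simp add: mult.assoc)
  next
    case False
    have at1: "0 < x t1" "20 * A t1 / (59 * B) \<le> (x t1)\<^sup>2"
    proof -
      have f1: "0 < x t1" "B * \<kappa> t1 \<le> B * (x t1)\<^sup>2" using first[of t1] t1 pB by auto
      then show "0 < x t1" by simp
      have "20 * A t1 \<le> 59 * (B * (x t1)\<^sup>2)" using kA[of t1] f1(2) by linarith
      then show "20 * A t1 / (59 * B) \<le> (x t1)\<^sup>2"
        using pB by (simp add: divide_le_eq mult_ac)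
    qed
    have "0 < x t \<and> 20 * A t / (59 * B) \<le> (x t)\<^sup>2"
    proof (rule square_barrier[where s = t1 and e = D and \<kappa>' = "\<lambda>u. 40 * p * u / (59 * B)"
            and \<kappa> = "\<lambda>u. 20 * A u / (59 * B)"])
      fix u assume u: "u \<in> {t1..D}"
      have u0: "0 < u" using u th by (auto simp: t1_def)
      have Apos: "0 < A u" using A_ge(2)[of u] a0 by linarith
      then show "0 < 20 * A u / (59 * B)" using pB by simp
      have "u\<^sup>2 \<le> D\<^sup>2" using u u0 by (auto intro: power_mono)
      then have "A u \<le> B * R0\<^sup>2" using room pB by (auto simp: A_def intro: order_trans[OF _ room])
      then have "20 * A u \<le> R0\<^sup>2 * (59 * B)" using Apos by (simp add: algebra_simps)
      then show "20 * A u / (59 * B) \<le> R0\<^sup>2" using pB by (simp add: divide_le_eq)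
      show "((\<lambda>u. 20 * A u / (59 * B)) has_real_derivative 40 * p * u / (59 * B)) (at u)"
        unfolding A_def by (rule DERIV_cdivide) (auto intro!: derivative_eq_intros)
      \<comment> \<open>the condition for \<open>20 A / (59 B)\<close> to be a subsolution; at \<open>u = t1\<close> it reads
        \<open>59 < 39 (23/20)^3\<close>, which barely holds\<close>
      have "59 * \<theta> ^ 3 < 39 * u ^ 3"
      proof -
        have "(23/20 * \<theta>) ^ 3 \<le> u ^ 3" using u th by (intro power_mono) (auto simp: t1_def)
        moreover have "59 * \<theta> ^ 3 < 39 * (23/20 * \<theta>) ^ 3"
          using th by (simp add: power_mult_distrib power3_eq_cube)
        ultimately show ?thesis by linarith
      qed
      then have "p\<^sup>2 * u * (59 * \<theta> ^ 3) < p\<^sup>2 * u * (39 * u ^ 3)"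
        using pB u0 by (intro mult_strict_left_mono) auto
      then have "59 * (\<epsilon> * p * u) < 39 * (p * u\<^sup>2) * (p * u\<^sup>2)"
        unfolding th(2)[symmetric] by (simp add: power2_eq_square power3_eq_cube algebra_simps)
      also have "\<dots> \<le> 39 * A u * A u" using A_ge(1)[of u] pB Apos by (intro mult_mono) auto
      finally have "40 / (59 * 59 * B) * (59 * (\<epsilon> * p * u)) < 40 / (59 * 59 * B) * (39 * A u * A u)"
        using pB by (intro mult_strict_left_mono) auto
      then show "\<epsilon> * (40 * p * u / (59 * B)) < 2 * (20 * A u / (59 * B)) * (A u - B * (20 * A u / (59 * B)))"
        using pB by (simp add: field_simps)
    qed (use t1 False t at1 in auto)
    then have "0 < x t" and main: "20 * A t \<le> 59 * B * (x t)\<^sup>2" using pB by (auto simp: divide_le_eq algebra_simps)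
    moreover have "3 * p * \<theta>\<^sup>2 \<le> 10 * B * (x t)\<^sup>2"
    proof -
      have "\<theta>\<^sup>2 \<le> t\<^sup>2" using False th by (intro power_mono) (auto simp: t1_def)
      then have "p * \<theta>\<^sup>2 \<le> p * t\<^sup>2" using pB by simp
      then have "p * \<theta>\<^sup>2 \<le> A t" using A_ge(1)[of t] by linarith
      moreover have "0 \<le> p * \<theta>\<^sup>2" using pB by simp
      ultimately show ?thesis using main by linarith
    qed
    ultimately show "0 < x t \<and> 20 * A t \<le> 59 * B * (x t)\<^sup>2 \<and> 3 * p * \<theta>\<^sup>2 \<le> 10 * B * (x t)\<^sup>2" by blast
  qed
qed

section \<open>The crossing time from above, and the lag after the crossing\<close>

text \<open>Mirror image of the lower barrier before the minimum: a linear upper barrier of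
  slope \<open>- G \<epsilon> / \<mu>^3\<close> that reaches \<open>xs\<close> a time \<open>\<Lambda> \<epsilon> / \<mu>^2\<close> after \<open>ts\<close>. The contact
  inequality is needed only up to the crossing, where the height of the barrier at a contact
  is nonnegative. In the regime \<open>sqrt a0 < \<epsilon>^(1/3)\<close> one has \<open>\<epsilon> / \<mu>^2 = \<mu>\<close>, and existence of
  a crossing before \<open>L \<mu>\<close> already has the right order.\<close>

lemma crossing_time_upper:
  assumes mu: "\<epsilon> powr (1/3) \<le> sqrt a0"
    and tc: "ts < tc" "tc \<le> L * \<mu>" "x tc = xs tc" "\<And>t. - T \<le> t \<Longrightarrow> t < tc \<Longrightarrow> xs t < x t"
    and L: "1 \<le> L" "L * \<mu> \<le> D"
    and start: "x (- \<mu>) \<le> xs (- \<mu>) + C1 * \<epsilon> / \<mu>\<^sup>2"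
    and G: "2 * C1 \<le> G" "C \<le> c ^ 3 * G" "1 < c ^ 3 * \<Lambda>" "G < c / L * \<Lambda>" "0 < \<Lambda>"
    and small: "G * (3/2 + \<Lambda>) * \<mu> \<le> R"
  shows "tc \<le> ts + \<Lambda> * \<epsilon> / \<mu>\<^sup>2"
proof -
  have mu_eq: "\<mu> = sqrt a0" using mu by (simp add: inner_scale_def)
  define q where "q = \<epsilon> / \<mu> ^ 3"
  have q: "0 < q" "q \<le> 1" using ratio3_le_1 eps mu_pos by (auto simp: q_def)
  have q2: "\<epsilon> / \<mu>\<^sup>2 = q * \<mu>" using mu_pos by (simp add: q_def eval_nat_numeral)
  have eX: "\<epsilon> * X = \<mu>\<^sup>2 * ((q * \<mu>) * X)" for X
    using mu_pos by (simp add: q_def eval_nat_numeral)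
  have qm: "0 < q * \<mu>" "q * \<mu> \<le> \<mu>" using q mu_pos by (auto simp: mult_le_cancel_right1)
  have G0: "0 < G"
  proof (rule ccontr)
    assume "\<not> 0 < G"
    then have "c ^ 3 * G \<le> 0" using c by (simp add: mult_nonneg_nonpos)
    then show False using G C by linarith
  qed
  have muL: "\<mu> \<le> L * \<mu>" using L mu_pos by simp
  have muD: "\<mu> \<le> D" "\<mu> \<le> T" using muL L D by linarith+
  define z where "z = (\<lambda>t. G * q * (ts + \<Lambda> * (q * \<mu>) - t))"
  have "x tc < xs tc + z tc"
  proof (rule barrier_above[where s = "- \<mu>" and e = tc and z' = "\<lambda>t. xs' t + - (G * q)"])
    fix t assume t: "t \<in> {- \<mu>..tc}" and xt: "x t = xs t + z t"
    have tD: "\<bar>t\<bar> \<le> D" using t tc L muL muD by auto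
    have tT: "\<bar>t\<bar> \<le> T" using tD D by linarith
    have rho_L: "\<rho> t \<le> L * \<mu>" "\<mu> \<le> \<rho> t"
      using t tc muL sqrt_le_mu mu_eq by (auto simp: width_def)
    have "xs t \<le> x t" using tc(3) tc(4)[of t] t tT by (cases "t = tc") force+
    then have z0: "0 \<le> z t" using xt by simp
    have z_le: "z t \<le> R"
    proof -
      have "ts + \<Lambda> * (q * \<mu>) - t \<le> (3/2 + \<Lambda>) * \<mu>"
      proof -
        have "\<Lambda> * (q * \<mu>) \<le> \<Lambda> * \<mu>" using qm G by (intro mult_left_mono) auto
        moreover have "- \<mu> \<le> t" using t by simp
        ultimately show ?thesis using ts_mu unfolding distrib_right by linarith
      qed
      then have "z t \<le> G * q * ((3/2 + \<Lambda>) * \<mu>)" unfolding z_def using G0 q by (intro mult_left_mono) auto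
      also have "\<dots> \<le> G * 1 * ((3/2 + \<Lambda>) * \<mu>)" using G0 q G mu_pos by (intro mult_mono) auto
      finally show ?thesis using small by (simp add: mult.assoc)
    qed
    have xsp: "0 < xs t" by (rule xs_pos[OF tT])
    obtain k where k: "c * (xs t + z t) * (xs t + z t + xs t) \<le> k" "f (xs t + z t) t = - k * z t"
      using chord[OF tT, of "xs t + z t"] z0 z_le xsp room[of t] tT tD by force
    have "c * \<mu> \<le> xs t" using xs_bounds[OF tT] mult_left_mono[OF rho_L(2), of c] c by linarith
    then have "c * (c * \<mu>) * (c * \<mu>) \<le> c * (xs t + z t) * (xs t + z t + xs t)"
      using c z0 xsp mu_pos by (intro mult_mono) auto
    then have "c * (c * \<mu>) * (c * \<mu>) * z t \<le> k * z t" using k z0 by (intro mult_right_mono) auto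
    then have kz: "\<mu>\<^sup>2 * (c ^ 3 * z t) \<le> k * z t" by (simp add: power2_eq_square power3_eq_cube mult_ac)
    \<comment> \<open>before \<open>ts\<close> the descent of \<open>xs\<close> is compensated by \<open>C \<le> c^3 G\<close>; after \<open>ts\<close> either
      the barrier is still high or \<open>xs\<close> already rises, and \<open>\<Lambda>\<close> is chosen so that the sum of
      both effects suffices\<close>
    have key: "G * (q * \<mu>) < c ^ 3 * G * (\<Lambda> * (q * \<mu>) - (t - ts)) + \<mu> * xs' t"
    proof (cases "t \<le> ts")
      case True
      have sl: "c * (ts - t) \<le> - xs' t * \<rho> t" "- xs' t * \<rho> t \<le> C * (ts - t)"
        using slope_left[of t] True tT by auto
      have "0 \<le> c * (ts - t)" using c True by simp
      then have "0 \<le> - xs' t * \<rho> t" using sl by linarith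
      then have "0 \<le> - xs' t" using rho_pos[of t] by (simp add: mult_le_0_iff)
      then have "- xs' t * \<mu> \<le> - xs' t * \<rho> t" using rho_L by (intro mult_left_mono) auto
      then have 1: "\<mu> * xs' t \<ge> C * (t - ts)" using sl(2) by (simp add: algebra_simps)
      have 2: "0 \<le> (c ^ 3 * G - C) * (ts - t)" using G True by (intro mult_nonneg_nonneg) auto
      have 3: "1 * (G * (q * \<mu>)) < c ^ 3 * \<Lambda> * (G * (q * \<mu>))"
        using G G0 qm by (intro mult_strict_right_mono) auto
      show ?thesis using 1 2 3 by (simp add: algebra_simps)
    next
      case False
      define r where "r = c / L"
      have sl: "c * (t - ts) \<le> xs' t * \<rho> t" using slope_right[of t] False tT by auto
      have xs'0: "0 \<le> xs' t" using slope_pos[of t] False tT by (auto simp: abs_le_iff)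
      have "xs' t * \<rho> t \<le> xs' t * (L * \<mu>)" using xs'0 rho_L by (intro mult_left_mono) auto
      then have "c * (t - ts) \<le> L * (\<mu> * xs' t)" using sl by (simp add: mult_ac)
      then have 1: "c / L * (t - ts) \<le> \<mu> * xs' t" using L by (simp add: pos_divide_le_eq mult_ac)
      have zs: "t - ts \<le> \<Lambda> * (q * \<mu>)"
      proof -
        have "0 < G * q" using G0 q by simp
        then show ?thesis using z0 by (auto simp: z_def zero_le_mult_iff)
      qed
      have "c / L \<le> C" using c C L mult_mono[of 1 C 1 L] by (simp add: divide_le_eq)
      then have "0 \<le> (c ^ 3 * G - c / L) * (\<Lambda> * (q * \<mu>) - (t - ts))"
        using G zs by (intro mult_nonneg_nonneg) auto
      moreover have "G * (q * \<mu>) < c / L * \<Lambda> * (q * \<mu>)" using G qm by (intro mult_strict_right_mono) auto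
      ultimately show ?thesis using 1 unfolding r_def[symmetric] by (simp add: algebra_simps)
    qed
    have "q * (G * (q * \<mu>)) < q * (c ^ 3 * G * (\<Lambda> * (q * \<mu>) - (t - ts)) + \<mu> * xs' t)"
      using key q by (intro mult_strict_left_mono) auto
    then have "- (c ^ 3 * z t) < (q * \<mu>) * (xs' t + - (G * q))"
      by (simp add: z_def algebra_simps)
    then have "\<mu>\<^sup>2 * - (c ^ 3 * z t) < \<mu>\<^sup>2 * ((q * \<mu>) * (xs' t + - (G * q)))"
      using mu_pos by (intro mult_strict_left_mono) auto
    then show "f (xs t + z t) t < \<epsilon> * (xs' t + - (G * q))" unfolding eX using k(2) kz by simp
  next
    fix t assume t: "t \<in> {- \<mu>..tc}"
    have tT: "\<bar>t\<bar> \<le> T" using t tc L muL muD D by auto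
    show "((\<lambda>t. xs t + z t) has_real_derivative xs' t + - (G * q)) (at t)"
      unfolding z_def by (intro DERIV_add xs_deriv[OF tT]) (auto intro!: derivative_eq_intros)
  next
    have "\<mu> / 2 \<le> ts + \<Lambda> * (q * \<mu>) - - \<mu>"
    proof -
      have "0 \<le> \<Lambda> * (q * \<mu>)" using G qm by simp
      then show ?thesis using ts_mu by linarith
    qed
    then have "G * q * (\<mu> / 2) \<le> z (- \<mu>)" unfolding z_def using G0 q by (intro mult_left_mono) auto
    moreover have "2 * C1 * (q * \<mu>) \<le> G * (q * \<mu>)" using G qm by (intro mult_right_mono) auto
    ultimately have "C1 * (q * \<mu>) \<le> z (- \<mu>)" by (simp add: mult.assoc)
    then show "x (- \<mu>) \<le> xs (- \<mu>) + z (- \<mu>)"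
      using start unfolding times_divide_eq_right[symmetric] q2 by linarith
  qed (use muD tc ts_mu L mu_pos D in auto)
  then have "0 < z tc" using tc by simp
  moreover have "0 < G * q" using G0 q by simp
  ultimately have "tc < ts + \<Lambda> * (q * \<mu>)" by (auto simp: z_def zero_less_mult_iff)
  then show ?thesis unfolding times_divide_eq_right[symmetric] q2 by simp
qed

text \<open>Immediately after the crossing, \<open>xs\<close> minus a constant multiple of \<open>\<epsilon> / \<mu>^2\<close> is a
  lower barrier, because the floor \<open>x \<ge> c3 \<mu>\<close> keeps the rate of attraction at least of order
  \<open>\<mu>^2\<close>. This supplies the starting value at \<open>N \<mu>\<close> for the decaying barrier used further
  out.\<close>

lemma after_inner:
  assumes tc: "- D \<le> tc" "x tc = xs tc"
    and floor: "\<And>t. \<bar>t\<bar> \<le> D \<Longrightarrow> c3 * max \<mu> \<bar>t\<bar> \<le> x t" "0 < c3"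
    and C3: "2 * C < c * c3\<^sup>2 * C3" "C3 * \<mu> \<le> R" "0 < C3"
    and t: "tc \<le> t" "t \<le> D"
  shows "xs t - C3 * \<epsilon> / \<mu>\<^sup>2 \<le> x t"
proof (cases "t = tc")
  case True
  then show ?thesis using tc C3 eps mu_pos by simp
next
  case False
  define z where "z = C3 * \<epsilon> / \<mu>\<^sup>2"
  have z: "0 < z" "z \<le> R"
  proof -
    show "0 < z" using C3 eps mu_pos by (simp add: z_def)
    have "z = C3 * (\<epsilon> / \<mu>\<^sup>2)" by (simp add: z_def)
    also have "\<dots> \<le> C3 * \<mu>" using ratio2_le_mu C3 by (intro mult_left_mono) auto
    finally show "z \<le> R" using C3 by linarith
  qed
  have "xs t - z < x t"
  proof (rule barrier_below[where s = tc and e = t and z' = xs'])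
    fix u assume u: "u \<in> {tc..t}" and xu: "x u = xs u - z"
    have uD: "\<bar>u\<bar> \<le> D" using u tc t by auto
    then have uT: "\<bar>u\<bar> \<le> T" using D by linarith
    have xsp: "0 < xs u" by (rule xs_pos[OF uT])
    have "c3 * \<mu> \<le> c3 * max \<mu> \<bar>u\<bar>" using floor by (intro mult_left_mono) auto
    then have xge: "c3 * \<mu> \<le> x u" using floor(1)[OF uD] by linarith
    have x0: "0 < x u" using xge mult_pos_pos[OF floor(2) mu_pos] by linarith
    obtain k where k: "c * (xs u - z) * (xs u - z + xs u) \<le> k" "f (xs u - z) u = k * z"
      using chord[OF uT, of "xs u - z"] x0 xu z xsp xs_le_d[OF uT] by force
    have "c * (c3 * \<mu>) * (c3 * \<mu>) \<le> c * (xs u - z) * (xs u - z + xs u)"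
      using xge xu x0 c xsp floor(2) mu_pos by (intro mult_mono mult_nonneg_nonneg) auto
    then have "c * (c3 * \<mu>) * (c3 * \<mu>) * z \<le> k * z" using k z by (intro mult_right_mono) auto
    moreover have "c * (c3 * \<mu>) * (c3 * \<mu>) * z = c * c3\<^sup>2 * C3 * \<epsilon>"
      using mu_pos by (simp add: z_def power2_eq_square)
    moreover have "2 * C * \<epsilon> < c * c3\<^sup>2 * C3 * \<epsilon>" using C3 eps by simp
    moreover have "\<epsilon> * xs' u \<le> 2 * C * \<epsilon>"
      using mult_left_mono[of "xs' u" "2 * C" \<epsilon>] xs_slope_le[OF uT] eps by (simp add: abs_le_iff mult_ac)
    ultimately show "\<epsilon> * xs' u < f (xs u - z) u" using k(2) by linarith
  next
    fix u assume u: "u \<in> {tc..t}"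
    have uT: "\<bar>u\<bar> \<le> T" using u tc t D by auto
    show "((\<lambda>t. xs t - z) has_real_derivative xs' u) (at u)"
      using DERIV_diff[OF xs_deriv[OF uT] DERIV_const[of z]] by simp
  qed (use tc t D False z in auto)
  then show ?thesis by (simp add: z_def)
qed

text \<open>The barrier is \<open>xs - C2 \<epsilon> / t^2\<close>. Unlike before the crossing, it approaches \<open>xs\<close>
  as \<open>t\<close> grows, at speed \<open>2 C2 \<epsilon> / t^3\<close>; this is absorbed by the restoring force only once
  \<open>t^3\<close> is a large multiple of \<open>\<epsilon>\<close>, hence the start at \<open>N \<mu>\<close> with \<open>N\<close> large.\<close>

lemma after_upper:
  assumes N: "1 \<le> N" "N * \<mu> \<le> D"
    and start: "xs (N * \<mu>) - C3 * \<epsilon> / \<mu>\<^sup>2 \<le> x (N * \<mu>)"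
    and floor: "\<And>t. \<bar>t\<bar> \<le> D \<Longrightarrow> c3 * max \<mu> \<bar>t\<bar> \<le> x t" "0 < c3"
    and c4: "0 < c4" "c4 \<le> c3" "c4 \<le> c / 2"
    and C2: "C3 * N\<^sup>2 \<le> C2" "4 \<le> N ^ 3 * (c\<^sup>2 * c4)" "4 * C < C2 * (c\<^sup>2 * c4)" "0 < C2"
    and small: "C2 * \<mu> \<le> R" "C2 * \<mu> \<le> c * D / 2"
    and t: "N * \<mu> \<le> t" "t \<le> T"
  shows "xs t - C2 * \<epsilon> / t\<^sup>2 \<le> x t"
proof -
  have Nmu: "\<mu> \<le> N * \<mu>" using N mu_pos by simp
  have start': "xs (N * \<mu>) - C2 * \<epsilon> / (N * \<mu>)\<^sup>2 \<le> x (N * \<mu>)"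
  proof -
    have "C3 * \<epsilon> / \<mu>\<^sup>2 = C3 * N\<^sup>2 * (\<epsilon> / (N * \<mu>)\<^sup>2)" using N mu_pos by (simp add: power_mult_distrib)
    also have "\<dots> \<le> C2 * (\<epsilon> / (N * \<mu>)\<^sup>2)" using C2 eps by (intro mult_right_mono) auto
    finally show ?thesis using start by simp
  qed
  show ?thesis
  proof (cases "t = N * \<mu>")
    case True
    then show ?thesis using start' by simp
  next
    case False
    have "xs t + (- C2) * \<epsilon> / t\<^sup>2 < x t"
    proof (rule barrier_below[where s = "N * \<mu>" and e = t and z' = "\<lambda>t. xs' t + - (2 * (- C2) * \<epsilon> / t ^ 3)"])
      fix u assume u: "u \<in> {N * \<mu>..t}" and xu': "x u = xs u + (- C2) * \<epsilon> / u\<^sup>2"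
      have "N * \<mu> \<le> u" "u \<le> t" using u by auto
      then have um: "\<mu> \<le> u" and uT: "\<bar>u\<bar> \<le> T" using t Nmu mu_pos T_pos by linarith+
      have u0: "0 < u" using um mu_pos by linarith
      define z where "z = C2 * \<epsilon> / u\<^sup>2"
      have xu: "x u = xs u - z" using xu' by (simp add: z_def)
      have z: "0 < z" "z \<le> R" "z \<le> c * D / 2"
      proof -
        show "0 < z" using C2 eps u0 by (simp add: z_def)
        have "z = C2 * (\<epsilon> / u\<^sup>2)" by (simp add: z_def)
        also have "\<dots> \<le> C2 * \<mu>" using eps_over_sq(2)[of u] um u0 C2 by (intro mult_left_mono) auto
        finally show "z \<le> R" "z \<le> c * D / 2" using small by linarith+
      qed
      have rho: "\<rho> u = u" using rho_outer[of u] um u0 by auto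
      have xsu: "c * u \<le> xs u" "0 < xs u" using xs_bounds[OF uT] xs_pos[OF uT] rho by auto
      have xge: "c4 * u \<le> xs u - z"
      proof (cases "u \<le> D")
        case True
        have "c4 * u \<le> c3 * u" using c4 u0 by simp
        also have "\<dots> \<le> c3 * max \<mu> \<bar>u\<bar>" using floor by (intro mult_left_mono) auto
        also have "\<dots> \<le> x u" using floor(1)[of u] True u0 by auto
        finally show ?thesis using xu by simp
      next
        case False
        have "c4 * u \<le> c / 2 * u" using c4 u0 by (intro mult_right_mono) auto
        moreover have "c * D \<le> c * u" using False c by simp
        ultimately show ?thesis using xsu z by (simp add: field_simps)
      qed
      have x0: "0 < xs u - z" using xge c4 u0 mult_pos_pos[of c4 u] by linarith
      obtain k where k: "c * (xs u - z) * (xs u - z + xs u) \<le> k" "f (xs u - z) u = k * z"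
        using chord[OF uT, of "xs u - z"] x0 z xsu xs_le_d[OF uT] by force
      have "c * (c4 * u) * (c * u) \<le> c * (xs u - z) * (xs u - z + xs u)"
        using xge xsu x0 c c4 u0 by (intro mult_mono) auto
      then have "c * (c4 * u) * (c * u) * z \<le> k * z" using k z by (intro mult_right_mono) auto
      moreover have "c * (c4 * u) * (c * u) * z = C2 * (c\<^sup>2 * c4) * \<epsilon>"
        using u0 by (simp add: z_def power2_eq_square)
      moreover have "xs' u + - (2 * (- C2) * \<epsilon> / u ^ 3) < C2 * (c\<^sup>2 * c4)"
      proof -
        have "N ^ 3 * \<epsilon> \<le> N ^ 3 * \<mu> ^ 3" using eps_le_mu3 N by (intro mult_left_mono) auto
        also have "\<dots> = (N * \<mu>) ^ 3" by (simp add: power_mult_distrib)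
        also have "\<dots> \<le> u ^ 3" using u Nmu mu_pos by (intro power_mono) auto
        finally have "N ^ 3 * (\<epsilon> / u ^ 3) \<le> 1" using u0 by simp
        then have "N ^ 3 * (\<epsilon> / u ^ 3) * (c\<^sup>2 * c4) \<le> 1 * (c\<^sup>2 * c4)" using c c4 by (intro mult_right_mono) auto
        moreover have "4 * (\<epsilon> / u ^ 3) \<le> N ^ 3 * (c\<^sup>2 * c4) * (\<epsilon> / u ^ 3)"
          using C2(2) eps u0 by (intro mult_right_mono) auto
        ultimately have "4 * (\<epsilon> / u ^ 3) \<le> c\<^sup>2 * c4" by (simp add: mult_ac)
        then have "C2 * (4 * (\<epsilon> / u ^ 3)) \<le> C2 * (c\<^sup>2 * c4)" using C2 by (intro mult_left_mono) auto
        moreover have "xs' u \<le> 2 * C" using xs_slope_le[OF uT] by linarith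
        moreover have "- (2 * (- C2) * \<epsilon> / u ^ 3) = C2 * (4 * (\<epsilon> / u ^ 3)) / 2" by simp
        moreover have "y + r / 2 < K" if "r \<le> K" "y \<le> 2 * C" "4 * C < K" for y r K :: real
          using that by linarith
        ultimately show ?thesis using C2(3) by metis
      qed
      then have "\<epsilon> * (xs' u + - (2 * (- C2) * \<epsilon> / u ^ 3)) < \<epsilon> * (C2 * (c\<^sup>2 * c4))"
        using eps by (intro mult_strict_left_mono) auto
      ultimately have "\<epsilon> * (xs' u + - (2 * (- C2) * \<epsilon> / u ^ 3)) < f (xs u - z) u" using k(2) by (metis (no_types, lifting) less_le_trans mult.commute)
      moreover have "xs u - z = xs u + (- C2) * \<epsilon> / u\<^sup>2" by (simp add: z_def)
      ultimately show "\<epsilon> * (xs' u + - (2 * (- C2) * \<epsilon> / u ^ 3)) < f (xs u + (- C2) * \<epsilon> / u\<^sup>2) u" by simp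
    next
      fix u assume u: "u \<in> {N * \<mu>..t}"
      have "N * \<mu> \<le> u" "u \<le> t" using u by auto
      then have um: "\<mu> \<le> u" and uT: "\<bar>u\<bar> \<le> T" using t Nmu mu_pos T_pos by linarith+
      then show "((\<lambda>t. xs t + (- C2) * \<epsilon> / t\<^sup>2) has_real_derivative xs' u + - (2 * (- C2) * \<epsilon> / u ^ 3)) (at u)"
        using mu_pos by (intro DERIV_add xs_deriv[OF uT] DERIV_inverse_square) auto
    next
      show "- T \<le> N * \<mu>" using Nmu mu_pos T_pos by linarith
    qed (use False t start' in auto)
    then show ?thesis by simp
  qed
qed

text \<open>At \<open>L \<mu>\<close> only \<open>x \<le> xs\<close> is known, so the barrier \<open>xs - c5 \<epsilon> (t - L \<mu>) / t^3\<close>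
  starts from zero lag there; beyond \<open>2 L \<mu>\<close> its lag is at least \<open>c5 \<epsilon> / (2 t^2)\<close>.\<close>

lemma after_lower:
  assumes L: "1 \<le> L" "L * \<mu> \<le> T" "x (L * \<mu>) \<le> xs (L * \<mu>)"
    and c5: "0 < c5" "c5 \<le> c / 2" "c5 * (2 * C ^ 3 + 1) < c / 2"
    and small: "\<mu> \<le> R"
    and t: "2 * L * \<mu> \<le> t" "t \<le> T"
  shows "x t \<le> xs t - c5 / 2 * \<epsilon> / t\<^sup>2"
proof -
  have Lmu: "\<mu> \<le> L * \<mu>" using L mu_pos by simp
  define z where "z = (\<lambda>t. c5 * \<epsilon> * (t - L * \<mu>) / t ^ 3)"
  define z' where "z' = (\<lambda>t. c5 * \<epsilon> * (3 * L * \<mu> - 2 * t) / t ^ 4)"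
  have "x t < xs t - z t"
  proof (rule barrier_above[where s = "L * \<mu>" and e = t and z' = "\<lambda>t. xs' t - z' t"])
    fix u assume u: "u \<in> {L * \<mu>..t}"
    have "L * \<mu> \<le> u" "u \<le> t" using u by auto
    then have um: "\<mu> \<le> u" and uT: "\<bar>u\<bar> \<le> T" using t Lmu mu_pos T_pos by linarith+
    have u0: "0 < u" using um mu_pos by linarith
    have "(z has_real_derivative z' u) (at u)"
    proof -
      have "(z has_real_derivative (c5 * \<epsilon> * 1 * u ^ 3 - c5 * \<epsilon> * (u - L * \<mu>) * (of_nat 3 * (1 * u ^ (3 - Suc 0)))) / (u ^ 3 * u ^ 3)) (at u)"
        unfolding z_def
        by (rule DERIV_divide DERIV_cmult DERIV_power DERIV_ident | use u0 in \<open>auto intro!: derivative_eq_intros\<close>)+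
      also have "(c5 * \<epsilon> * 1 * u ^ 3 - c5 * \<epsilon> * (u - L * \<mu>) * (of_nat 3 * (1 * u ^ (3 - Suc 0)))) / (u ^ 3 * u ^ 3)
         = c5 * \<epsilon> * (u\<^sup>2 * (3 * L * \<mu> - 2 * u)) / (u\<^sup>2 * u ^ 4)"
        by (rule arg_cong2[where f = "(/)"]) (simp_all add: eval_nat_numeral algebra_simps)
      also have "\<dots> = z' u" using u0 unfolding z'_def by (simp add: eval_nat_numeral)
      finally show ?thesis .
    qed
    then show "((\<lambda>t. xs t - z t) has_real_derivative xs' u - z' u) (at u)"
      by (intro DERIV_diff xs_deriv[OF uT])
    have rho: "\<rho> u = u" using rho_outer[of u] um u0 by auto
    have xsu: "c * u \<le> xs u" "0 < xs u" "xs u \<le> C * u" using xs_bounds[OF uT] xs_pos[OF uT] rho by auto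
    have z_le: "z u \<le> c5 * \<epsilon> / u\<^sup>2" and z0: "0 \<le> z u"
    proof -
      have "z u \<le> c5 * \<epsilon> * u / u ^ 3"
        unfolding z_def using c5 eps u0 L mu_pos by (intro divide_right_mono mult_left_mono) auto
      then show "z u \<le> c5 * \<epsilon> / u\<^sup>2" using u0 by (simp add: power3_eq_cube power2_eq_square)
      show "0 \<le> z u" unfolding z_def using c5 eps u0 u by simp
    qed
    have ze: "c5 * \<epsilon> / u\<^sup>2 \<le> c5 * u" "c5 * \<epsilon> / u\<^sup>2 \<le> c5 * \<mu>"
      using mult_left_mono[OF eps_over_sq(1)[of u], of c5] mult_left_mono[OF eps_over_sq(2)[of u], of c5] um u0 c5 by auto
    have zR: "z u \<le> R"
    proof -
      have "c5 * \<mu> \<le> 1 * \<mu>" using c5 c mu_pos by (intro mult_right_mono) auto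
      then show ?thesis using z_le ze small by linarith
    qed
    have x0: "0 < xs u - z u"
    proof -
      have "c5 * u \<le> c / 2 * u" using c5 u0 by (intro mult_right_mono) auto
      also have "\<dots> < c * u" using c u0 by simp
      finally show ?thesis using z_le ze(1) xsu by linarith
    qed
    obtain k where k: "k \<le> C * (xs u - z u) * (xs u - z u + xs u)" "f (xs u - z u) u = k * z u"
      using chord[OF uT, of "xs u - z u"] x0 z0 zR xsu xs_le_d[OF uT] by force
    have "C * (xs u - z u) * (xs u - z u + xs u) \<le> C * (C * u) * (2 * (C * u))"
      using xsu x0 z0 C u0 by (intro mult_mono) auto
    then have "k * z u \<le> C * (C * u) * (2 * (C * u)) * z u" using k z0 by (intro mult_right_mono) auto
    also have "\<dots> \<le> C * (C * u) * (2 * (C * u)) * (c5 * \<epsilon> / u\<^sup>2)" using z_le C u0 by (intro mult_left_mono) auto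
    also have "\<dots> = c5 * (2 * C ^ 3) * \<epsilon>" using u0 by (simp add: power2_eq_square power3_eq_cube)
    finally have kz: "k * z u \<le> c5 * (2 * C ^ 3) * \<epsilon>" .
    have z'u: "z' u \<le> c5"
    proof -
      have "3 * L * \<mu> - 2 * u \<le> u" using u by auto
      then have "z' u \<le> c5 * \<epsilon> * u / u ^ 4"
        unfolding z'_def using c5 eps u0 by (intro divide_right_mono mult_left_mono) auto
      also have "\<dots> = c5 * \<epsilon> / u\<^sup>2 / u" using u0 by (simp add: eval_nat_numeral)
      also have "\<dots> \<le> c5 * u / u" using ze(1) u0 by (intro divide_right_mono) auto
      also have "\<dots> = c5" using u0 by simp
      finally show ?thesis .
    qed
    have "c / 2 \<le> xs' u"
    proof -
      have tsu: "u / 2 \<le> u - ts" using ts_mu um by linarith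
      then have "c * (u / 2) \<le> c * (u - ts)" using c by simp
      also have "\<dots> \<le> xs' u * u" using slope_right[of u] tsu u0 uT rho by auto
      finally show ?thesis using u0 by simp
    qed
    then have "c5 * (2 * C ^ 3) < xs' u - z' u" using c5 z'u by (simp add: algebra_simps)
    then have "\<epsilon> * (c5 * (2 * C ^ 3)) < \<epsilon> * (xs' u - z' u)" using eps by (intro mult_strict_left_mono) auto
    then show "f (xs u - z u) u < \<epsilon> * (xs' u - z' u)" using kz k(2) by (simp add: mult_ac)
  next
    show "x (L * \<mu>) \<le> xs (L * \<mu>) - z (L * \<mu>)" using L by (simp add: z_def)
  next
    show "- T \<le> L * \<mu>" using Lmu mu_pos T_pos by linarith
    have "2 * L * \<mu> = L * \<mu> + L * \<mu>" by simp
    then show "L * \<mu> < t" using t Lmu mu_pos by linarith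
  qed (use t in auto)
  moreover have "c5 / 2 * \<epsilon> / t\<^sup>2 \<le> z t"
  proof -
    have t0: "0 < t" using t Lmu mu_pos by linarith
    have "c5 / 2 * \<epsilon> / t\<^sup>2 = c5 * \<epsilon> * (t / 2) / t ^ 3" using t0 by (simp add: eval_nat_numeral)
    also have "\<dots> \<le> z t" unfolding z_def using c5 eps t t0 by (intro divide_right_mono mult_left_mono) auto
    finally show ?thesis .
  qed
  ultimately show ?thesis by linarith
qed

section \<open>Global bounds and the linearization\<close>

lemma eps_third_le: "\<epsilon> powr (1/3) \<le> \<mu>" by (simp add: inner_scale_def)

lemma a0_le: "a0 \<le> \<mu>\<^sup>2"
  using power_mono[OF sqrt_le_mu, of 2] a0 by simp

lemma mu_square_cases: "\<mu>\<^sup>2 = a0 \<or> \<mu> = \<epsilon> powr (1/3)"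
  using a0 by (auto simp: inner_scale_def max_def)

text \<open>The floor for \<open>x^2\<close> bounds it below by multiples of \<open>a0 + p t^2\<close> and of \<open>\<theta>^2\<close>,
  where \<open>\<theta>\<close> is proportional to \<open>\<epsilon>^(1/3)\<close>; together these are of the order of the square of
  \<open>max \<mu> \<bar>t\<bar>\<close>.\<close>

lemma proportional_floor:
  assumes r: "0 < r" "p * r ^ 3 = 1" "2 * r * \<mu> \<le> D" and room: "a0 + p * D\<^sup>2 \<le> B * R0\<^sup>2"
    and start: "xs (- D) < x (- D)"
    and c3: "0 < c3" "59 * B * c3\<^sup>2 \<le> 20" "59 * B * c3\<^sup>2 \<le> 20 * p" "10 * B * c3\<^sup>2 \<le> 3 * p * r\<^sup>2"
    and t: "\<bar>t\<bar> \<le> D"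
  shows "c3 * max \<mu> \<bar>t\<bar> \<le> x t" "20 * A t \<le> 59 * B * (x t)\<^sup>2" "0 < x t"
proof -
  define \<theta> where "\<theta> = r * \<epsilon> powr (1/3)"
  have th: "0 < \<theta>" using r cube_root by (simp add: \<theta>_def)
  have "p * \<theta> ^ 3 = (p * r ^ 3) * (\<epsilon> powr (1/3)) ^ 3" by (simp add: \<theta>_def power_mult_distrib)
  then have th3: "p * \<theta> ^ 3 = \<epsilon>" unfolding r(2) cube_root(1) by simp
  have "r * \<epsilon> powr (1/3) \<le> r * \<mu>" using r eps_third_le by (intro mult_left_mono) auto
  moreover have "2 * (r * \<mu>) \<le> D" using r(3) by (simp add: mult.assoc)
  ultimately have thD: "2 * \<theta> \<le> D" unfolding \<theta>_def by linarith
  note sf = square_floor[OF th th3 thD room start t]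
  show "0 < x t" "20 * A t \<le> 59 * B * (x t)\<^sup>2" using sf by auto
  have a: "a0 \<le> A t" "p * t\<^sup>2 \<le> A t" using a0 p_pos by (auto simp: A_def)
  have le: "c3 * y \<le> x t" if "B * (c3 * y)\<^sup>2 \<le> B * (x t)\<^sup>2" for y
  proof -
    have "(c3 * y)\<^sup>2 \<le> (x t)\<^sup>2" using that B_pos by simp
    then show ?thesis using sf(1) by (rule power2_le_imp_le[OF _ less_imp_le])
  qed
  have t_part: "c3 * \<bar>t\<bar> \<le> x t"
  proof (rule le)
    have "59 * B * c3\<^sup>2 * t\<^sup>2 \<le> 20 * p * t\<^sup>2" using c3 by (intro mult_right_mono) auto
    then have "59 * (B * (c3 * \<bar>t\<bar>)\<^sup>2) \<le> 59 * (B * (x t)\<^sup>2)" using sf(2) a by (simp add: power_mult_distrib mult_ac)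
    then show "B * (c3 * \<bar>t\<bar>)\<^sup>2 \<le> B * (x t)\<^sup>2" by simp
  qed
  have mu_part: "c3 * \<mu> \<le> x t"
  proof (rule le)
    from mu_square_cases show "B * (c3 * \<mu>)\<^sup>2 \<le> B * (x t)\<^sup>2"
    proof
      assume mu: "\<mu>\<^sup>2 = a0"
      have "59 * B * c3\<^sup>2 * a0 \<le> 20 * a0" using c3 a0 by (intro mult_right_mono) auto
      then have "59 * (B * (c3 * \<mu>)\<^sup>2) \<le> 59 * (B * (x t)\<^sup>2)" using sf(2) a mu by (simp add: power_mult_distrib mult_ac)
      then show ?thesis by simp
    next
      assume mu: "\<mu> = \<epsilon> powr (1/3)"
      have "10 * B * c3\<^sup>2 * \<mu>\<^sup>2 \<le> 3 * p * r\<^sup>2 * \<mu>\<^sup>2" using c3 by (intro mult_right_mono) auto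
      also have "\<dots> = 3 * p * \<theta>\<^sup>2" by (simp add: \<theta>_def mu power_mult_distrib)
      finally have "10 * (B * (c3 * \<mu>)\<^sup>2) \<le> 10 * (B * (x t)\<^sup>2)" using sf(3) by (simp add: power_mult_distrib mult_ac)
      then show ?thesis by simp
    qed
  qed
  show "c3 * max \<mu> \<bar>t\<bar> \<le> x t" using t_part mu_part by (simp add: max_def)
qed

lemma global_upper:
  assumes before: "\<And>t. - T \<le> t \<Longrightarrow> t \<le> - \<mu> \<Longrightarrow> x t \<le> xs t + C1 * \<epsilon> / t\<^sup>2" "0 < C1"
    and X: "(C + C1) * \<mu> \<le> R" "\<mu> \<le> D"
    and tc: "- \<mu> < tc" "tc \<le> D" "\<And>t. - T \<le> t \<Longrightarrow> t < tc \<Longrightarrow> xs t < x t" "x tc = xs tc"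
      "\<And>t. tc < t \<Longrightarrow> t \<le> T \<Longrightarrow> x t < xs t"
    and t: "\<bar>t\<bar> \<le> T"
  shows "x t \<le> (C + C1) * max \<mu> \<bar>t\<bar>"
proof -
  have rho_max: "\<rho> t \<le> max \<mu> \<bar>t\<bar>" using sqrt_le_mu by (auto simp: width_def)
  have max0: "0 < max \<mu> \<bar>t\<bar>" using mu_pos by (simp add: less_max_iff_disj)
  have C_max: "C * \<rho> t \<le> C * max \<mu> \<bar>t\<bar>" using rho_max C by (intro mult_left_mono) auto
  have C1_max: "0 \<le> C1 * max \<mu> \<bar>t\<bar>" using before max0 by simp
  have pre: "x u \<le> xs u + C1 * \<bar>u\<bar>" if u: "- T \<le> u" "u \<le> - \<mu>" for u
  proof -
    have "C1 * (\<epsilon> / u\<^sup>2) \<le> C1 * \<bar>u\<bar>" using eps_over_sq(1)[of u] u mu_pos before by (intro mult_left_mono) auto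
    then show ?thesis using before(1)[OF u] by simp
  qed
  consider "t \<le> - \<mu>" | "- \<mu> < t" "t < tc" | "tc \<le> t" by linarith
  then show ?thesis
  proof cases
    case 1
    then have "\<bar>t\<bar> = max \<mu> \<bar>t\<bar>" using mu_pos by auto
    moreover have "- T \<le> t" using t by linarith
    ultimately show ?thesis using pre[of t] 1 xs_bounds[OF t] C_max by (auto simp: distrib_right)
  next
    case 2
    have muT: "\<mu> \<le> T" using X D by linarith
    have "x (- \<mu>) \<le> xs (- \<mu>) + C1 * \<mu>" using pre[of "- \<mu>"] muT mu_pos by simp
    moreover have "xs (- \<mu>) \<le> C * \<mu>" using xs_bounds[of "- \<mu>"] rho_outer[of "- \<mu>"] muT mu_pos by simp
    ultimately have X0: "x (- \<mu>) \<le> (C + C1) * \<mu>" by (simp add: distrib_right)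
    have tD: "t \<le> D" using 2 tc by linarith
    have ab: "xs u < x u" if "- \<mu> \<le> u" "u \<le> t" for u
      using tc(3)[of u] that 2 muT by linarith
    have "x t \<le> (C + C1) * \<mu>"
      by (rule falls_while_above[OF X0 X(1) muT tD ab _ order_refl]) (use 2 in auto)
    also have "\<dots> \<le> (C + C1) * max \<mu> \<bar>t\<bar>" using C before by (intro mult_left_mono) auto
    finally show ?thesis .
  next
    case 3
    then have "x t \<le> xs t" using tc(4) tc(5)[of t] t by (cases "t = tc") (auto simp: abs_le_iff)
    then show ?thesis using xs_bounds[OF t] C_max C1_max by (simp add: distrib_right)
  qed
qed

text \<open>The inequality \<open>20 A \<le> 59 B x^2\<close> gives \<open>A - 3 B x^2 \<le> - B x^2 / 20\<close>; half of
  this margin is spent on the errors of the normal form.\<close>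

lemma linearization_inner:
  assumes t: "\<bar>t\<bar> \<le> D" and x: "0 < x t" "x t \<le> R0" "20 * A t \<le> 59 * B * (x t)\<^sup>2"
    and eta: "\<eta> * (4 + 6 * B / p) \<le> B / 40"
  shows "B / 40 * (x t)\<^sup>2 \<le> - fx (x t) t" "- fx (x t) t \<le> 3 * B * (x t)\<^sup>2 + \<eta> * t\<^sup>2"
proof -
  note nf = normal_form_deriv[OF t x(1,2)]
  have "- fx (x t) t \<le> 3 * B * (x t)\<^sup>2 + \<eta> * t\<^sup>2 - (a0 + a1 * t\<^sup>2) - 2 * (\<eta> * (x t)\<^sup>2)"
    using nf by (simp add: B_def abs_le_iff algebra_simps)
  moreover have "0 \<le> a1 * t\<^sup>2" "0 \<le> \<eta> * (x t)\<^sup>2" using coeffs by auto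
  ultimately show "- fx (x t) t \<le> 3 * B * (x t)\<^sup>2 + \<eta> * t\<^sup>2" using a0 by linarith
  have 1: "fx (x t) t \<le> A t + 2 * \<eta> * t\<^sup>2 - 3 * B * (x t)\<^sup>2 + 4 * \<eta> * (x t)\<^sup>2"
    using nf by (simp add: A_def p_def B_def abs_le_iff algebra_simps)
  have "20 * a0 + 20 * (p * t\<^sup>2) \<le> 59 * (B * (x t)\<^sup>2)" using x(3) by (simp add: A_def)
  moreover have "0 \<le> B * (x t)\<^sup>2" using B_pos by simp
  ultimately have "p * t\<^sup>2 \<le> 3 * (B * (x t)\<^sup>2)" using a0 by linarith
  then have "t\<^sup>2 \<le> 3 * (B * (x t)\<^sup>2) / p" using p_pos by (simp add: pos_le_divide_eq mult.commute)
  then have "t\<^sup>2 \<le> 3 * B / p * (x t)\<^sup>2" by simp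
  then have 2: "2 * \<eta> * t\<^sup>2 \<le> 2 * \<eta> * (3 * B / p * (x t)\<^sup>2)" using coeffs by (intro mult_left_mono) auto
  have 3: "\<eta> * (4 + 6 * B / p) * (x t)\<^sup>2 \<le> B / 40 * (x t)\<^sup>2" using eta by (intro mult_right_mono) auto
  have "2 * \<eta> * (3 * B / p * (x t)\<^sup>2) + 4 * \<eta> * (x t)\<^sup>2 = \<eta> * (4 + 6 * B / p) * (x t)\<^sup>2"
    by (simp add: algebra_simps)
  then show "B / 40 * (x t)\<^sup>2 \<le> - fx (x t) t" using 1 2 3 x(3) by simp
qed

end

section \<open>Choice of constants for the slow passage\<close>

text \<open>The four assertions of the theorem for a fixed \<open>\<epsilon>\<close> in terms of the single scale
  \<open>\<mu>\<close>, with constants \<open>k\<close>, \<open>K\<close>, \<open>N\<close>. It uses \<open>(\<epsilon> / a0) \<and> \<epsilon>^(1/3) = \<epsilon> / \<mu>^2\<close> and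
  \<open>t^2 \<or> a0 \<or> \<epsilon>^(2/3) = (max \<mu> \<bar>t\<bar>)^2\<close>.\<close>

definition passage_profile where
  "passage_profile T k K N \<epsilon> a0 ts fx xs x \<longleftrightarrow>
    (\<exists>tc. - T < tc \<and> tc < T \<and> x tc = xs tc \<and>
       (\<forall>t. - T \<le> t \<and> t < tc \<longrightarrow> xs t < x t) \<and> (\<forall>t. tc < t \<and> t \<le> T \<longrightarrow> x t < xs t) \<and>
       k * (\<epsilon> / (inner_scale a0 \<epsilon>)\<^sup>2) \<le> tc - ts \<and> tc - ts \<le> K * (\<epsilon> / (inner_scale a0 \<epsilon>)\<^sup>2)) \<and>
    (\<forall>t. - T \<le> t \<and> t \<le> - N * inner_scale a0 \<epsilon> \<longrightarrow>
       k * (\<epsilon> / t\<^sup>2) \<le> x t - xs t \<and> x t - xs t \<le> K * (\<epsilon> / t\<^sup>2)) \<and>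
    (\<forall>t. N * inner_scale a0 \<epsilon> \<le> t \<and> t \<le> T \<longrightarrow>
       k * (\<epsilon> / t\<^sup>2) \<le> xs t - x t \<and> xs t - x t \<le> K * (\<epsilon> / t\<^sup>2)) \<and>
    (\<forall>t. \<bar>t\<bar> \<le> T \<longrightarrow> k * max (inner_scale a0 \<epsilon>) \<bar>t\<bar> \<le> x t \<and> x t \<le> K * max (inner_scale a0 \<epsilon>) \<bar>t\<bar>) \<and>
    (\<forall>t. \<bar>t\<bar> \<le> T \<longrightarrow> k * (max (inner_scale a0 \<epsilon>) \<bar>t\<bar>)\<^sup>2 \<le> - fx (x t) t \<and>
       - fx (x t) t \<le> K * (max (inner_scale a0 \<epsilon>) \<bar>t\<bar>)\<^sup>2)"

text \<open>The constants have to be chosen before \<open>\<epsilon>\<close>. The dependencies are: \<open>C1\<close>, \<open>c1\<close> for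
  the passage before \<open>- \<mu>\<close>; then \<open>g\<close>, \<open>h\<close>, \<open>M\<close>, \<open>m\<close> for the delay of the crossing and \<open>L\<close>
  for its existence; \<open>r\<close>, \<open>c3\<close> for the floor; \<open>C3\<close>, \<open>N\<close>, \<open>C2\<close>, \<open>c5\<close> for the lag after the
  crossing; \<open>G\<close>, \<open>\<Lambda>\<close> for the upper bound of the crossing time. Every barrier then asks that
  some multiple of \<open>\<mu>\<close> be small, which is a bound \<open>\<mu> \<le> \<nu>\<close>.\<close>

lemma slow_passage_asymptotics:
  fixes T d D R R0 c C b a1 \<eta> :: real
  assumes c: "0 < c" "c \<le> 1" "1 \<le> C" and D: "0 < D" "D \<le> T" "T < 1/2" and R: "0 < R" "2 * R \<le> R0"
    and coeffs: "0 < b" "0 < \<eta>" "\<eta> < a1"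
    and room2: "2 * (a1 - \<eta>) * D\<^sup>2 \<le> (b + \<eta>) * R0\<^sup>2"
    and eta: "\<eta> * (4 + 6 * (b + \<eta>) / (a1 - \<eta>)) \<le> (b + \<eta>) / 40"
  shows "\<exists>k K N \<nu>. 0 < k \<and> 0 < K \<and> 1 \<le> N \<and> 0 < \<nu> \<and>
    (\<forall>\<epsilon> a0 ts f fx xs xs' x.
       slow_passage T d D R R0 c C b a1 \<eta> \<epsilon> a0 ts f fx xs xs' x \<longrightarrow> inner_scale a0 \<epsilon> \<le> \<nu> \<longrightarrow>
       passage_profile T k K N \<epsilon> a0 ts fx xs x)"
proof -
  define p B where "p = a1 - \<eta>" and "B = b + \<eta>"
  have pB: "0 < p" "0 < B" using coeffs by (auto simp: p_def B_def)
  have T0: "0 < T" using D by linarith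
  define C1 where "C1 = C + 3 * C / c ^ 3"
  have C1: "C \<le> C1" "2 * C < c ^ 3 * C1" "0 < C1"
  proof -
    show "C \<le> C1" "0 < C1" using c by (auto simp: C1_def add_pos_nonneg)
    have "c ^ 3 * C1 = c ^ 3 * C + 3 * C" using c by (simp add: C1_def distrib_left)
    moreover have "0 < c ^ 3 * C" using c by simp
    ultimately show "2 * C < c ^ 3 * C1" using c by linarith
  qed
  define K0 where "K0 = C * (C + 1) * (2 * C + 1)"
  have K0: "0 < K0" using c by (simp add: K0_def)
  define c1 where "c1 = min (c * T\<^sup>2) (c / (4 * (K0 + 2)))"
  have c1: "0 < c1" "c1 \<le> c * T\<^sup>2" "c1 * (K0 + 2) < c / 2"
  proof -
    show "0 < c1" using c T0 K0 by (simp add: c1_def)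
    show "c1 \<le> c * T\<^sup>2" unfolding c1_def by (rule min.cobounded1)
    have "c1 * (K0 + 2) \<le> c / (4 * (K0 + 2)) * (K0 + 2)"
      using K0 by (intro mult_right_mono) (auto simp: c1_def)
    also have "\<dots> = c / 4" using K0 by (simp add: divide_simps)
    also have "\<dots> < c / 2" using c by simp
    finally show "c1 * (K0 + 2) < c / 2" .
  qed
  define h where "h = 1 / (2 * K0)"
  have h: "0 < h" "K0 * h < 1" using K0 by (auto simp: h_def)
  define g where "g = min (c1 / (3/2 + h)) (min (1 / (3/2 + h)) (c / K0))"
  have g: "0 < g" "g * (3/2 + h) \<le> c1" "g * (3/2 + h) \<le> 1" "K0 * g \<le> c"
  proof -
    have h3: "0 < 3/2 + h" using h by simp
    show "0 < g" using c1 h3 c K0 by (simp add: g_def)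
    have "g \<le> c1 / (3/2 + h)" "g \<le> 1 / (3/2 + h)" "g \<le> c / K0" by (auto simp: g_def)
    then show "g * (3/2 + h) \<le> c1" "g * (3/2 + h) \<le> 1" "K0 * g \<le> c"
      using h3 K0 by (simp_all add: pos_le_divide_eq mult.commute)
  qed
  have gh: "0 < g * h" "g * h \<le> 1"
  proof -
    show "0 < g * h" using g h by simp
    have "g * h \<le> g * (3/2 + h)" using g by (intro mult_left_mono) auto
    then show "g * h \<le> 1" using g by linarith
  qed
  define M where "M = K0 * (g * h) + 2 * C + 1"
  have M: "K0 * (g * h) + 2 * C < M" "0 < M" using K0 gh c by (auto simp: M_def add_pos_nonneg add_nonneg_pos)
  define m where "m = min (1/2) (g * h / M)"
  have m: "M * m \<le> g * h" "0 < m" "m \<le> 1/2"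
  proof -
    show "0 < m" using gh M by (simp add: m_def)
    show "m \<le> 1/2" unfolding m_def by (rule min.cobounded1)
    have "m \<le> g * h / M" by (simp add: m_def)
    then show "M * m \<le> g * h" using M by (simp add: pos_le_divide_eq mult.commute)
  qed
  \<comment> \<open>at \<open>L \<mu>\<close> the equilibrium is at least \<open>c L \<mu> = (C + C1) \<mu>\<close>, an upper bound for
    \<open>x (- \<mu>)\<close>\<close>
  define L where "L = (C + C1) / c"
  have L: "1 \<le> L" "(C + C1) = c * L"
  proof -
    have "c \<le> C + C1" using c C1 by linarith
    then show "1 \<le> L" using c by (simp add: L_def pos_le_divide_eq)
    show "(C + C1) = c * L" using c by (simp add: L_def)
  qed
  define r where "r = root 3 (1 / p)"
  have r: "0 < r" "p * r ^ 3 = 1" using pB by (simp_all add: r_def real_root_pow_pos2)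
  define c3 where "c3 = sqrt (min (20 / (59 * B)) (min (20 * p / (59 * B)) (3 * p * r\<^sup>2 / (10 * B))))"
  have c3: "0 < c3" "59 * B * c3\<^sup>2 \<le> 20" "59 * B * c3\<^sup>2 \<le> 20 * p" "10 * B * c3\<^sup>2 \<le> 3 * p * r\<^sup>2"
  proof -
    show "0 < c3" using pB r by (simp add: c3_def)
    have "c3\<^sup>2 = min (20 / (59 * B)) (min (20 * p / (59 * B)) (3 * p * r\<^sup>2 / (10 * B)))"
      unfolding c3_def using pB r by (intro real_sqrt_pow2) auto
    then have "c3\<^sup>2 \<le> 20 / (59 * B)" "c3\<^sup>2 \<le> 20 * p / (59 * B)" "c3\<^sup>2 \<le> 3 * p * r\<^sup>2 / (10 * B)" by auto
    then show "59 * B * c3\<^sup>2 \<le> 20" "59 * B * c3\<^sup>2 \<le> 20 * p" "10 * B * c3\<^sup>2 \<le> 3 * p * r\<^sup>2"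
      using pB by (simp_all add: pos_le_divide_eq mult_ac)
  qed
  define C3 where "C3 = 3 * C / (c * c3\<^sup>2)"
  have C3: "2 * C < c * c3\<^sup>2 * C3" "0 < C3" using c c3 by (auto simp: C3_def)
  define c4 where "c4 = min c3 (c / 2)"
  have c4: "0 < c4" "c4 \<le> c3" "c4 \<le> c / 2" unfolding c4_def using c c3 by (auto intro: min.cobounded1 min.cobounded2 simp del: min_def)
  define N where "N = max (2 * L) (4 / (c\<^sup>2 * c4))"
  have N: "1 \<le> N" "2 * L \<le> N" "4 \<le> N ^ 3 * (c\<^sup>2 * c4)"
  proof -
    show N1: "1 \<le> N" "2 * L \<le> N" using L by (auto simp: N_def)
    have "4 / (c\<^sup>2 * c4) \<le> N" by (simp add: N_def)
    also have "N \<le> N ^ 3" using N1 by (simp add: power_increasing[of 1 3 N, simplified])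
    finally show "4 \<le> N ^ 3 * (c\<^sup>2 * c4)" using c c4 by (simp add: pos_divide_le_eq)
  qed
  define C2 where "C2 = C3 * N\<^sup>2 + 5 * C / (c\<^sup>2 * c4)"
  have C2: "C3 * N\<^sup>2 \<le> C2" "4 * C < C2 * (c\<^sup>2 * c4)" "0 < C2"
  proof -
    show "C3 * N\<^sup>2 \<le> C2" "0 < C2" using c c4 C3 by (auto simp: C2_def add_nonneg_pos)
    have "C2 * (c\<^sup>2 * c4) = C3 * N\<^sup>2 * (c\<^sup>2 * c4) + 5 * C" using c c4 by (simp add: C2_def distrib_right)
    moreover have "0 \<le> C3 * N\<^sup>2 * (c\<^sup>2 * c4)" using C3 c4 by simp
    ultimately show "4 * C < C2 * (c\<^sup>2 * c4)" using c by linarith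
  qed
  define c5 where "c5 = min (c / 2) (c / (4 * (2 * C ^ 3 + 1)))"
  have c5: "0 < c5" "c5 \<le> c / 2" "c5 * (2 * C ^ 3 + 1) < c / 2"
  proof -
    have C3': "0 < 2 * C ^ 3 + 1" using c by (simp add: add_pos_pos)
    show "0 < c5" using c C3' by (simp add: c5_def)
    show "c5 \<le> c / 2" unfolding c5_def by (rule min.cobounded1)
    have "c5 * (2 * C ^ 3 + 1) \<le> c / (4 * (2 * C ^ 3 + 1)) * (2 * C ^ 3 + 1)"
      using C3' by (intro mult_right_mono) (auto simp: c5_def)
    also have "\<dots> = c / 4" using C3' by (simp add: divide_simps)
    also have "\<dots> < c / 2" using c by simp
    finally show "c5 * (2 * C ^ 3 + 1) < c / 2" .
  qed
  define G where "G = 2 * C1 + C / c ^ 3"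
  have G: "2 * C1 \<le> G" "C \<le> c ^ 3 * G" "0 < G"
  proof -
    show "2 * C1 \<le> G" "0 < G" using c C1 by (auto simp: G_def add_pos_nonneg)
    have "c ^ 3 * G = 2 * (c ^ 3 * C1) + C" using c by (simp add: G_def distrib_left)
    moreover have "0 < c ^ 3 * C1" using c C1 by simp
    ultimately show "C \<le> c ^ 3 * G" by linarith
  qed
  define \<Lambda> where "\<Lambda> = 2 / c ^ 3 + (G + 1) * L / c"
  have Lam: "1 < c ^ 3 * \<Lambda>" "G < c / L * \<Lambda>" "0 < \<Lambda>"
  proof -
    have pos: "0 < 2 / c ^ 3" "0 < (G + 1) * L / c" using c G L by auto
    show "0 < \<Lambda>" unfolding \<Lambda>_def by (rule add_pos_pos[OF pos])
    have "c ^ 3 * \<Lambda> = 2 + c ^ 3 * ((G + 1) * L / c)" using c by (simp add: \<Lambda>_def distrib_left)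
    then show "1 < c ^ 3 * \<Lambda>" using mult_pos_pos[OF _ pos(2), of "c ^ 3"] c by simp
    have "0 < L" using L by linarith
    then have "c / L * (y * L / c) = y" for y using c by simp
    then have "c / L * \<Lambda> = c / L * (2 / c ^ 3) + (G + 1)" unfolding \<Lambda>_def distrib_left by simp
    moreover have "0 < c / L * (2 / c ^ 3)" using c L by simp
    ultimately show "G < c / L * \<Lambda>" by linarith
  qed
  \<comment> \<open>the upper bounds that the individual estimates impose on \<open>\<mu>\<close>\<close>
  define S where "S = {R, R / C1, R / (C + C1), D, D / L, D / N, R / (G * (3/2 + \<Lambda>)), R / C3, R / C2,
     c * D / 2 / C2, D / (2 * r), sqrt p * D, D / (2 * L)}"
  define \<nu> where "\<nu> = Min S"
  have fin: "finite S" "S \<noteq> {}" by (auto simp: S_def)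
  have L0: "0 < L" "0 < N" using L N by auto
  have CC: "0 < C + C1" using c C1 by linarith
  have "0 < G * (3/2 + \<Lambda>)" using G Lam by simp
  then have "\<forall>y\<in>S. 0 < y" using R C1 c D L0 C3 C2 r pB by (auto simp: S_def)
  then have nu: "0 < \<nu>" unfolding \<nu>_def using fin by simp
  \<comment> \<open>the lower and upper constants of the individual estimates\<close>
  define Sk where "Sk = {m, c1, c5 / 2, c3, c / 2, B / 40 * c3\<^sup>2, c}"
  define SK where "SK = {\<Lambda>, L + 1, C1, C2, C + C1, 3 * B * (C + C1)\<^sup>2 + \<eta>, C / D\<^sup>2}"
  have fin': "finite Sk" "Sk \<noteq> {}" "finite SK" by (auto simp: Sk_def SK_def)
  define k where "k = Min Sk"
  define K where "K = Max SK"
  have kle: "k \<le> y" if "y \<in> Sk" for y unfolding k_def by (rule Min_le[OF fin'(1) that])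
  have leK: "y \<le> K" if "y \<in> SK" for y unfolding K_def by (rule Max_ge[OF fin'(3) that])
  have k: "k \<le> m" "k \<le> c1" "k \<le> c5 / 2" "k \<le> c3" "k \<le> c / 2" "k \<le> B / 40 * c3\<^sup>2" "k \<le> c"
    by (rule kle, simp add: Sk_def)+
  have "\<forall>y\<in>Sk. 0 < y" using m c1 c5 c3 c pB by (auto simp: Sk_def)
  then have k0: "0 < k" unfolding k_def using fin' by simp
  have K: "\<Lambda> \<le> K" "L + 1 \<le> K" "C1 \<le> K" "C2 \<le> K" "C + C1 \<le> K" "3 * B * (C + C1)\<^sup>2 + \<eta> \<le> K" "C / D\<^sup>2 \<le> K"
    by (rule leK, simp add: SK_def)+
  then have K_pos: "0 < K" using C1 by linarith
  have room': "2 * p * D\<^sup>2 \<le> B * R0\<^sup>2" using room2 by (simp add: p_def B_def)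
  have eta': "\<eta> * (4 + 6 * B / p) \<le> B / 40" using eta by (simp add: p_def B_def)
  have c1': "c1 * (C * (C + 1) * (2 * C + 1) + 2) < c / 2" using c1(3) by (simp add: K0_def)
  note local_defs = p_def B_def K0_def
  show ?thesis
  proof (intro exI conjI allI impI)
    fix \<epsilon> a0 ts f fx xs xs' x
    assume sp: "slow_passage T d D R R0 c C b a1 \<eta> \<epsilon> a0 ts f fx xs xs' x"
      and small: "inner_scale a0 \<epsilon> \<le> \<nu>"
    interpret slow_passage T d D R R0 c C b a1 \<eta> \<epsilon> a0 ts f fx xs xs' x by (rule sp)
    have muS: "\<mu> \<le> y" if "y \<in> S" for y
      using small Min_le[OF fin(1) that] by (simp add: \<nu>_def)
    have muR: "\<mu> \<le> R" and muD: "\<mu> \<le> D" using muS by (auto simp: S_def)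
    have mult_le: "y * \<mu> \<le> w" if "w / y \<in> S" "0 < y" for w y
      using muS[OF that(1)] that(2) by (simp add: pos_le_divide_eq mult.commute)
    have muC1: "C1 * \<mu> \<le> R" and muX: "(C + C1) * \<mu> \<le> R" and muL: "L * \<mu> \<le> D" and muN: "N * \<mu> \<le> D"
      and muG: "G * (3/2 + \<Lambda>) * \<mu> \<le> R" and muC3: "C3 * \<mu> \<le> R" and muC2: "C2 * \<mu> \<le> R" "C2 * \<mu> \<le> c * D / 2"
      and mur: "2 * r * \<mu> \<le> D"
      by (rule mult_le; use C1 CC L0 G Lam C3 C2 r in \<open>simp add: S_def\<close>)+
    have muT: "\<mu> \<le> T" using muD D by linarith
    have mup: "\<mu> \<le> sqrt p * D" using muS by (auto simp: S_def)
    have a0_small: "a0 + p * D\<^sup>2 \<le> B * R0\<^sup>2"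
    proof -
      have "a0 \<le> (sqrt p * D)\<^sup>2" using a0_le power_mono[OF mup, of 2] mu_pos by simp
      then have "a0 \<le> p * D\<^sup>2" using pB by (simp add: power_mult_distrib)
      then show ?thesis using room' by linarith
    qed
    have tsT: "ts \<le> T" "- T < ts" "- D < ts" using ts_mu muD D mu_pos by linarith+
    have K0_eq: "slow_passage.K0 C = K0" by (simp add: local_defs slow_passage.K0_def[OF sp])
    have pB_eq: "slow_passage.p a1 \<eta> = p" "slow_passage.B b \<eta> = B"
      by (simp_all add: local_defs slow_passage.p_def[OF sp] slow_passage.B_def[OF sp])
    have upper: "x t \<le> xs t + C1 * \<epsilon> / t\<^sup>2" if "- T \<le> t" "t \<le> - \<mu>" for t
      by (rule before_upper[OF C1(1,2) muC1 that])
    have lower: "xs t + c1 * \<epsilon> / t\<^sup>2 \<le> x t" if "- T \<le> t" "t \<le> - \<mu>" for t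
      by (rule before_lower[OF c1(1,2) c1' muR that])
    have lower0: "xs (- \<mu>) + c1 * \<epsilon> / \<mu>\<^sup>2 \<le> x (- \<mu>)" using lower[of "- \<mu>"] muT by simp
    have upper0: "x (- \<mu>) \<le> xs (- \<mu>) + C1 * \<epsilon> / \<mu>\<^sup>2" using upper[of "- \<mu>"] muT by simp
    have at_min: "xs ts + g * h * \<epsilon>\<^sup>2 / \<mu> ^ 5 < x ts"
      by (rule at_minimum[OF g(1) h(1) g(2,3) _ _ muR muD lower0]) (use g h K0_eq in auto)
    have after_min: "xs t < x t" if "ts \<le> t" "t \<le> ts + m * \<epsilon> / \<mu>\<^sup>2" for t
      by (rule after_minimum[OF gh _ m muR muD at_min that]) (use M K0_eq in auto)
    have X0: "x (- \<mu>) \<le> c * (L * \<mu>)"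
    proof -
      have "C1 * (\<epsilon> / \<mu>\<^sup>2) \<le> C1 * \<mu>" using ratio2_le_mu C1 by (intro mult_left_mono) auto
      moreover have "xs (- \<mu>) \<le> C * \<mu>" using xs_bounds[of "- \<mu>"] rho_outer[of "- \<mu>"] muT mu_pos by simp
      ultimately have "x (- \<mu>) \<le> (C + C1) * \<mu>" using upper0 by (simp add: distrib_right)
      then show ?thesis by (simp add: L(2) mult.assoc)
    qed
    have XR: "c * (L * \<mu>) \<le> R" using muX by (simp add: L(2) mult.assoc)
    from crossing_exists[OF after_min m(2,3) X0 XR order_refl L(1) muL]
    obtain tc where tc: "ts + m * \<epsilon> / \<mu>\<^sup>2 < tc" "tc \<le> L * \<mu>" "x tc = xs tc"
      and before: "\<And>t. - T \<le> t \<Longrightarrow> t < tc \<Longrightarrow> xs t < x t"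
      and after: "\<And>t. tc < t \<Longrightarrow> t \<le> T \<Longrightarrow> x t < xs t" by blast
    have "0 < m * \<epsilon> / \<mu>\<^sup>2" using m eps mu_pos by simp
    then have ts_tc: "ts < tc" using tc by linarith
    have tcD: "- D < tc" "tc \<le> D" "tc < T" "- \<mu> < tc"
    proof -
      show "- D < tc" "tc \<le> D" using ts_tc tsT tc muL by linarith+
      have "2 * L * \<mu> \<le> D" using mult_le[of D "2 * L"] L0 by (auto simp: S_def)
      moreover have "0 < L * \<mu>" using L0 mu_pos by simp
      ultimately show "tc < T" using tc D by linarith
      show "- \<mu> < tc" using ts_tc ts_mu mu_pos by linarith
    qed
    note tcs = tcD(4,2) before tc(3) after
    have startD: "xs (- D) < x (- D)" using before[of "- D"] tcD D by auto
    note pf = proportional_floor[OF r(1), unfolded pB_eq, OF r(2) mur a0_small startD c3]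
    have gu: "x t \<le> (C + C1) * max \<mu> \<bar>t\<bar>" if "\<bar>t\<bar> \<le> T" for t
      by (rule global_upper[OF upper C1(3) muX muD tcs that])
    have inner: "xs (N * \<mu>) - C3 * \<epsilon> / \<mu>\<^sup>2 \<le> x (N * \<mu>)"
    proof (rule after_inner[OF _ tc(3) pf(1) c3(1) C3(1) muC3 C3(2) _ muN])
      have "L * \<mu> \<le> N * \<mu>" using N L0 mu_pos by (intro mult_right_mono) auto
      then show "tc \<le> N * \<mu>" using tc by linarith
    qed (use tcD in auto)
    have au: "xs t - C2 * \<epsilon> / t\<^sup>2 \<le> x t" if "N * \<mu> \<le> t" "t \<le> T" for t
      by (rule after_upper[OF N(1) muN inner pf(1) c3(1) c4 C2(1) N(3) C2(2,3) muC2 that])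
    have al: "x t \<le> xs t - c5 / 2 * \<epsilon> / t\<^sup>2" if t: "N * \<mu> \<le> t" "t \<le> T" for t
    proof (rule after_lower[OF L(1) _ _ c5 muR _ t(2)])
      show "L * \<mu> \<le> T" using muL D by linarith
      show "x (L * \<mu>) \<le> xs (L * \<mu>)"
        using after[of "L * \<mu>"] tc muL D by (cases "tc = L * \<mu>") auto
      have "2 * L * \<mu> \<le> N * \<mu>" using N mu_pos by (intro mult_right_mono) auto
      then show "2 * L * \<mu> \<le> t" using t by linarith
    qed
    have muN1: "\<mu> \<le> N * \<mu>" using N mu_pos by simp
    have mx0: "0 < max \<mu> \<bar>t\<bar>" for t using mu_pos by (simp add: less_max_iff_disj)
    have gl: "k * max \<mu> \<bar>t\<bar> \<le> x t" if t: "\<bar>t\<bar> \<le> T" for t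
    proof -
      consider "\<bar>t\<bar> \<le> D" | "t < - D" | "D < t" by linarith
      then show ?thesis
      proof cases
        case 1
        have "k * max \<mu> \<bar>t\<bar> \<le> c3 * max \<mu> \<bar>t\<bar>" using k mx0[of t] by (intro mult_right_mono) auto
        then show ?thesis using pf(1)[OF 1] by linarith
      next
        case 2
        then have e: "max \<mu> \<bar>t\<bar> = \<bar>t\<bar>" "\<rho> t = \<bar>t\<bar>" using muD rho_outer[of t] by auto
        have "k * \<bar>t\<bar> \<le> c * \<bar>t\<bar>" using k by (intro mult_right_mono) auto
        also have "\<dots> \<le> xs t" using xs_bounds[OF t] e by simp
        also have "\<dots> \<le> x t" using before[of t] 2 tcD t by (auto simp: abs_le_iff)
        finally show ?thesis using e by simp
      next
        case 3
        then have e: "max \<mu> \<bar>t\<bar> = t" "\<rho> t = t" using muD rho_outer[of t] mu_pos by auto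
        have "C2 * (\<epsilon> / t\<^sup>2) \<le> C2 * \<mu>" using eps_over_sq(2)[of t] 3 muD D C2 by (intro mult_left_mono) auto
        then have z: "C2 * \<epsilon> / t\<^sup>2 \<le> c * D / 2" using muC2 unfolding times_divide_eq_right by linarith
        have "c * D \<le> c * t" using 3 c by simp
        moreover have "k * t \<le> c / 2 * t" using k 3 D by (intro mult_right_mono) auto
        moreover have "c * t \<le> xs t" using xs_bounds[OF t] e by simp
        moreover have "xs t - C2 * \<epsilon> / t\<^sup>2 \<le> x t" using au[of t] 3 muN t by auto
        moreover have "c / 2 * t = c * t / 2" by simp
        ultimately show ?thesis unfolding e(1) using z by linarith
      qed
    qed
    have lin: "k * (max \<mu> \<bar>t\<bar>)\<^sup>2 \<le> - fx (x t) t \<and> - fx (x t) t \<le> K * (max \<mu> \<bar>t\<bar>)\<^sup>2" if t: "\<bar>t\<bar> \<le> T" for t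
    proof (cases "\<bar>t\<bar> \<le> D")
      case True
      have x0: "0 < x t" by (rule pf(3)[OF True])
      \<comment> \<open>the normal form is available at \<open>x t\<close>: before \<open>- \<mu>\<close> and after the crossing by
        comparison with \<open>xs\<close>, in between because \<open>x\<close> does not exceed \<open>R\<close>\<close>
      have xR0: "x t \<le> R0"
      proof (cases "t < - \<mu>")
        case t1: True
        have "C1 * (\<epsilon> / t\<^sup>2) \<le> C1 * \<mu>" using eps_over_sq(2)[of t] t1 mu_pos C1 by (intro mult_left_mono) auto
        then have "C1 * \<epsilon> / t\<^sup>2 \<le> R" using muC1 by simp
        then show ?thesis using upper[of t] t1 t xs_small[OF True] R R0 by (simp add: abs_le_iff)
      next
        case f1: False
        show ?thesis
        proof (cases "t \<le> \<mu>")
          case True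
          then have "max \<mu> \<bar>t\<bar> = \<mu>" using f1 by auto
          then show ?thesis using gu[OF t] muX R R0 by simp
        next
          case f2: False
          show ?thesis
          proof (cases "t < tc")
            case tt: True
            have muL0: "- \<mu> \<le> t" using f2 mu_pos by linarith
            have ab: "xs u < x u" if "- \<mu> \<le> u" "u \<le> t" for u
              using before[of u] that tt muT by linarith
            have "x t \<le> c * (L * \<mu>)"
              by (rule falls_while_above[OF X0 XR muT _ ab muL0 order_refl]) (use True in auto)
            then show ?thesis using XR R R0 by linarith
          next
            case False
            then have "x t \<le> xs t" using after[of t] tc t by (cases "t = tc") (auto simp: abs_le_iff)
            then show ?thesis using xs_small[OF \<open>\<bar>t\<bar> \<le> D\<close>] R R0 by linarith
          qed
        qed
      qed
      note li = linearization_inner[unfolded pB_eq, OF True x0 xR0 pf(2)[OF True] eta']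
      have "k * (max \<mu> \<bar>t\<bar>)\<^sup>2 \<le> B / 40 * c3\<^sup>2 * (max \<mu> \<bar>t\<bar>)\<^sup>2" using k by (intro mult_right_mono) auto
      also have "\<dots> = B / 40 * (c3 * max \<mu> \<bar>t\<bar>)\<^sup>2" by (simp add: power_mult_distrib)
      also have "\<dots> \<le> B / 40 * (x t)\<^sup>2"
        using pf(1)[OF True] c3 mx0[of t] pB by (intro mult_left_mono power_mono mult_nonneg_nonneg) auto
      finally have 1: "k * (max \<mu> \<bar>t\<bar>)\<^sup>2 \<le> - fx (x t) t" using li by linarith
      have "3 * B * (x t)\<^sup>2 + \<eta> * t\<^sup>2 \<le> 3 * B * ((C + C1) * max \<mu> \<bar>t\<bar>)\<^sup>2 + \<eta> * (max \<mu> \<bar>t\<bar>)\<^sup>2"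
      proof (rule add_mono)
        have "(x t)\<^sup>2 \<le> ((C + C1) * max \<mu> \<bar>t\<bar>)\<^sup>2" using gu[OF t] x0 by (intro power_mono) auto
        then show "3 * B * (x t)\<^sup>2 \<le> 3 * B * ((C + C1) * max \<mu> \<bar>t\<bar>)\<^sup>2" using pB by (intro mult_left_mono) auto
        have "\<bar>t\<bar>\<^sup>2 \<le> (max \<mu> \<bar>t\<bar>)\<^sup>2" by (intro power_mono) auto
        then show "\<eta> * t\<^sup>2 \<le> \<eta> * (max \<mu> \<bar>t\<bar>)\<^sup>2" using coeffs by (intro mult_left_mono) auto
      qed
      also have "\<dots> = (3 * B * (C + C1)\<^sup>2 + \<eta>) * (max \<mu> \<bar>t\<bar>)\<^sup>2"
        unfolding power_mult_distrib distrib_right[of "3 * B * (C + C1)\<^sup>2" \<eta>] by (rule arg_cong2[where f = "(+)"]) (simp_all only: mult.assoc)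
      also have "\<dots> \<le> K * (max \<mu> \<bar>t\<bar>)\<^sup>2" using K by (intro mult_right_mono) auto
      finally show ?thesis using 1 li by linarith
    next
      case False
      have e: "max \<mu> \<bar>t\<bar> = \<bar>t\<bar>" using False muD by auto
      have x0: "0 < x t" using gl[OF t] k0 mx0[of t] mult_pos_pos[of k "max \<mu> \<bar>t\<bar>"] by linarith
      have near: "\<bar>x t - xs t\<bar> \<le> R" "x t \<le> d"
      proof (atomize(full), cases "t < 0")
        case True
        then have tD: "t < - D" using False by auto
        have "C1 * (\<epsilon> / t\<^sup>2) \<le> C1 * \<mu>" using eps_over_sq(2)[of t] tD muD D C1 by (intro mult_left_mono) auto
        then have "C1 * \<epsilon> / t\<^sup>2 \<le> R" using muC1 by simp
        moreover have "x t \<le> xs t + C1 * \<epsilon> / t\<^sup>2" using upper[of t] tD muD t by (auto simp: abs_le_iff)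
        moreover have "xs t < x t" using before[of t] tD tcD t by (auto simp: abs_le_iff)
        moreover have "xs t \<le> d - R" using room[of t] tD D t by (auto simp: abs_le_iff)
        ultimately show "\<bar>x t - xs t\<bar> \<le> R \<and> x t \<le> d" by linarith
      next
        case f: False
        then have tD: "D < t" using False by auto
        have "C2 * (\<epsilon> / t\<^sup>2) \<le> C2 * \<mu>" using eps_over_sq(2)[of t] tD muD D C2 by (intro mult_left_mono) auto
        then have "C2 * \<epsilon> / t\<^sup>2 \<le> R" using muC2 unfolding times_divide_eq_right by linarith
        moreover have "xs t - C2 * \<epsilon> / t\<^sup>2 \<le> x t" using au[of t] tD muN t by (auto simp: abs_le_iff)
        moreover have "x t < xs t" using after[of t] tD tcD t by (auto simp: abs_le_iff)
        ultimately show "\<bar>x t - xs t\<bar> \<le> R \<and> x t \<le> d" using xs_le_d[OF t] by linarith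
      qed
      have os: "c \<le> - fx (x t) t" "- fx (x t) t \<le> C"
        using outer_slope[OF _ t x0 near(2,1)] False by auto
      have "\<bar>t\<bar>\<^sup>2 \<le> 1" using t T by (intro power_le_one) auto
      then have "k * \<bar>t\<bar>\<^sup>2 \<le> k * 1" using k0 by (intro mult_left_mono) auto
      moreover have "D\<^sup>2 \<le> \<bar>t\<bar>\<^sup>2" using False D by (intro power_mono) auto
      then have "C / D\<^sup>2 * D\<^sup>2 \<le> K * \<bar>t\<bar>\<^sup>2" using K K_pos D by (intro mult_mono) auto
      ultimately show ?thesis using os k D unfolding e by simp
    qed
    \<comment> \<open>the linear barrier if \<open>a0\<close> dominates, the bound \<open>tc \<le> L \<mu>\<close> otherwise\<close>
    have tc_upper: "tc - ts \<le> K * (\<epsilon> / \<mu>\<^sup>2)"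
    proof (cases "\<epsilon> powr (1/3) \<le> sqrt a0")
      case True
      have "tc \<le> ts + \<Lambda> * \<epsilon> / \<mu>\<^sup>2"
        by (rule crossing_time_upper[OF True ts_tc tc(2,3) before L(1) muL upper0 G(1,2) Lam muG])
      moreover have "\<Lambda> * (\<epsilon> / \<mu>\<^sup>2) \<le> K * (\<epsilon> / \<mu>\<^sup>2)" using K eps by (intro mult_right_mono) auto
      ultimately show ?thesis by simp
    next
      case False
      then have "\<mu> = \<epsilon> powr (1/3)" by (simp add: inner_scale_def)
      then have "\<mu> ^ 3 = \<epsilon>" using cube_root by simp
      then have e: "\<epsilon> / \<mu>\<^sup>2 = \<mu>" using mu_pos by (simp add: power2_eq_square power3_eq_cube divide_eq_eq mult_ac)
      have "tc - ts \<le> (L + 1) * \<mu>" using tc ts_mu mu_pos by (simp add: distrib_right)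
      also have "\<dots> \<le> K * \<mu>" using K mu_pos by (intro mult_right_mono) auto
      finally show ?thesis by (simp add: e)
    qed
    have tc_lower: "k * (\<epsilon> / \<mu>\<^sup>2) \<le> tc - ts"
    proof -
      have "k * (\<epsilon> / \<mu>\<^sup>2) \<le> m * (\<epsilon> / \<mu>\<^sup>2)" using k eps by (intro mult_right_mono) auto
      then show ?thesis using tc by simp
    qed
    have kK: "k * (\<epsilon> / t\<^sup>2) \<le> y * \<epsilon> / t\<^sup>2" if "k \<le> y" for y t
      using mult_right_mono[OF that, of "\<epsilon> / t\<^sup>2"] eps by simp
    have KK: "y * \<epsilon> / t\<^sup>2 \<le> K * (\<epsilon> / t\<^sup>2)" if "y \<le> K" for y t
      using mult_right_mono[OF that, of "\<epsilon> / t\<^sup>2"] eps by simp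
    have gu': "x t \<le> K * max \<mu> \<bar>t\<bar>" if "\<bar>t\<bar> \<le> T" for t
      using gu[OF that] mult_right_mono[OF K(5), of "max \<mu> \<bar>t\<bar>"] mx0[of t] by linarith
    show "passage_profile T k K N \<epsilon> a0 ts fx xs x"
      unfolding passage_profile_def
    proof (intro conjI allI impI)
      show "\<exists>tc>- T. tc < T \<and> x tc = xs tc \<and> (\<forall>t. - T \<le> t \<and> t < tc \<longrightarrow> xs t < x t) \<and>
        (\<forall>t. tc < t \<and> t \<le> T \<longrightarrow> x t < xs t) \<and> k * (\<epsilon> / \<mu>\<^sup>2) \<le> tc - ts \<and> tc - ts \<le> K * (\<epsilon> / \<mu>\<^sup>2)"
        using tcD D tc before after tc_lower tc_upper by (intro exI[of _ tc]) auto
    next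
      fix t assume t: "- T \<le> t \<and> t \<le> - N * \<mu>"
      then have tt: "- T \<le> t" "t \<le> - \<mu>" using muN1 by auto
      show "k * (\<epsilon> / t\<^sup>2) \<le> x t - xs t" using lower[OF tt] kK[OF k(2), of t] by linarith
      show "x t - xs t \<le> K * (\<epsilon> / t\<^sup>2)" using upper[OF tt] KK[OF K(3), of t] by linarith
    next
      fix t assume t: "N * \<mu> \<le> t \<and> t \<le> T"
      show "k * (\<epsilon> / t\<^sup>2) \<le> xs t - x t" using al[of t] t kK[OF k(3), of t] by auto
      show "xs t - x t \<le> K * (\<epsilon> / t\<^sup>2)" using au[of t] t KK[OF K(4), of t] by auto
    qed (use gl gu' lin in auto)
  qed (use k0 K_pos N nu in auto)
qed

section \<open>Calculus on the strip\<close>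

lemma Ck_bounded_mono: "Ck_bounded n d K g \<Longrightarrow> K \<le> K' \<Longrightarrow> Ck_bounded n d K' g"
proof (induction n arbitrary: g)
  case 0
  then show ?case by (auto intro: order_trans[of _ K])
next
  case (Suc n)
  have "Ck_bounded n d K' (pdx d g)" "Ck_bounded n d K' (pdt g)"
    using Suc.IH Suc.prems by simp_all
  moreover have "\<forall>x\<in>{- d..d}. \<forall>t. \<bar>g x t\<bar> \<le> K'"
    using Suc.prems by (auto intro: order_trans[of _ K])
  ultimately show ?case using Suc.prems(1) unfolding Ck_bounded.simps by blast
qed

lemma Ck_bounded_lower: "Ck_bounded (Suc n) d K g \<Longrightarrow> Ck_bounded n d K g"
proof (induction n arbitrary: g)
  case 0
  have "continuous_on ({- d..d} \<times> UNIV) (\<lambda>(x, t). g x t)"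
    unfolding continuous_on_eq_continuous_within
  proof
    fix z :: "real \<times> real" assume "z \<in> {- d..d} \<times> UNIV"
    moreover obtain x t where z: "z = (x, t)" by fastforce
    ultimately have "((\<lambda>(y, s). g y s) has_derivative (\<lambda>(u, v). pdx d g x t * u + pdt g x t * v))
      (at (x, t) within {- d..d} \<times> UNIV)"
      using 0 by simp
    then show "continuous (at z within {- d..d} \<times> UNIV) (\<lambda>(x, t). g x t)"
      unfolding z by (rule has_derivative_continuous)
  qed
  then show ?case using 0 by simp
next
  case (Suc n)
  have "Ck_bounded n d K (pdx d g)" "Ck_bounded n d K (pdt g)"
    using Suc.IH[of "pdx d g"] Suc.IH[of "pdt g"] Suc.prems by simp_all
  then show ?case using Suc.prems unfolding Ck_bounded.simps by blast
qed

lemma Ck_bounded_bound: "Ck_bounded n d K g \<Longrightarrow> x \<in> {- d..d} \<Longrightarrow> \<bar>g x t\<bar> \<le> K"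
  by (cases n) auto

lemma Ck_bounded_pdx: "Ck_bounded (Suc n) d K g \<Longrightarrow> Ck_bounded n d K (pdx d g)"
  and Ck_bounded_pdt: "Ck_bounded (Suc n) d K g \<Longrightarrow> Ck_bounded n d K (pdt g)"
  by auto

lemma Ck_has_derivative:
  "Ck_bounded (Suc n) d K g \<Longrightarrow> x \<in> {- d..d} \<Longrightarrow>
    ((\<lambda>(y, s). g y s) has_derivative (\<lambda>(u, v). pdx d g x t * u + pdt g x t * v))
      (at (x, t) within {- d..d} \<times> UNIV)"
  by auto

lemma pdx_deriv:
  assumes "Ck_bounded (Suc n) d K g" "x \<in> {- d..d}"
  shows "((\<lambda>y. g y t) has_real_derivative pdx d g x t) (at x within {- d..d})"
proof -
  have "((\<lambda>y. (y, t)) has_derivative (\<lambda>u. (u, 0))) (at x within {- d..d})"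
    by (intro derivative_eq_intros) auto
  moreover have "((\<lambda>(y, s). g y s) has_derivative (\<lambda>(u, v). pdx d g x t * u + pdt g x t * v))
      (at (x, t) within (\<lambda>y. (y, t)) ` {- d..d})"
    by (rule has_derivative_subset[OF Ck_has_derivative[OF assms]]) auto
  ultimately have "((\<lambda>y. case (y, t) of (y, s) \<Rightarrow> g y s) has_derivative
      (\<lambda>u. case (u, 0) of (u, v) \<Rightarrow> pdx d g x t * u + pdt g x t * v)) (at x within {- d..d})"
    by (rule has_derivative_in_compose)
  then show ?thesis by (simp add: has_field_derivative_def)
qed

lemma pdt_deriv:
  assumes "Ck_bounded (Suc n) d K g" "x \<in> {- d..d}"
  shows "(g x has_real_derivative pdt g x t) (at t)"
proof -
  have "((\<lambda>s. (x, s)) has_derivative (\<lambda>v. (0, v))) (at t)"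
    by (intro derivative_eq_intros) auto
  moreover have "((\<lambda>(y, s). g y s) has_derivative (\<lambda>(u, v). pdx d g x t * u + pdt g x t * v))
      (at (x, t) within range (\<lambda>s. (x, s)))"
    by (rule has_derivative_subset[OF Ck_has_derivative[OF assms]]) (use assms in auto)
  ultimately have "((\<lambda>s. case (x, s) of (y, s) \<Rightarrow> g y s) has_derivative
      (\<lambda>v. case (0, v) of (u, v) \<Rightarrow> pdx d g x t * u + pdt g x t * v)) (at t)"
    by (rule has_derivative_in_compose)
  then show ?thesis by (simp add: has_field_derivative_def)
qed

text \<open>The building block of all Taylor estimates: a bound on the derivative of the
  remainder integrates to a bound on the remainder. The derivative of \<open>g\<close> in \<open>x\<close> is
  one-sided at the boundary of the strip, so the estimate is made within an interval.\<close>

lemma strip_mvt: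
  assumes g: "Ck_bounded (Suc n) d K g" and x: "0 \<le> x" "x \<le> d"
    and dq: "\<And>y. (q has_real_derivative q' y) (at y)"
    and bd: "\<And>y. 0 \<le> y \<Longrightarrow> y \<le> x \<Longrightarrow> \<bar>pdx d g y t - q' y\<bar> \<le> M"
    and zero: "g 0 t = q 0"
  shows "\<bar>g x t - q x\<bar> \<le> M * x"
proof -
  have "norm ((g x t - q x) - (g 0 t - q 0)) \<le> M * norm (x - 0)"
  proof (rule field_differentiable_bound[where S = "{0..x}" and f' = "\<lambda>y. pdx d g y t - q' y"])
    fix y assume y: "y \<in> {0..x}"
    have "((\<lambda>y. g y t) has_real_derivative pdx d g y t) (at y within {0..x})"
      by (rule has_field_derivative_subset[OF pdx_deriv[OF g]]) (use x y in auto)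
    then show "((\<lambda>y. g y t - q y) has_real_derivative pdx d g y t - q' y) (at y within {0..x})"
      by (intro DERIV_diff has_field_derivative_at_within[OF dq])
  qed (use x bd in auto)
  then show ?thesis using x zero by simp
qed

lemma time_mvt:
  assumes g: "Ck_bounded (Suc n) d K g" and x: "x \<in> {- d..d}"
    and dq: "\<And>s. (q has_real_derivative q' s) (at s)"
    and bd: "\<And>s. \<bar>s\<bar> \<le> \<bar>t\<bar> \<Longrightarrow> \<bar>pdt g x s - q' s\<bar> \<le> M"
    and zero: "g x 0 = q 0"
  shows "\<bar>g x t - q t\<bar> \<le> M * \<bar>t\<bar>"
proof -
  have "norm ((g x t - q t) - (g x 0 - q 0)) \<le> M * norm (t - 0)"
  proof (rule field_differentiable_bound[where S = "{- \<bar>t\<bar>..\<bar>t\<bar>}" and f' = "\<lambda>s. pdt g x s - q' s"])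
    fix s
    show "((\<lambda>s. g x s - q s) has_real_derivative pdt g x s - q' s) (at s within {- \<bar>t\<bar>..\<bar>t\<bar>})"
      by (intro has_field_derivative_at_within[OF DERIV_diff[OF pdt_deriv[OF g x] dq]])
  qed (use bd in auto)
  then show ?thesis using zero by simp
qed

lemma Icc_not_bot: "0 < d \<Longrightarrow> x \<in> {- d..d} \<Longrightarrow> at x within {- d..d::real} \<noteq> bot"
  by (auto simp: trivial_limit_within islimpt_Icc)

text \<open>Differentiation in \<open>x\<close> reverses the parity: \<open>\<sigma> = 1\<close> stands for even and \<open>\<sigma> = -1\<close>
  for odd functions.\<close>

lemma pdx_parity:
  assumes g: "Ck_bounded (Suc n) d K g" and d: "0 < d" and x: "x \<in> {- d..d}"
    and par: "\<And>y. y \<in> {- d..d} \<Longrightarrow> g y t = \<sigma> * g (- y) t"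
  shows "pdx d g x t = (- \<sigma>) * pdx d g (- x) t"
proof -
  have img: "uminus ` {- d..d} = {- d..d}" by simp
  have "((\<lambda>y. g y t) has_real_derivative pdx d g (- x) t) (at (- x) within uminus ` {- d..d})"
    unfolding img by (rule pdx_deriv[OF g]) (use x in auto)
  moreover have "(uminus has_real_derivative - 1) (at x within {- d..d})"
    by (auto intro!: derivative_eq_intros)
  ultimately have "((\<lambda>y. g (- y) t) has_real_derivative pdx d g (- x) t * - 1) (at x within {- d..d})"
    using DERIV_image_chain[of "\<lambda>y. g y t" _ uminus x "{- d..d}" "- 1"] by (simp add: o_def)
  then have "((\<lambda>y. \<sigma> * g (- y) t) has_real_derivative \<sigma> * (pdx d g (- x) t * - 1)) (at x within {- d..d})"
    by (rule DERIV_cmult)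
  then have "((\<lambda>y. g y t) has_real_derivative \<sigma> * (pdx d g (- x) t * - 1)) (at x within {- d..d})"
    by (rule has_field_derivative_transform_within[OF _ zero_less_one x]) (rule par[symmetric])
  from has_field_derivative_unique[OF pdx_deriv[OF g x] this Icc_not_bot[OF d x]] show ?thesis by simp
qed

lemma pdt_parity:
  assumes g: "Ck_bounded (Suc n) d K g" and x: "x \<in> {- d..d}" and par: "\<And>t. g x t = \<sigma> * g (- x) t"
  shows "pdt g x t = \<sigma> * pdt g (- x) t"
proof -
  have "((\<lambda>t. \<sigma> * g (- x) t) has_real_derivative \<sigma> * pdt g (- x) t) (at t)"
    using pdt_deriv[OF g, of "- x"] x by (intro DERIV_cmult) auto
  moreover have "(\<lambda>t. \<sigma> * g (- x) t) = g x" using par by auto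
  ultimately show ?thesis using DERIV_unique[OF pdt_deriv[OF g x]] by auto
qed

lemma le_by_vanishing:
  fixes A B M r :: real
  assumes "0 < r" "\<And>x. 0 < x \<Longrightarrow> x \<le> r \<Longrightarrow> A \<le> B + M * x"
  shows "A \<le> B"
proof (rule field_le_epsilon)
  fix e :: real assume e: "0 < e"
  define x where "x = min r (e / (\<bar>M\<bar> + 1))"
  have x: "0 < x" "x \<le> r" "x \<le> e / (\<bar>M\<bar> + 1)" using assms e by (auto simp: x_def)
  have "M * x \<le> (\<bar>M\<bar> + 1) * x" using x by (intro mult_right_mono) auto
  also have "\<dots> \<le> e" using x by (simp add: pos_le_divide_eq mult.commute)
  finally show "A \<le> B + e" using assms(2)[OF x(1,2)] by linarith
qed

lemma quadratic_from_cubic_bound: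
  fixes u v M \<delta> :: real
  assumes "0 < \<delta>" "\<And>t. 0 < t \<Longrightarrow> t \<le> \<delta> \<Longrightarrow> \<bar>u * t + v * t\<^sup>2\<bar> \<le> M * t ^ 3"
  shows "u = 0" "v = 0"
proof -
  have M: "0 \<le> M"
  proof -
    have "0 \<le> M * \<delta> ^ 3" using assms(1) by (intro order_trans[OF abs_ge_zero assms(2)]) auto
    then show ?thesis using assms(1) by (simp add: zero_le_mult_iff)
  qed
  show u: "u = 0"
  proof -
    have "\<bar>u\<bar> \<le> 0"
    proof (rule le_by_vanishing[where M = "\<bar>v\<bar> + M * \<delta>" and r = \<delta>])
      fix t :: real assume t: "0 < t" "t \<le> \<delta>"
      have "\<bar>u\<bar> * t = \<bar>u * t\<bar>" using t by (simp add: abs_mult)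
      also have "\<dots> \<le> \<bar>u * t + v * t\<^sup>2\<bar> + \<bar>v * t\<^sup>2\<bar>" by linarith
      also have "\<dots> \<le> M * t ^ 3 + \<bar>v\<bar> * t\<^sup>2" using assms(2)[OF t] by (simp add: abs_mult)
      also have "M * t ^ 3 \<le> M * (\<delta> * t\<^sup>2)" using t M by (intro mult_left_mono) (auto simp: power3_eq_cube power2_eq_square)
      finally have "\<bar>u\<bar> * t \<le> ((\<bar>v\<bar> + M * \<delta>) * t) * t" by (simp add: power2_eq_square algebra_simps)
      then show "\<bar>u\<bar> \<le> 0 + (\<bar>v\<bar> + M * \<delta>) * t" using t by simp
    qed (use assms in auto)
    then show ?thesis by simp
  qed
  have "\<bar>v\<bar> \<le> 0"
  proof (rule le_by_vanishing[where M = M and r = \<delta>])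
    fix t :: real assume t: "0 < t" "t \<le> \<delta>"
    have "\<bar>v\<bar> * t\<^sup>2 \<le> (M * t) * t\<^sup>2" using assms(2)[OF t] u by (simp add: abs_mult power3_eq_cube power2_eq_square)
    then show "\<bar>v\<bar> \<le> 0 + M * t" using t by simp
  qed (use assms in auto)
  then show "v = 0" by simp
qed

text \<open>A continuous zero curve is differentiable wherever the derivative in the first
  variable does not vanish. Continuity is given here, so the argument is elementary: first
  \<open>\<bar>\<xi> s - \<xi> t\<bar> \<le> M \<bar>s - t\<bar>\<close>, then the difference quotient converges. It also applies when
  the curve touches the boundary of \<open>S\<close>, where the differential of \<open>g\<close> exists only within
  \<open>S\<close>.\<close>

lemma implicit_deriv:
  fixes g :: "real \<Rightarrow> real \<Rightarrow> real"
  assumes dg: "((\<lambda>(y, s). g y s) has_derivative (\<lambda>(u, v). A * u + B * v)) (at (\<xi> t, t) within S \<times> UNIV)"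
    and A: "A \<noteq> 0" and cont: "isCont \<xi> t" and S: "\<And>s. \<xi> s \<in> S" and zero: "\<And>s. g (\<xi> s) s = 0"
  shows "(\<xi> has_real_derivative - B / A) (at t)"
proof -
  define M where "M = (2 * \<bar>B\<bar> + \<bar>A\<bar>) / \<bar>A\<bar>"
  have M0: "0 \<le> M" by (simp add: M_def)
  have key: "\<forall>\<^sub>F s in at t. norm ((\<xi> s - \<xi> t) / (s - t) - (- B / A)) < e" if e: "0 < e" for e
  proof -
    \<comment> \<open>the first bound on \<open>e'\<close> absorbs \<open>\<xi> s - \<xi> t\<close> into the left-hand side, the second
      one gives accuracy \<open>e\<close>\<close>
    define e' where "e' = min (\<bar>A\<bar> / 2) (e * \<bar>A\<bar> / (2 * (M + 1)))"
    have e': "0 < e'" "e' \<le> \<bar>A\<bar> / 2" "e' * (M + 1) \<le> e * \<bar>A\<bar> / 2"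
    proof -
      show "0 < e'" using A e M0 by (simp add: e'_def)
      show "e' \<le> \<bar>A\<bar> / 2" unfolding e'_def by (rule min.cobounded1)
      have "e' \<le> e * \<bar>A\<bar> / (2 * (M + 1))" unfolding e'_def by (rule min.cobounded2)
      also have "\<dots> = e * \<bar>A\<bar> / 2 / (M + 1)" by simp
      finally have "e' \<le> e * \<bar>A\<bar> / 2 / (M + 1)" .
      then show "e' * (M + 1) \<le> e * \<bar>A\<bar> / 2" using M0 pos_le_divide_eq[of "M + 1" e' "e * \<bar>A\<bar> / 2"] by linarith
    qed
    obtain \<delta> where \<delta>0: "0 < \<delta>" and \<delta>1: "\<forall>y\<in>S \<times> UNIV. norm (y - (\<xi> t, t)) < \<delta> \<longrightarrow>
        norm ((case y of (y, s) \<Rightarrow> g y s) - (case (\<xi> t, t) of (y, s) \<Rightarrow> g y s)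
          - (case y - (\<xi> t, t) of (u, v) \<Rightarrow> A * u + B * v)) \<le> e' * norm (y - (\<xi> t, t))"
      using dg[unfolded has_derivative_within_alt, THEN conjunct2, rule_format, OF e'(1)] by blast
    have \<delta>: "\<bar>g y s - g (\<xi> t) t - (A * (y - \<xi> t) + B * (s - t))\<bar> \<le> e' * norm (y - \<xi> t, s - t)"
      if "y \<in> S" "norm (y - \<xi> t, s - t) < \<delta>" for y s
      using bspec[OF \<delta>1, of "(y, s)"] that by simp
    have "((\<lambda>s. norm (\<xi> s - \<xi> t, s - t)) \<longlongrightarrow> norm (\<xi> t - \<xi> t, t - t)) (at t)"
      using cont unfolding isCont_def by (intro tendsto_intros)
    then have "\<forall>\<^sub>F s in at t. norm (\<xi> s - \<xi> t, s - t) < \<delta>"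
      by (rule order_tendstoD(2)) (use \<delta>0 in simp)
    moreover have "\<forall>\<^sub>F s in at t. s \<noteq> t" by (simp add: eventually_at_filter)
    ultimately show ?thesis
    proof eventually_elim
      case (elim s)
      define x h where "x = \<xi> s - \<xi> t" and "h = s - t"
      have h: "h \<noteq> 0" using elim by (simp add: h_def)
      have n: "norm (\<xi> s - \<xi> t, s - t) \<le> \<bar>x\<bar> + \<bar>h\<bar>"
        using norm_Pair_le[of x h] by (simp add: x_def h_def)
      have "\<bar>A * x + B * h\<bar> \<le> e' * norm (\<xi> s - \<xi> t, s - t)"
        using \<delta>[OF S elim(1)] zero unfolding x_def h_def by (simp add: abs_minus_commute)
      also have "\<dots> \<le> e' * (\<bar>x\<bar> + \<bar>h\<bar>)" using n e' by (intro mult_left_mono) auto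
      finally have main: "\<bar>A * x + B * h\<bar> \<le> e' * (\<bar>x\<bar> + \<bar>h\<bar>)" .
      have "\<bar>A\<bar> * \<bar>x\<bar> \<le> \<bar>A * x + B * h\<bar> + \<bar>B\<bar> * \<bar>h\<bar>"
        unfolding abs_mult[symmetric] by linarith
      also have "\<dots> \<le> \<bar>A\<bar> / 2 * (\<bar>x\<bar> + \<bar>h\<bar>) + \<bar>B\<bar> * \<bar>h\<bar>"
        using main mult_right_mono[OF e'(2), of "\<bar>x\<bar> + \<bar>h\<bar>"] by linarith
      also have "\<bar>A\<bar> / 2 * (\<bar>x\<bar> + \<bar>h\<bar>) = (\<bar>A\<bar> * \<bar>x\<bar> + \<bar>A\<bar> * \<bar>h\<bar>) / 2" by (simp add: distrib_left)
      finally have "\<bar>A\<bar> * \<bar>x\<bar> \<le> (\<bar>A\<bar> * \<bar>x\<bar> + \<bar>A\<bar> * \<bar>h\<bar>) / 2 + \<bar>B\<bar> * \<bar>h\<bar>" .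
      moreover have "P \<le> 2 * Q + R" if "P \<le> (P + R) / 2 + Q" for P Q R :: real
        using that by (simp add: field_simps)
      ultimately have "\<bar>A\<bar> * \<bar>x\<bar> \<le> 2 * (\<bar>B\<bar> * \<bar>h\<bar>) + \<bar>A\<bar> * \<bar>h\<bar>" by blast
      then have "\<bar>A\<bar> * \<bar>x\<bar> \<le> (2 * \<bar>B\<bar> + \<bar>A\<bar>) * \<bar>h\<bar>" by (simp add: distrib_right)
      then have "\<bar>x\<bar> \<le> (2 * \<bar>B\<bar> + \<bar>A\<bar>) * \<bar>h\<bar> / \<bar>A\<bar>"
        using A by (subst pos_le_divide_eq) (simp_all add: mult.commute)
      then have xh: "\<bar>x\<bar> \<le> M * \<bar>h\<bar>" by (simp add: M_def)
      have "\<bar>A * x + B * h\<bar> \<le> e' * (M * \<bar>h\<bar> + \<bar>h\<bar>)"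
        using main xh e'(1) mult_left_mono[of "\<bar>x\<bar> + \<bar>h\<bar>" "M * \<bar>h\<bar> + \<bar>h\<bar>" e'] by linarith
      also have "\<dots> = e' * (M + 1) * \<bar>h\<bar>" by (simp add: algebra_simps)
      also have "\<dots> \<le> e * \<bar>A\<bar> / 2 * \<bar>h\<bar>" using e'(3) by (intro mult_right_mono) auto
      also have "\<dots> < e * (\<bar>A\<bar> * \<bar>h\<bar>)" using e A h by simp
      finally have fin: "\<bar>A * x + B * h\<bar> < e * (\<bar>A\<bar> * \<bar>h\<bar>)" .
      have "x / h - (- B / A) = (A * x + B * h) / (A * h)" using A h by (simp add: field_simps)
      then have "\<bar>x / h - (- B / A)\<bar> = \<bar>A * x + B * h\<bar> / (\<bar>A\<bar> * \<bar>h\<bar>)" by (simp add: abs_mult)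
      also have "\<dots> < e" using fin A h by (simp add: pos_divide_less_eq)
      finally show ?case by (simp add: x_def h_def)
    qed
  qed
  have "((\<lambda>s. (\<xi> s - \<xi> t) / (s - t)) \<longlongrightarrow> - B / A) (at t)"
    unfolding tendsto_iff dist_norm using key by blast
  then show ?thesis by (simp add: has_field_derivative_iff)
qed

section \<open>Taylor expansions of odd drifts\<close>

locale odd_strip =
  fixes d K :: real and f :: "real \<Rightarrow> real \<Rightarrow> real"
  assumes d: "0 < d" and K: "0 \<le> K" and smooth: "Ck_bounded 4 d K f"
    and odd: "\<And>x t. x \<in> {- d..d} \<Longrightarrow> f x t = - f (- x) t"
begin

abbreviation "fx \<equiv> pdx d f"
abbreviation "fxx \<equiv> pdx d fx"
abbreviation "fxxx \<equiv> pdx d fxx"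
abbreviation "ft \<equiv> pdt f"
abbreviation "ftx \<equiv> pdx d ft"
abbreviation "ftxx \<equiv> pdx d ftx"
abbreviation "ftt \<equiv> pdt ft"
abbreviation "fttx \<equiv> pdx d ftt"
abbreviation "fttt \<equiv> pdt ftt"

lemma levels:
  shows "Ck_bounded (Suc (Suc (Suc (Suc 0)))) d K f"
    and "Ck_bounded (Suc (Suc (Suc 0))) d K fx" and "Ck_bounded (Suc (Suc 0)) d K fxx"
    and "Ck_bounded (Suc 0) d K fxxx"
    and "Ck_bounded (Suc (Suc (Suc 0))) d K ft" and "Ck_bounded (Suc (Suc 0)) d K ftx"
    and "Ck_bounded (Suc 0) d K ftxx"
    and "Ck_bounded (Suc (Suc 0)) d K ftt" and "Ck_bounded (Suc 0) d K fttx" and "Ck_bounded (Suc 0) d K fttt"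
proof -
  have "(4::nat) = Suc (Suc (Suc (Suc 0)))" by simp
  then show f: "Ck_bounded (Suc (Suc (Suc (Suc 0)))) d K f" using smooth by (simp only:)
  show fx: "Ck_bounded (Suc (Suc (Suc 0))) d K fx" by (rule Ck_bounded_pdx[OF f])
  show fxx: "Ck_bounded (Suc (Suc 0)) d K fxx" by (rule Ck_bounded_pdx[OF fx])
  show "Ck_bounded (Suc 0) d K fxxx" by (rule Ck_bounded_pdx[OF fxx])
  show ft: "Ck_bounded (Suc (Suc (Suc 0))) d K ft" by (rule Ck_bounded_pdt[OF f])
  show ftx: "Ck_bounded (Suc (Suc 0)) d K ftx" by (rule Ck_bounded_pdx[OF ft])
  show "Ck_bounded (Suc 0) d K ftxx" by (rule Ck_bounded_pdx[OF ftx])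
  show ftt: "Ck_bounded (Suc (Suc 0)) d K ftt" by (rule Ck_bounded_pdt[OF ft])
  show "Ck_bounded (Suc 0) d K fttx" by (rule Ck_bounded_pdx[OF ftt])
  show "Ck_bounded (Suc 0) d K fttt" by (rule Ck_bounded_pdt[OF ftt])
qed

lemma zero_in: "0 \<in> {- d..d}" using d by simp

text \<open>An odd function and its second derivative vanish at the origin, and time
  derivatives keep the parity.\<close>

lemma vanish:
  "f 0 t = 0" "fxx 0 t = 0" "ft 0 t = 0" "ftxx 0 t = 0" "ftt 0 t = 0" "fttt 0 t = 0"
proof -
  show f0: "f 0 t = 0" for t using odd[OF zero_in, of t] by simp
  have *: "pdx d (pdx d g) 0 t = 0"
    if g: "Ck_bounded (Suc (Suc n)) d K g" and o: "\<And>x t. x \<in> {- d..d} \<Longrightarrow> g x t = - g (- x) t" for g n t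
  proof -
    have g': "Ck_bounded (Suc n) d K (pdx d g)" by (rule Ck_bounded_pdx[OF g])
    have o': "g x t = - 1 * g (- x) t" if "x \<in> {- d..d}" for x t
      using o[OF that, of t] by linarith
    have "pdx d g x t = 1 * pdx d g (- x) t" if x: "x \<in> {- d..d}" for x
      using pdx_parity[OF g d x, of t "- 1", OF o'] by simp
    from pdx_parity[OF g' d zero_in, of t 1, OF this] show ?thesis by simp
  qed
  show "fxx 0 t = 0" by (rule *[OF levels(1) odd])
  have ft_odd: "ft x t = - ft (- x) t" if "x \<in> {- d..d}" for x t
  proof -
    have "f x t = - 1 * f (- x) t" for t using odd[OF that, of t] by linarith
    from pdt_parity[OF levels(1) that, of "- 1", OF this, of t] show ?thesis by linarith
  qed
  show "ftxx 0 t = 0" by (rule *[OF levels(5) ft_odd])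
  have 0: "pdt g 0 t = 0" if "\<And>t. g 0 t = 0" for g :: "real \<Rightarrow> real \<Rightarrow> real" and t
    using that by (simp add: pdt_def fun_eq_iff)
  show "ft 0 t = 0" for t by (rule 0) (rule f0)
  then show "ftt 0 t = 0" for t by (rule 0)
  then show "fttt 0 t = 0" by (rule 0)
qed

lemma monomial_derivs:
  fixes c e g y :: real
  shows "((\<lambda>y. c) has_real_derivative 0) (at y)"
    "((\<lambda>y. c * y) has_real_derivative c) (at y)"
    "((\<lambda>y. c + y * e) has_real_derivative e) (at y)"
    "((\<lambda>y. c + e / 2 * y\<^sup>2) has_real_derivative e * y) (at y)"
    "((\<lambda>y. c * y + e / 6 * y ^ 3) has_real_derivative c + e / 2 * y\<^sup>2) (at y)"
    "((\<lambda>y. c + y * e + y\<^sup>2 / 2 * g) has_real_derivative e + y * g) (at y)"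
  by (auto intro!: derivative_eq_intros simp: power2_eq_square)

context
  fixes x t :: real
  assumes x: "0 \<le> x" "x \<le> d"
begin

lemma fxxx_near: assumes "0 \<le> y" "y \<le> x" shows "\<bar>fxxx y t - fxxx 0 0\<bar> \<le> K * (x + \<bar>t\<bar>)"
proof -
  have "\<bar>fxxx y t - fxxx 0 t\<bar> \<le> K * y"
    by (rule strip_mvt[OF levels(4), where q = "\<lambda>_. fxxx 0 t" and q' = "\<lambda>_. 0"])
       (use assms x d Ck_bounded_bound[OF Ck_bounded_pdx[OF levels(4)]] in auto)
  moreover have "\<bar>fxxx 0 t - fxxx 0 0\<bar> \<le> K * \<bar>t\<bar>"
    by (rule time_mvt[OF levels(4) zero_in, where q = "\<lambda>_. fxxx 0 0" and q' = "\<lambda>_. 0"])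
       (use Ck_bounded_bound[OF Ck_bounded_pdt[OF levels(4)]] zero_in in auto)
  moreover have "K * y \<le> K * x" using assms K by (intro mult_left_mono) auto
  ultimately show ?thesis unfolding distrib_left by linarith
qed

lemma fxx_expand: assumes "0 \<le> y" "y \<le> x"
  shows "\<bar>fxx y t - fxxx 0 0 * y\<bar> \<le> K * (x + \<bar>t\<bar>) * x"
proof -
  have "\<bar>fxx y t - fxxx 0 0 * y\<bar> \<le> K * (x + \<bar>t\<bar>) * y"
  proof (rule strip_mvt[OF levels(3), where q = "\<lambda>y. fxxx 0 0 * y" and q' = "\<lambda>_. fxxx 0 0"])
    fix z assume "0 \<le> z" "z \<le> y"
    then show "\<bar>fxxx z t - fxxx 0 0\<bar> \<le> K * (x + \<bar>t\<bar>)" using assms by (intro fxxx_near) auto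
  qed (rule monomial_derivs | use assms x vanish in simp)+
  also have "\<dots> \<le> K * (x + \<bar>t\<bar>) * x" using assms K x by (intro mult_left_mono) auto
  finally show ?thesis .
qed

lemma fx_expand: assumes "0 \<le> y" "y \<le> x"
  shows "\<bar>fx y t - (fx 0 t + fxxx 0 0 / 2 * y\<^sup>2)\<bar> \<le> K * (x + \<bar>t\<bar>) * x\<^sup>2"
proof -
  have "\<bar>fx y t - (fx 0 t + fxxx 0 0 / 2 * y\<^sup>2)\<bar> \<le> K * (x + \<bar>t\<bar>) * x * y"
  proof (rule strip_mvt[OF levels(2), where q = "\<lambda>y. fx 0 t + fxxx 0 0 / 2 * y\<^sup>2" and q' = "\<lambda>y. fxxx 0 0 * y"])
    fix z assume "0 \<le> z" "z \<le> y"
    then show "\<bar>fxx z t - fxxx 0 0 * z\<bar> \<le> K * (x + \<bar>t\<bar>) * x" using assms by (intro fxx_expand) auto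
  qed (rule monomial_derivs | use assms x in simp)+
  also have "\<dots> \<le> K * (x + \<bar>t\<bar>) * x * x" using assms K x by (intro mult_left_mono) auto
  finally show ?thesis by (simp add: power2_eq_square mult.assoc)
qed

text \<open>The error is only \<open>K (x + \<bar>t\<bar>) x^3\<close> although the cubic coefficient is frozen at
  the origin: oddness removes the quadratic term for all \<open>t\<close>.\<close>

lemma f_expand: "\<bar>f x t - (fx 0 t * x + fxxx 0 0 / 6 * x ^ 3)\<bar> \<le> K * (x + \<bar>t\<bar>) * x ^ 3"
proof -
  have "\<bar>f x t - (fx 0 t * x + fxxx 0 0 / 6 * x ^ 3)\<bar> \<le> K * (x + \<bar>t\<bar>) * x\<^sup>2 * x"
  proof (rule strip_mvt[OF levels(1), where q = "\<lambda>y. fx 0 t * y + fxxx 0 0 / 6 * y ^ 3" and q' = "\<lambda>y. fx 0 t + fxxx 0 0 / 2 * y\<^sup>2"])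
    fix z assume "0 \<le> z" "z \<le> x"
    then show "\<bar>fx z t - (fx 0 t + fxxx 0 0 / 2 * z\<^sup>2)\<bar> \<le> K * (x + \<bar>t\<bar>) * x\<^sup>2" by (rule fx_expand)
  qed (rule monomial_derivs | use x vanish in simp)+
  then show ?thesis by (simp add: power2_eq_square power3_eq_cube mult.assoc)
qed

lemma first_order:
  assumes g: "Ck_bounded (Suc (Suc 0)) d K g" and g0: "g 0 t = 0"
  shows "\<bar>g x t - pdx d g 0 t * x\<bar> \<le> K * x\<^sup>2"
proof -
  have "\<bar>g x t - pdx d g 0 t * x\<bar> \<le> (K * x) * x"
  proof (rule strip_mvt[OF g, where q = "\<lambda>y. pdx d g 0 t * y" and q' = "\<lambda>_. pdx d g 0 t"])
    fix y assume y: "0 \<le> y" "y \<le> x"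
    have "\<bar>pdx d g y t - pdx d g 0 t\<bar> \<le> K * y"
      by (rule strip_mvt[OF Ck_bounded_pdx[OF g], where q = "\<lambda>_. pdx d g 0 t" and q' = "\<lambda>_. 0"])
         (use y x d Ck_bounded_bound[OF Ck_bounded_pdx[OF Ck_bounded_pdx[OF g]]] in auto)
    also have "\<dots> \<le> K * x" using y K by (intro mult_left_mono) auto
    finally show "\<bar>pdx d g y t - pdx d g 0 t\<bar> \<le> K * x" .
  qed (rule monomial_derivs | use x g0 in simp)+
  then show ?thesis by (simp add: power2_eq_square mult.assoc)
qed

lemma ftxx_bound: assumes "0 \<le> y" "y \<le> x" shows "\<bar>ftxx y t\<bar> \<le> K * x"
proof -
  have "\<bar>ftxx y t - 0\<bar> \<le> K * y"
    by (rule strip_mvt[OF levels(7), where q = "\<lambda>_. 0" and q' = "\<lambda>_. 0"])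
       (use assms x d vanish Ck_bounded_bound[OF Ck_bounded_pdx[OF levels(7)]] in auto)
  also have "\<dots> \<le> K * x" using assms K by (intro mult_left_mono) auto
  finally show ?thesis by simp
qed

lemma ftx_expand: assumes "0 \<le> y" "y \<le> x" shows "\<bar>ftx y t - ftx 0 t\<bar> \<le> K * x\<^sup>2"
proof -
  have "\<bar>ftx y t - ftx 0 t\<bar> \<le> K * x * y"
    by (rule strip_mvt[OF levels(6), where q = "\<lambda>_. ftx 0 t" and q' = "\<lambda>_. 0"])
       (use assms x ftxx_bound in auto)
  also have "\<dots> \<le> K * x * x" using assms K x by (intro mult_left_mono) auto
  finally show ?thesis by (simp add: power2_eq_square mult.assoc)
qed

text \<open>The cubic error, rather than a quadratic one, is due to
  \<open>\<partial>\<^sub>x\<^sub>x \<partial>\<^sub>t f (0, t) = 0\<close>.\<close>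

lemma ft_expand: "\<bar>ft x t - ftx 0 t * x\<bar> \<le> K * x ^ 3"
proof -
  have "\<bar>ft x t - ftx 0 t * x\<bar> \<le> K * x\<^sup>2 * x"
    by (rule strip_mvt[OF levels(5), where q = "\<lambda>y. ftx 0 t * y" and q' = "\<lambda>_. ftx 0 t"])
       (rule monomial_derivs | use x ftx_expand vanish in simp)+
  then show ?thesis by (simp add: power2_eq_square power3_eq_cube mult.assoc)
qed

lemma fttt_bound: "\<bar>fttt x t\<bar> \<le> K * x"
proof -
  have "\<bar>fttt x t - 0\<bar> \<le> K * x"
    by (rule strip_mvt[OF levels(10), where q = "\<lambda>_. 0" and q' = "\<lambda>_. 0"])
       (use x d vanish Ck_bounded_bound[OF Ck_bounded_pdx[OF levels(10)]] in auto)
  then show ?thesis by simp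
qed

end

lemma pdt_at_zero:
  assumes "Ck_bounded (Suc 0) d K g" shows "\<bar>g 0 t - g 0 0\<bar> \<le> K * \<bar>t\<bar>"
  by (rule time_mvt[OF assms zero_in, where q = "\<lambda>_. g 0 0" and q' = "\<lambda>_. 0"])
     (use Ck_bounded_bound[OF Ck_bounded_pdt[OF assms]] zero_in in auto)

lemma time_taylor:
  assumes x: "0 \<le> x" "x \<le> d"
  shows "\<bar>f x t - (f x 0 + t * ft x 0 + t\<^sup>2 / 2 * ftt x 0)\<bar> \<le> K * x * \<bar>t\<bar> ^ 3"
proof -
  have xin: "x \<in> {- d..d}" using x d by auto
  have 1: "\<bar>ftt x s - ftt x 0\<bar> \<le> K * x * \<bar>t\<bar>" if s: "\<bar>s\<bar> \<le> \<bar>t\<bar>" for s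
  proof -
    have "\<bar>ftt x s - ftt x 0\<bar> \<le> K * x * \<bar>s\<bar>"
      by (rule time_mvt[OF levels(8) xin, where q = "\<lambda>_. ftt x 0" and q' = "\<lambda>_. 0"]) (use fttt_bound[OF x] in auto)
    also have "\<dots> \<le> K * x * \<bar>t\<bar>" using s K x by (intro mult_left_mono) auto
    finally show ?thesis .
  qed
  have 2: "\<bar>ft x s - (ft x 0 + s * ftt x 0)\<bar> \<le> K * x * \<bar>t\<bar> * \<bar>t\<bar>" if s: "\<bar>s\<bar> \<le> \<bar>t\<bar>" for s
  proof -
    have "\<bar>ft x s - (ft x 0 + s * ftt x 0)\<bar> \<le> K * x * \<bar>t\<bar> * \<bar>s\<bar>"
      by (rule time_mvt[OF levels(5) xin, where q = "\<lambda>s. ft x 0 + s * ftt x 0" and q' = "\<lambda>_. ftt x 0"])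
         (rule monomial_derivs | use 1 s in simp)+
    also have "\<dots> \<le> K * x * \<bar>t\<bar> * \<bar>t\<bar>" using s K x by (intro mult_left_mono) auto
    finally show ?thesis .
  qed
  have "\<bar>f x t - (f x 0 + t * ft x 0 + t\<^sup>2 / 2 * ftt x 0)\<bar> \<le> K * x * \<bar>t\<bar> * \<bar>t\<bar> * \<bar>t\<bar>"
    by (rule time_mvt[OF levels(1) xin, where q = "\<lambda>s. f x 0 + s * ft x 0 + s\<^sup>2 / 2 * ftt x 0" and q' = "\<lambda>s. ft x 0 + s * ftt x 0"])
       (rule monomial_derivs | use 2 in simp)+
  then show ?thesis by (simp add: power3_eq_cube mult.assoc)
qed

text \<open>The known expansion of \<open>a(t)\<close> concerns time derivatives of \<open>\<partial>\<^sub>x f\<close>, while the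
  motion of the equilibrium involves \<open>\<partial>\<^sub>x \<partial>\<^sub>t f\<close> and \<open>\<partial>\<^sub>x \<partial>\<^sub>t \<partial>\<^sub>t f\<close>. The two are linked by
  expanding \<open>f\<close> in \<open>t\<close> with an error of order \<open>x t^3\<close>, dividing by \<open>x\<close> and letting \<open>x\<close> tend
  to zero; this takes the place of the symmetry of mixed partial derivatives.\<close>

lemma slope_taylor: "\<bar>fx 0 t - (fx 0 0 + t * ftx 0 0 + t\<^sup>2 / 2 * fttx 0 0)\<bar> \<le> K * \<bar>t\<bar> ^ 3"
proof (rule le_by_vanishing[OF d, where M = "K * (2 + \<bar>t\<bar> + t\<^sup>2 / 2)"])
  fix x assume x: "0 < x" "x \<le> d"
  then have x': "0 \<le> x" "x \<le> d" by auto
  note two = Ck_bounded_lower[OF Ck_bounded_lower[OF levels(1)]] Ck_bounded_lower[OF levels(5)] levels(8)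
  define E where "E = fx 0 t - (fx 0 0 + t * ftx 0 0 + t\<^sup>2 / 2 * fttx 0 0)"
  have a: "\<bar>f x t - fx 0 t * x\<bar> \<le> K * x\<^sup>2" "\<bar>f x 0 - fx 0 0 * x\<bar> \<le> K * x\<^sup>2"
      "\<bar>ft x 0 - ftx 0 0 * x\<bar> \<le> K * x\<^sup>2" "\<bar>ftt x 0 - fttx 0 0 * x\<bar> \<le> K * x\<^sup>2"
    by (rule first_order[OF x'] two vanish)+
  have b: "\<bar>t * (ft x 0 - ftx 0 0 * x)\<bar> \<le> \<bar>t\<bar> * (K * x\<^sup>2)"
    unfolding abs_mult using a by (intro mult_left_mono) auto
  have c: "\<bar>t\<^sup>2 / 2 * (ftt x 0 - fttx 0 0 * x)\<bar> \<le> t\<^sup>2 / 2 * (K * x\<^sup>2)"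
    unfolding abs_mult using a by (simp add: mult_left_mono)
  have "E * x = (f x t - (f x 0 + t * ft x 0 + t\<^sup>2 / 2 * ftt x 0)) - (f x t - fx 0 t * x)
     + (f x 0 - fx 0 0 * x) + t * (ft x 0 - ftx 0 0 * x) + t\<^sup>2 / 2 * (ftt x 0 - fttx 0 0 * x)"
    by (simp add: E_def algebra_simps)
  then have "\<bar>E * x\<bar> \<le> K * x * \<bar>t\<bar> ^ 3 + K * x\<^sup>2 + K * x\<^sup>2 + \<bar>t\<bar> * (K * x\<^sup>2) + t\<^sup>2 / 2 * (K * x\<^sup>2)"
    using time_taylor[OF x', of t] a(1,2) b c by linarith
  also have "\<dots> = (K * \<bar>t\<bar> ^ 3 + K * (2 + \<bar>t\<bar> + t\<^sup>2 / 2) * x) * x"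
    by (simp add: power2_eq_square distrib_left distrib_right mult_ac)
  finally have "\<bar>E\<bar> * x \<le> (K * \<bar>t\<bar> ^ 3 + K * (2 + \<bar>t\<bar> + t\<^sup>2 / 2) * x) * x" using x by (simp add: abs_mult)
  then show "\<bar>E\<bar> \<le> K * \<bar>t\<bar> ^ 3 + K * (2 + \<bar>t\<bar> + t\<^sup>2 / 2) * x" using x by simp
qed

text \<open>Compare the Taylor polynomial of \<open>a(t)\<close> with the given expansion.\<close>

lemma mixed_derivatives_at_zero:
  assumes exp: "\<And>t. \<bar>t\<bar> < \<delta> \<Longrightarrow> \<bar>fx 0 t - (a0 + a1 * t\<^sup>2)\<bar> \<le> K' * \<bar>t\<bar> ^ 3" and \<delta>: "0 < \<delta>"
  shows "ftx 0 0 = 0" "fttx 0 0 = 2 * a1"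
proof -
  have a0: "fx 0 0 = a0" using exp[of 0] \<delta> by simp
  have bound: "\<bar>ftx 0 0 * t + (fttx 0 0 / 2 - a1) * t\<^sup>2\<bar> \<le> (K + K') * t ^ 3" if t: "0 < t" "t \<le> \<delta> / 2" for t
  proof -
    have "\<bar>fx 0 t - (a0 + a1 * t\<^sup>2)\<bar> \<le> K' * t ^ 3" using exp[of t] t by simp
    moreover have "\<bar>fx 0 t - (a0 + t * ftx 0 0 + t\<^sup>2 / 2 * fttx 0 0)\<bar> \<le> K * t ^ 3" using slope_taylor[of t] a0 t by simp
    moreover have "ftx 0 0 * t + (fttx 0 0 / 2 - a1) * t\<^sup>2
      = (fx 0 t - (a0 + a1 * t\<^sup>2)) - (fx 0 t - (a0 + t * ftx 0 0 + t\<^sup>2 / 2 * fttx 0 0))"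
      by (simp add: algebra_simps)
    ultimately show ?thesis unfolding distrib_right[of K K'] by linarith
  qed
  have "\<delta> / 2 > 0" using \<delta> by simp
  from quadratic_from_cubic_bound[OF this bound] show "ftx 0 0 = 0" "fttx 0 0 = 2 * a1" by auto
qed

end

section \<open>The equilibrium branch\<close>

lemma strip_mean_value:
  assumes g: "Ck_bounded (Suc n) d K g" and xy: "- d \<le> x" "x < y" "y \<le> d"
  obtains z where "x < z" "z < y" "g y t - g x t = (y - x) * pdx d g z t"
proof -
  have "\<exists>z\<in>{x<..<y}. g y t - g x t = (\<lambda>v. pdx d g z t * v) (y - x)"
  proof (rule mvt[OF xy(2)])
    show "continuous_on {x..y} (\<lambda>y. g y t)"
      by (rule DERIV_continuous_on[OF has_field_derivative_subset[OF pdx_deriv[OF g]]]) (use xy in auto)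
    fix z assume z: "x < z" "z < y"
    have "((\<lambda>y. g y t) has_real_derivative pdx d g z t) (at z within {- d..d})"
      by (rule pdx_deriv[OF g]) (use xy z in auto)
    moreover have "at z within {- d..d} = at z" using xy z by (intro at_within_Icc_at) auto
    ultimately show "((\<lambda>y. g y t) has_derivative (\<lambda>v. pdx d g z t * v)) (at z)"
      by (simp add: has_field_derivative_def)
  qed (auto intro!: bexI)
  then show ?thesis using that by (auto simp: mult.commute)
qed

text \<open>One member of the family, with the asymptotic relations of the setting replaced
  by inequalities with constants \<open>K\<close>, \<open>l\<close>, \<open>u\<close>, \<open>\<delta>0\<close> that are common to all small \<open>\<epsilon>\<close>.\<close>

locale symmetric_snapshot = odd_strip d K f for d K :: real and f +
  fixes T a1 f3 a0 l u \<delta>0 ts :: real and xs :: "real \<Rightarrow> real"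
  assumes T: "0 < T" "T < 1/2" and coeffs: "0 < a1" "f3 < 0" and a0: "0 < a0" "a0 \<le> 1"
    and K1: "1 \<le> K" and lu: "0 < l" "l \<le> 1" "1 \<le> u" and \<delta>0: "0 < \<delta>0"
    and xs_cont: "continuous_on UNIV xs" and xs_range: "\<And>t. 0 < xs t \<and> xs t \<le> d"
    and zeros: "\<And>x t. x \<in> {- d..d} \<Longrightarrow> f x t = 0 \<longleftrightarrow> x = 0 \<or> x = xs t \<or> x = - xs t"
    and astar_neg: "\<And>t. fx (xs t) t < 0"
    and third: "fxxx 0 0 = f3"
    and a_exp: "\<And>t. \<bar>t\<bar> < \<delta>0 \<Longrightarrow> \<bar>fx 0 t - (a0 + a1 * t\<^sup>2)\<bar> \<le> K * \<bar>t\<bar> ^ 3"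
    and xs_b: "\<And>t. \<bar>t\<bar> \<le> T \<Longrightarrow> l * width a0 t \<le> xs t \<and> xs t \<le> u * width a0 t"
    and slope: "\<And>t. \<bar>t\<bar> \<le> T \<Longrightarrow> l * (width a0 t)\<^sup>2 \<le> - fx (xs t) t \<and> - fx (xs t) t \<le> u * (width a0 t)\<^sup>2"
    and ts_range: "\<bar>ts\<bar> \<le> T" and crit: "\<And>t. \<bar>t\<bar> \<le> T \<Longrightarrow> deriv xs t = 0 \<longleftrightarrow> t = ts"
begin

abbreviation "\<rho> \<equiv> width a0"

definition b :: real where "b = - f3 / 6"

text \<open>The derivative of \<open>xs\<close> according to the implicit function theorem.\<close>

definition xs' :: "real \<Rightarrow> real" where "xs' t = - ft (xs t) t / fx (xs t) t"

text \<open>By implicit differentiation \<open>xs' = \<psi> xs / (- \<partial>\<^sub>x f)\<close> with a positive second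
  factor, so that \<open>\<psi>\<close> has the sign and the zeros of \<open>xs'\<close>. Division by \<open>xs\<close> removes the
  dependence on the size of the equilibrium: near the origin the slope of \<open>\<psi>\<close> is close to
  \<open>2 a1\<close>, uniformly in \<open>a0\<close>.\<close>

definition \<psi> :: "real \<Rightarrow> real" where "\<psi> t = ft (xs t) t / xs t"

text \<open>A bound for the speed of the equilibrium on \<open>[-T, T]\<close>.\<close>

definition V :: real where "V = K * (1 + u\<^sup>2) * u / l"

lemma rho: "0 < \<rho> t" "sqrt a0 \<le> \<rho> t" "\<bar>t\<bar> \<le> \<rho> t"
  using a0 by (auto simp: width_def less_max_iff_disj)

lemma rho_le_1: "\<bar>t\<bar> \<le> T \<Longrightarrow> \<rho> t \<le> 1"
  using a0 T by (simp add: width_def)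

lemma xs_in: "xs t \<in> {- d..d}" using xs_range[of t] by auto

lemma xs_pos: "0 < xs t" and xs_le: "xs t \<le> d" using xs_range[of t] by auto

lemma f_xs: "f (xs t) t = 0" using zeros[OF xs_in] by simp

lemma xs_deriv: assumes "\<bar>t\<bar> \<le> T" shows "(xs has_real_derivative xs' t) (at t)"
  unfolding xs'_def
proof (rule implicit_deriv[where \<xi> = xs and t = t, OF Ck_has_derivative[OF levels(1) xs_in]])
  show "isCont xs t" using xs_cont by (simp add: continuous_on_eq_continuous_at)
qed (use astar_neg[of t] xs_in f_xs in auto)

lemma along_xs_deriv:
  assumes g: "Ck_bounded (Suc n) d K g" and t: "\<bar>t\<bar> \<le> T"
  shows "((\<lambda>s. g (xs s) s) has_real_derivative pdx d g (xs t) t * xs' t + pdt g (xs t) t) (at t)"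
proof -
  have "((\<lambda>s. (xs s, s)) has_derivative (\<lambda>v. (xs' t * v, v))) (at t)"
    using xs_deriv[OF t] by (intro derivative_eq_intros) (auto simp: has_field_derivative_def)
  moreover have "((\<lambda>(y, s). g y s) has_derivative (\<lambda>(a, v). pdx d g (xs t) t * a + pdt g (xs t) t * v))
      (at (xs t, t) within range (\<lambda>s. (xs s, s)))"
    by (rule has_derivative_subset[OF Ck_has_derivative[OF g xs_in]]) (use xs_in in auto)
  ultimately have "((\<lambda>s. case (xs s, s) of (y, s) \<Rightarrow> g y s) has_derivative
      (\<lambda>v. case (xs' t * v, v) of (a, v) \<Rightarrow> pdx d g (xs t) t * a + pdt g (xs t) t * v)) (at t)"
    by (rule has_derivative_in_compose)
  then show ?thesis
    unfolding has_field_derivative_def prod.case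
    by (rule has_derivative_eq_rhs) (simp add: fun_eq_iff algebra_simps)
qed

lemma \<psi>_deriv:
  assumes t: "\<bar>t\<bar> \<le> T"
  shows "(\<psi> has_real_derivative ftt (xs t) t / xs t
           + xs' t * ((xs t * ftx (xs t) t - ft (xs t) t) / (xs t)\<^sup>2)) (at t)"
proof -
  have "(\<psi> has_real_derivative ((ftx (xs t) t * xs' t + ftt (xs t) t) * xs t - ft (xs t) t * xs' t) / (xs t * xs t)) (at t)"
    unfolding \<psi>_def using xs_pos[of t] by (intro DERIV_divide along_xs_deriv[OF levels(5) t] xs_deriv[OF t]) auto
  moreover have "((ftx (xs t) t * xs' t + ftt (xs t) t) * xs t - ft (xs t) t * xs' t) / (xs t * xs t)
    = ftt (xs t) t / xs t + xs' t * ((xs t * ftx (xs t) t - ft (xs t) t) / (xs t)\<^sup>2)"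
    using xs_pos[of t] by (simp add: power2_eq_square field_simps)
  ultimately show ?thesis by (simp only:)
qed

lemma xs'_eq: "xs' t = \<psi> t * (xs t / - fx (xs t) t)"
  using xs_pos[of t] by (simp add: xs'_def \<psi>_def)

lemma ftx_zero: "ftx 0 0 = 0" and fttx_zero: "fttx 0 0 = 2 * a1"
  using mixed_derivatives_at_zero[OF a_exp \<delta>0] by auto

lemma \<psi>_near: "\<bar>\<psi> t\<bar> \<le> K * \<bar>t\<bar> + K * (xs t)\<^sup>2"
proof -
  have "\<bar>ft (xs t) t - ftx 0 t * xs t\<bar> \<le> K * (xs t) ^ 3" using xs_range[of t] by (intro ft_expand) auto
  moreover have "\<bar>ftx 0 t\<bar> \<le> K * \<bar>t\<bar>" using pdt_at_zero[OF Ck_bounded_lower[OF levels(6)], of t] ftx_zero by simp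
  then have "\<bar>ftx 0 t * xs t\<bar> \<le> K * \<bar>t\<bar> * xs t" unfolding abs_mult using xs_pos[of t] by (simp add: mult_right_mono)
  ultimately have "\<bar>ft (xs t) t\<bar> \<le> (K * \<bar>t\<bar> + K * (xs t)\<^sup>2) * xs t"
    unfolding distrib_right by (simp add: power2_eq_square power3_eq_cube mult.assoc)
  then show ?thesis using xs_pos[of t] by (simp add: \<psi>_def abs_divide pos_divide_le_eq)
qed

lemma factor_bounds:
  assumes "\<bar>t\<bar> \<le> T"
  shows "l / u \<le> xs t * \<rho> t / - fx (xs t) t" "xs t * \<rho> t / - fx (xs t) t \<le> u / l"
proof -
  note s = slope[OF assms] and x = xs_b[OF assms] and r = rho(1)[of t]
  have neg: "0 < - fx (xs t) t" using astar_neg[of t] by simp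
  have "l * (- fx (xs t) t) \<le> l * (u * (\<rho> t)\<^sup>2)" using s lu by (intro mult_left_mono) auto
  also have "\<dots> = u * ((l * \<rho> t) * \<rho> t)" by (simp add: power2_eq_square)
  also have "\<dots> \<le> u * (xs t * \<rho> t)" using x r lu by (intro mult_left_mono mult_right_mono) auto
  finally show "l / u \<le> xs t * \<rho> t / - fx (xs t) t"
    using neg lu by (simp add: frac_le_eq divide_le_eq pos_le_divide_eq mult_ac del: divide_minus_right)
  have "l * (xs t * \<rho> t) \<le> l * (u * \<rho> t * \<rho> t)" using x r lu by (intro mult_left_mono mult_right_mono) auto
  also have "\<dots> = u * (l * (\<rho> t)\<^sup>2)" by (simp add: power2_eq_square)
  also have "\<dots> \<le> u * (- fx (xs t) t)" using s lu by (intro mult_left_mono) auto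
  finally show "xs t * \<rho> t / - fx (xs t) t \<le> u / l"
    using neg lu by (simp add: pos_divide_le_eq pos_le_divide_eq mult_ac del: divide_minus_right)
qed

lemma xs'_rho: "xs' t * \<rho> t = \<psi> t * (xs t * \<rho> t / - fx (xs t) t)"
  by (simp add: xs'_eq)

lemma xs'_bound: assumes "\<bar>t\<bar> \<le> T" shows "\<bar>xs' t\<bar> \<le> V"
proof -
  have "(xs t)\<^sup>2 \<le> (u * \<rho> t)\<^sup>2" using xs_b[OF assms] xs_pos[of t] by (intro power_mono) auto
  also have "\<dots> = u\<^sup>2 * (\<rho> t * \<rho> t)" by (simp add: power_mult_distrib power2_eq_square)
  also have "\<dots> \<le> u\<^sup>2 * (\<rho> t * 1)" using rho(1)[of t] rho_le_1[OF assms] by (intro mult_left_mono) auto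
  finally have "K * (xs t)\<^sup>2 \<le> K * (u\<^sup>2 * \<rho> t)" using K by (intro mult_left_mono) auto
  moreover have "K * \<bar>t\<bar> \<le> K * \<rho> t" using K rho by (intro mult_left_mono) auto
  ultimately have p: "\<bar>\<psi> t\<bar> \<le> K * (1 + u\<^sup>2) * \<rho> t" using \<psi>_near[of t] by (simp add: algebra_simps)
  have pos: "0 \<le> xs t * \<rho> t / - fx (xs t) t"
    using factor_bounds(1)[OF assms] lu by (intro order_trans[OF _ factor_bounds(1)[OF assms]]) auto
  have "\<bar>xs' t\<bar> * \<rho> t = \<bar>xs' t * \<rho> t\<bar>" using rho(1)[of t] by (simp add: abs_mult)
  also have "\<dots> = \<bar>\<psi> t\<bar> * (xs t * \<rho> t / - fx (xs t) t)"
    unfolding xs'_rho abs_mult[of "\<psi> t"] abs_of_nonneg[OF pos] ..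
  also have "\<dots> \<le> K * (1 + u\<^sup>2) * \<rho> t * (u / l)" using p factor_bounds(2)[OF assms] pos K rho(1)[of t] by (intro mult_mono) auto
  finally have "\<bar>xs' t\<bar> * \<rho> t \<le> V * \<rho> t" by (simp add: V_def mult_ac)
  then show ?thesis using rho(1)[of t] by simp
qed

text \<open>The contributions of \<open>xs'\<close> to \<open>\<psi>'\<close> are of order \<open>xs\<close>, because \<open>\<partial>\<^sub>t f / x\<close> is
  even in \<open>x\<close>; what remains is \<open>\<partial>\<^sub>x \<partial>\<^sub>t \<partial>\<^sub>t f (0, 0) = 2 a1\<close>.\<close>

lemma \<psi>_slope:
  assumes t: "\<bar>t\<bar> \<le> T" and small: "K * (\<bar>t\<bar> + xs t * (1 + 2 * V)) \<le> a1"
  shows "\<exists>s. (\<psi> has_real_derivative s) (at t) \<and> a1 \<le> s \<and> s \<le> 3 * a1"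
proof -
  note x0 = xs_pos[of t]
  have "\<bar>ftt (xs t) t - fttx 0 t * xs t\<bar> \<le> K * (xs t)\<^sup>2"
    using xs_range[of t] vanish by (intro first_order[OF _ _ levels(8)]) auto
  then have "\<bar>ftt (xs t) t / xs t - fttx 0 t\<bar> \<le> K * xs t"
    using x0 by (simp add: abs_divide[symmetric] power2_eq_square divide_simps abs_if split: if_splits)
  moreover have "\<bar>fttx 0 t - 2 * a1\<bar> \<le> K * \<bar>t\<bar>" using pdt_at_zero[OF levels(9), of t] fttx_zero by simp
  ultimately have 1: "\<bar>ftt (xs t) t / xs t - 2 * a1\<bar> \<le> K * \<bar>t\<bar> + K * xs t" by linarith
  have r: "0 \<le> xs t" "xs t \<le> d" using xs_range[of t] by auto
  have "\<bar>ftx (xs t) t - ftx 0 t\<bar> \<le> K * (xs t)\<^sup>2" by (rule ftx_expand[OF r r(1) order_refl])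
  then have A: "\<bar>xs t * (ftx (xs t) t - ftx 0 t)\<bar> \<le> xs t * (K * (xs t)\<^sup>2)"
    unfolding abs_mult using x0 by simp
  have B: "\<bar>ft (xs t) t - ftx 0 t * xs t\<bar> \<le> K * (xs t) ^ 3" by (rule ft_expand[OF r])
  have "xs t * ftx (xs t) t - ft (xs t) t = xs t * (ftx (xs t) t - ftx 0 t) - (ft (xs t) t - ftx 0 t * xs t)"
    by (simp add: algebra_simps)
  then have "\<bar>xs t * ftx (xs t) t - ft (xs t) t\<bar> \<le> xs t * (K * (xs t)\<^sup>2) + K * (xs t) ^ 3"
    using A B by linarith
  also have "\<dots> = (2 * K * xs t) * (xs t)\<^sup>2" by (simp add: power2_eq_square power3_eq_cube)
  finally have "\<bar>(xs t * ftx (xs t) t - ft (xs t) t) / (xs t)\<^sup>2\<bar> \<le> 2 * K * xs t"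
    using x0 by (simp add: abs_divide pos_divide_le_eq)
  then have "\<bar>xs' t * ((xs t * ftx (xs t) t - ft (xs t) t) / (xs t)\<^sup>2)\<bar> \<le> V * (2 * K * xs t)"
    unfolding abs_mult[of "xs' t"] using xs'_bound[OF t] by (intro mult_mono) auto
  then have fin: "\<bar>(ftt (xs t) t / xs t + xs' t * ((xs t * ftx (xs t) t - ft (xs t) t) / (xs t)\<^sup>2)) - 2 * a1\<bar>
     \<le> K * (\<bar>t\<bar> + xs t * (1 + 2 * V))"
  proof -
    have "V * (2 * K * xs t) + (K * \<bar>t\<bar> + K * xs t) = K * (\<bar>t\<bar> + xs t * (1 + 2 * V))"
      by (simp add: algebra_simps)
    moreover have "\<bar>y + z - w\<bar> \<le> A + B" if "\<bar>z\<bar> \<le> A" "\<bar>y - w\<bar> \<le> B" for y z w A B :: real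
      using that by linarith
    ultimately show ?thesis using 1 \<open>\<bar>xs' t * _\<bar> \<le> _\<close> by metis
  qed
  have "a1 \<le> ftt (xs t) t / xs t + xs' t * ((xs t * ftx (xs t) t - ft (xs t) t) / (xs t)\<^sup>2)"
    "ftt (xs t) t / xs t + xs' t * ((xs t * ftx (xs t) t - ft (xs t) t) / (xs t)\<^sup>2) \<le> 3 * a1"
  proof -
    have "a1 \<le> s \<and> s \<le> 3 * a1" if "\<bar>s - 2 * a1\<bar> \<le> K * (\<bar>t\<bar> + xs t * (1 + 2 * V))" for s
      using that small by (auto simp: abs_le_iff)
    from this[OF fin] show
      "a1 \<le> ftt (xs t) t / xs t + xs' t * ((xs t * ftx (xs t) t - ft (xs t) t) / (xs t)\<^sup>2)"
      "ftt (xs t) t / xs t + xs' t * ((xs t * ftx (xs t) t - ft (xs t) t) / (xs t)\<^sup>2) \<le> 3 * a1" by auto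
  qed
  then show ?thesis using \<psi>_deriv[OF t] by blast
qed

lemma \<psi>_increment:
  assumes xy: "- D \<le> x" "x < y" "y \<le> D" and D: "D \<le> T"
    and small: "\<And>t. \<bar>t\<bar> \<le> D \<Longrightarrow> K * (\<bar>t\<bar> + xs t * (1 + 2 * V)) \<le> a1"
  shows "a1 * (y - x) \<le> \<psi> y - \<psi> x \<and> \<psi> y - \<psi> x \<le> 3 * a1 * (y - x)"
proof -
  have "\<exists>s. (\<psi> has_real_derivative s) (at t) \<and> a1 \<le> s \<and> s \<le> 3 * a1" if "x \<le> t" "t \<le> y" for t
    using that xy D by (intro \<psi>_slope small) auto
  then obtain s where s: "\<And>t. x \<le> t \<Longrightarrow> t \<le> y \<Longrightarrow> (\<psi> has_real_derivative s t) (at t)"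
    "\<And>t. x \<le> t \<Longrightarrow> t \<le> y \<Longrightarrow> a1 \<le> s t \<and> s t \<le> 3 * a1" by metis
  obtain z where z: "x < z" "z < y" "\<psi> y - \<psi> x = (y - x) * s z"
    using MVT2[OF xy(2) s(1)] by auto
  have "a1 * (y - x) \<le> s z * (y - x)" "s z * (y - x) \<le> 3 * a1 * (y - x)"
    using s(2)[of z] z xy by (auto intro!: mult_right_mono)
  then show ?thesis using z(3) by (simp add: mult.commute)
qed

lemma \<psi>_continuous: "continuous_on {- T..T} \<psi>"
  by (rule DERIV_continuous_on[OF has_field_derivative_at_within[OF \<psi>_deriv]]) auto

lemma \<psi>_zero_iff: assumes "\<bar>t\<bar> \<le> T" shows "\<psi> t = 0 \<longleftrightarrow> t = ts"
proof -
  have "deriv xs t = xs' t" by (rule DERIV_imp_deriv[OF xs_deriv[OF assms]])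
  moreover have "xs' t = 0 \<longleftrightarrow> \<psi> t = 0"
    using xs'_eq[of t] xs_pos[of t] astar_neg[of t] by simp
  ultimately show ?thesis using crit[OF assms] by simp
qed

text \<open>\<open>\<psi> 0\<close> has at most the order of \<open>xs(0)^2\<close>, that is of \<open>a0\<close>, and \<open>\<psi>\<close> increases
  with slope at least \<open>a1\<close>: it has a zero at distance of order \<open>a0\<close>, and \<open>ts\<close> is its only
  zero.\<close>

lemma ts_bound:
  assumes D: "0 < D" "D \<le> T" and small: "\<And>t. \<bar>t\<bar> \<le> D \<Longrightarrow> K * (\<bar>t\<bar> + xs t * (1 + 2 * V)) \<le> a1"
    and rD: "K * u\<^sup>2 * a0 / a1 \<le> D"
  shows "\<bar>ts\<bar> \<le> K * u\<^sup>2 * a0 / a1"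
proof -
  define r where "r = K * u\<^sup>2 * a0 / a1"
  have r: "0 < r" "r \<le> D" "a1 * r = K * u\<^sup>2 * a0" using a0 coeffs K1 lu rD by (auto simp: r_def)
  have w0: "\<rho> 0 = sqrt a0" by (simp add: width_def a0 less_imp_le)
  have "(xs 0)\<^sup>2 \<le> (u * \<rho> 0)\<^sup>2" using xs_b[of 0] xs_pos[of 0] T by (intro power_mono) auto
  then have "K * (xs 0)\<^sup>2 \<le> K * (u\<^sup>2 * a0)" using K a0 by (intro mult_left_mono) (auto simp: w0 power_mult_distrib)
  then have \<psi>0: "\<bar>\<psi> 0\<bar> \<le> a1 * r" using \<psi>_near[of 0] r by simp
  have "0 \<le> \<psi> r" "\<psi> (- r) \<le> 0"
    using \<psi>_increment[of D 0 r] \<psi>_increment[of D "- r" 0] r D small \<psi>0 by auto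
  then have "\<exists>t\<ge>- r. t \<le> r \<and> \<psi> t = 0"
    using r D by (intro IVT' continuous_on_subset[OF \<psi>_continuous]) auto
  then obtain t where t: "- r \<le> t" "t \<le> r" "\<psi> t = 0" by blast
  then have "t = ts" using \<psi>_zero_iff[of t] r D by auto
  then show ?thesis using t r_def by auto
qed

lemma slopes_inner:
  assumes D: "D \<le> T" and small: "\<And>t. \<bar>t\<bar> \<le> D \<Longrightarrow> K * (\<bar>t\<bar> + xs t * (1 + 2 * V)) \<le> a1"
    and tsD: "\<bar>ts\<bar> \<le> D" and t: "\<bar>t\<bar> \<le> D"
    and cC: "c \<le> a1 * (l / u)" "3 * a1 * (u / l) \<le> C"
  shows "ts \<le> t \<Longrightarrow> c * (t - ts) \<le> xs' t * \<rho> t \<and> xs' t * \<rho> t \<le> C * (t - ts)"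
    and "t \<le> ts \<Longrightarrow> c * (ts - t) \<le> - xs' t * \<rho> t \<and> - xs' t * \<rho> t \<le> C * (ts - t)"
proof -
  have tT: "\<bar>t\<bar> \<le> T" using t D by linarith
  define q where "q = xs t * \<rho> t / - fx (xs t) t"
  have q: "l / u \<le> q" "q \<le> u / l" "0 < l / u" using factor_bounds[OF tT] lu by (auto simp: q_def)
  have ts0: "\<psi> ts = 0" using \<psi>_zero_iff[of ts] tsD D by auto
  have eq: "xs' t * \<rho> t = \<psi> t * q" unfolding q_def by (rule xs'_rho)
  have bounds: "c * w \<le> y * q \<and> y * q \<le> C * w" if "a1 * w \<le> y" "y \<le> 3 * a1 * w" "0 \<le> w" for y w
  proof
    have y0: "0 \<le> y" using that coeffs mult_nonneg_nonneg[of a1 w] by linarith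
    have "c * w \<le> a1 * (l / u) * w" using cC that by (intro mult_right_mono) auto
    also have "\<dots> = (a1 * w) * (l / u)" by simp
    also have "\<dots> \<le> y * q" using that q y0 by (intro mult_mono) auto
    finally show "c * w \<le> y * q" .
    have "y * q \<le> (3 * a1 * w) * (u / l)" using that q y0 coeffs by (intro mult_mono) auto
    also have "\<dots> = 3 * a1 * (u / l) * w" by simp
    also have "\<dots> \<le> C * w" using cC that by (intro mult_right_mono) auto
    finally show "y * q \<le> C * w" .
  qed
  show "c * (t - ts) \<le> xs' t * \<rho> t \<and> xs' t * \<rho> t \<le> C * (t - ts)" if "ts \<le> t"
  proof (cases "t = ts")
    case True
    show ?thesis unfolding eq unfolding True ts0 by simp
  next
    case False
    then show ?thesis using \<psi>_increment[of D ts t] that tsD t D small ts0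
      unfolding eq by (intro bounds) auto
  qed
  show "c * (ts - t) \<le> - xs' t * \<rho> t \<and> - xs' t * \<rho> t \<le> C * (ts - t)" if "t \<le> ts"
  proof (cases "t = ts")
    case True
    have "- xs' t * \<rho> t = 0" using eq ts0 True by simp
    then show ?thesis using True by (simp only:) simp
  next
    case False
    have "- xs' t * \<rho> t = (- \<psi> t) * q" using eq by simp
    then show ?thesis using \<psi>_increment[of D t ts] that False tsD t D small ts0
      by (simp only:, intro bounds) auto
  qed
qed

text \<open>Away from the origin the size of \<open>xs'\<close> is given but its sign is not; it is
  inherited from \<open>\<psi> D\<close>, since \<open>\<psi>\<close> has no zero other than \<open>ts\<close>.\<close>

lemma slope_sign_right:
  assumes D: "0 < D" "D \<le> T" and tsD: "ts < D" and posD: "0 < \<psi> D" and t: "D \<le> t" "t \<le> T"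
  shows "0 < xs' t"
proof -
  have "0 < \<psi> t"
  proof (rule ccontr)
    assume "\<not> 0 < \<psi> t"
    then have "\<exists>s\<ge>D. s \<le> t \<and> \<psi> s = 0"
      using posD t D by (intro IVT2' continuous_on_subset[OF \<psi>_continuous]) auto
    then obtain s where "D \<le> s" "s \<le> t" "\<psi> s = 0" by blast
    then show False using \<psi>_zero_iff[of s] tsD t D by auto
  qed
  moreover have "0 < xs t / - fx (xs t) t" using xs_pos[of t] astar_neg[of t] t D by (intro divide_pos_pos) auto
  ultimately show ?thesis unfolding xs'_eq by (rule mult_pos_pos)
qed

lemma slope_sign_left:
  assumes D: "0 < D" "D \<le> T" and tsD: "- D < ts" and negD: "\<psi> (- D) < 0" and t: "- T \<le> t" "t \<le> - D"
  shows "xs' t < 0"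
proof -
  have "\<psi> t < 0"
  proof (rule ccontr)
    assume "\<not> \<psi> t < 0"
    then have "\<exists>s\<ge>t. s \<le> - D \<and> \<psi> s = 0"
      using negD t D by (intro IVT2' continuous_on_subset[OF \<psi>_continuous]) auto
    then obtain s where "t \<le> s" "s \<le> - D" "\<psi> s = 0" by blast
    then show False using \<psi>_zero_iff[of s] tsD t D by auto
  qed
  moreover have "0 < xs t / - fx (xs t) t" using xs_pos[of t] astar_neg[of t] t D by (intro divide_pos_pos) auto
  ultimately show ?thesis unfolding xs'_eq by (rule mult_neg_pos)
qed

section \<open>The drift near the equilibrium branch\<close>

text \<open>The third estimate concerns the numerator of the derivative of \<open>f \<xi> t / \<xi>\<close>. In
  it the linear term of \<open>f\<close> cancels, so no error of the form \<open>\<eta> t^2\<close> remains.\<close>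

lemma normal_form_f:
  assumes t: "\<bar>t\<bar> \<le> D" "D < \<delta>0" and \<xi>: "0 < \<xi>" "\<xi> \<le> R0" "R0 \<le> d" and \<eta>: "K * (R0 + D) \<le> \<eta>"
  shows "\<bar>f \<xi> t - \<xi> * (a0 + a1 * t\<^sup>2 - b * \<xi>\<^sup>2)\<bar> \<le> \<eta> * \<xi> * (t\<^sup>2 + \<xi>\<^sup>2)"
    and "\<bar>fx \<xi> t - (a0 + a1 * t\<^sup>2 - 3 * b * \<xi>\<^sup>2)\<bar> \<le> \<eta> * (t\<^sup>2 + \<xi>\<^sup>2)"
    and "\<bar>\<xi> * fx \<xi> t - f \<xi> t + 2 * b * \<xi> ^ 3\<bar> \<le> 2 * \<eta> * \<xi> ^ 3"
proof -
  have \<xi>0: "0 \<le> \<xi>" "\<xi> \<le> d" using \<xi> by auto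
  have 1: "\<bar>f \<xi> t - (fx 0 t * \<xi> - b * \<xi> ^ 3)\<bar> \<le> K * (\<xi> + \<bar>t\<bar>) * \<xi> ^ 3"
    using f_expand[OF \<xi>0, of t] by (simp add: third b_def)
  have 2: "\<bar>fx \<xi> t - (fx 0 t - 3 * b * \<xi>\<^sup>2)\<bar> \<le> K * (\<xi> + \<bar>t\<bar>) * \<xi>\<^sup>2"
    using fx_expand[OF \<xi>0 \<xi>0(1) order_refl, of t] by (simp add: third b_def)
  have 3: "\<bar>fx 0 t - (a0 + a1 * t\<^sup>2)\<bar> \<le> K * \<bar>t\<bar> * t\<^sup>2"
    using a_exp[of t] t by (simp add: power3_eq_cube power2_eq_square mult.assoc)
  have "K * (\<xi> + \<bar>t\<bar>) \<le> K * (R0 + D)" using \<xi> t K by (intro mult_left_mono add_mono) auto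
  then have e1: "K * (\<xi> + \<bar>t\<bar>) \<le> \<eta>" using \<eta> by linarith
  have "K * \<bar>t\<bar> \<le> K * (\<xi> + \<bar>t\<bar>)" using \<xi> K by (intro mult_left_mono) auto
  then have e2: "K * \<bar>t\<bar> \<le> \<eta>" using e1 by linarith
  have n1: "\<bar>f \<xi> t - (fx 0 t * \<xi> - b * \<xi> ^ 3)\<bar> \<le> \<eta> * \<xi> ^ 3"
    by (rule order_trans[OF 1 mult_right_mono[OF e1]]) (use \<xi> in simp)
  have n2: "\<bar>fx \<xi> t - (fx 0 t - 3 * b * \<xi>\<^sup>2)\<bar> \<le> \<eta> * \<xi>\<^sup>2"
    by (rule order_trans[OF 2 mult_right_mono[OF e1]]) simp
  have n3: "\<bar>fx 0 t - (a0 + a1 * t\<^sup>2)\<bar> \<le> \<eta> * t\<^sup>2"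
    by (rule order_trans[OF 3 mult_right_mono[OF e2]]) simp
  then have 4: "\<bar>\<xi> * (fx 0 t - (a0 + a1 * t\<^sup>2))\<bar> \<le> \<xi> * (\<eta> * t\<^sup>2)"
    unfolding abs_mult using \<xi> by simp
  have "f \<xi> t - \<xi> * (a0 + a1 * t\<^sup>2 - b * \<xi>\<^sup>2) =
      (f \<xi> t - (fx 0 t * \<xi> - b * \<xi> ^ 3)) + \<xi> * (fx 0 t - (a0 + a1 * t\<^sup>2))"
    by (simp add: power3_eq_cube power2_eq_square algebra_simps)
  moreover have "\<eta> * \<xi> * (t\<^sup>2 + \<xi>\<^sup>2) = \<eta> * \<xi> ^ 3 + \<xi> * (\<eta> * t\<^sup>2)"
    by (simp add: power3_eq_cube power2_eq_square algebra_simps)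
  ultimately show "\<bar>f \<xi> t - \<xi> * (a0 + a1 * t\<^sup>2 - b * \<xi>\<^sup>2)\<bar> \<le> \<eta> * \<xi> * (t\<^sup>2 + \<xi>\<^sup>2)"
    using n1 4 by linarith
  show "\<bar>fx \<xi> t - (a0 + a1 * t\<^sup>2 - 3 * b * \<xi>\<^sup>2)\<bar> \<le> \<eta> * (t\<^sup>2 + \<xi>\<^sup>2)"
    using n2 n3 unfolding distrib_left by linarith
  have 5: "\<bar>\<xi> * (fx \<xi> t - (fx 0 t - 3 * b * \<xi>\<^sup>2))\<bar> \<le> \<xi> * (\<eta> * \<xi>\<^sup>2)"
    unfolding abs_mult using \<xi> n2 by simp
  have "\<xi> * fx \<xi> t - f \<xi> t + 2 * b * \<xi> ^ 3 =
     \<xi> * (fx \<xi> t - (fx 0 t - 3 * b * \<xi>\<^sup>2)) - (f \<xi> t - (fx 0 t * \<xi> - b * \<xi> ^ 3))"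
    by (simp add: power3_eq_cube power2_eq_square algebra_simps)
  moreover have "2 * \<eta> * \<xi> ^ 3 = \<xi> * (\<eta> * \<xi>\<^sup>2) + \<eta> * \<xi> ^ 3"
    by (simp add: power3_eq_cube power2_eq_square)
  ultimately show "\<bar>\<xi> * fx \<xi> t - f \<xi> t + 2 * b * \<xi> ^ 3\<bar> \<le> 2 * \<eta> * \<xi> ^ 3"
    using 5 n1 by linarith
qed

text \<open>The mean value theorem of Cauchy for \<open>f x t / x\<close> against \<open>x^2\<close>: this is the
  statement that \<open>f = x (a - h x^2)\<close> with \<open>h\<close> close to \<open>b\<close>, for increments. It yields the
  factor \<open>\<xi> (\<xi> + xs)\<close> of the restoring rate without any loss as \<open>\<xi>\<close> or \<open>xs\<close> tends to zero.\<close>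

lemma quotient_increment:
  assumes t: "\<bar>t\<bar> \<le> D" "D < \<delta>0" and xy: "0 < x" "x < y" "y \<le> R0" "R0 < d" and \<eta>: "K * (R0 + D) \<le> \<eta>"
  shows "\<exists>h. b - \<eta> \<le> h \<and> h \<le> b + \<eta> \<and> f y t / y - f x t / x = - h * (y\<^sup>2 - x\<^sup>2)"
proof -
  have der: "((\<lambda>z. f z t / z) has_real_derivative (z * fx z t - f z t) / z\<^sup>2) (at z)" if z: "x \<le> z" "z \<le> y" for z
  proof -
    have "((\<lambda>y. f y t) has_real_derivative fx z t) (at z within {- d..d})"
      by (rule pdx_deriv[OF levels(1)]) (use z xy in auto)
    moreover have "at z within {- d..d} = at z" using z xy by (intro at_within_Icc_at) auto
    ultimately have "((\<lambda>y. f y t) has_real_derivative fx z t) (at z)" by simp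
    then have "((\<lambda>z. f z t / z) has_real_derivative (fx z t * z - f z t * 1) / (z * z)) (at z)"
      using z xy by (intro DERIV_divide DERIV_ident) auto
    then show ?thesis by (simp add: power2_eq_square mult.commute)
  qed
  have sq: "((\<lambda>z. z\<^sup>2) has_real_derivative 2 * z) (at z)" for z :: real
    by (auto intro!: derivative_eq_intros)
  obtain z where z: "x < z" "z < y"
    "(f y t / y - f x t / x) * (2 * z) = (y\<^sup>2 - x\<^sup>2) * ((z * fx z t - f z t) / z\<^sup>2)"
    using GMVT'[of x y "\<lambda>z. f z t / z" "\<lambda>z. z\<^sup>2" "\<lambda>z. 2 * z" "\<lambda>z. (z * fx z t - f z t) / z\<^sup>2"]
      xy(2) der sq by (auto intro: DERIV_isCont)
  have z0: "0 < z" "z \<le> R0" using z xy by auto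
  define h where "h = - (z * fx z t - f z t) / (2 * z ^ 3)"
  have "\<bar>z * fx z t - f z t + 2 * b * z ^ 3\<bar> \<le> 2 * \<eta> * z ^ 3"
    by (rule normal_form_f(3)[OF t z0 less_imp_le[OF xy(4)] \<eta>])
  then have "(b - \<eta>) * (2 * z ^ 3) \<le> - (z * fx z t - f z t)" "- (z * fx z t - f z t) \<le> (b + \<eta>) * (2 * z ^ 3)"
    by (auto simp: abs_le_iff algebra_simps)
  then have "b - \<eta> \<le> h" "h \<le> b + \<eta>" using z0 unfolding h_def by (simp_all add: pos_le_divide_eq pos_divide_le_eq)
  moreover have "f y t / y - f x t / x = - h * (y\<^sup>2 - x\<^sup>2)"
  proof -
    have "f y t / y - f x t / x = (y\<^sup>2 - x\<^sup>2) * ((z * fx z t - f z t) / z\<^sup>2) / (2 * z)"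
    proof -
      have "P = Q / (2 * z)" if "P * (2 * z) = Q" for P Q :: real
        using that z0 by (simp add: nonzero_eq_divide_eq)
      from this[OF z(3)] show ?thesis .
    qed
    also have "\<dots> = - h * (y\<^sup>2 - x\<^sup>2)"
    proof -
      have "S * (W / z\<^sup>2) / (2 * z) = - (- W / (2 * z ^ 3)) * S" for S W by (simp add: eval_nat_numeral mult_ac)
      then show ?thesis unfolding h_def .
    qed
    finally show ?thesis .
  qed
  ultimately show ?thesis by blast
qed

lemma chord_inner_region:
  assumes t: "\<bar>t\<bar> \<le> D" "D < \<delta>0" and \<xi>: "0 < \<xi>" "\<xi> \<le> R0" "xs t \<le> R0" "R0 < d"
    and \<eta>: "K * (R0 + D) \<le> \<eta>" "\<eta> \<le> b / 2"
    and cC: "c \<le> b / 2" "2 * b \<le> C"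
  shows "\<exists>k. c * \<xi> * (\<xi> + xs t) \<le> k \<and> k \<le> C * \<xi> * (\<xi> + xs t) \<and> f \<xi> t = - k * (\<xi> - xs t)"
proof -
  have b0: "0 < b" using coeffs by (simp add: b_def)
  have "\<exists>h. b - \<eta> \<le> h \<and> h \<le> b + \<eta> \<and> f \<xi> t / \<xi> = - h * (\<xi>\<^sup>2 - (xs t)\<^sup>2)"
  proof -
    consider "\<xi> < xs t" | "\<xi> = xs t" | "xs t < \<xi>" by linarith
    then show ?thesis
    proof cases
      case 1
      from quotient_increment[OF t \<xi>(1) 1 \<xi>(3,4) \<eta>(1)] obtain h where
        "b - \<eta> \<le> h" "h \<le> b + \<eta>" "f (xs t) t / xs t - f \<xi> t / \<xi> = - h * ((xs t)\<^sup>2 - \<xi>\<^sup>2)" by blast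
      then show ?thesis using f_xs by (intro exI[of _ h]) (auto simp: algebra_simps)
    next
      case 2
      have "0 \<le> K * (R0 + D)" using K \<xi> t by simp
      then have "0 \<le> \<eta>" using \<eta> by linarith
      then show ?thesis using 2 f_xs[of t] by (intro exI[of _ "b - \<eta>"]) simp
    next
      case 3
      from quotient_increment[OF t xs_pos 3 \<xi>(2,4) \<eta>(1)] obtain h where
        "b - \<eta> \<le> h" "h \<le> b + \<eta>" "f \<xi> t / \<xi> - f (xs t) t / xs t = - h * (\<xi>\<^sup>2 - (xs t)\<^sup>2)" by blast
      then show ?thesis using f_xs by (intro exI[of _ h]) auto
    qed
  qed
  then obtain h where h: "b - \<eta> \<le> h" "h \<le> b + \<eta>" "f \<xi> t / \<xi> = - h * (\<xi>\<^sup>2 - (xs t)\<^sup>2)" by blast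
  have w: "0 \<le> \<xi> * (\<xi> + xs t)" using \<xi> xs_pos[of t] by simp
  have "c \<le> h" "h \<le> C" using h cC \<eta> b0 by linarith+
  then have "c * (\<xi> * (\<xi> + xs t)) \<le> h * (\<xi> * (\<xi> + xs t))" "h * (\<xi> * (\<xi> + xs t)) \<le> C * (\<xi> * (\<xi> + xs t))"
    using w by (auto intro!: mult_right_mono)
  moreover have "f \<xi> t = \<xi> * (f \<xi> t / \<xi>)" using \<xi> by simp
  then have "f \<xi> t = - (h * (\<xi> * (\<xi> + xs t))) * (\<xi> - xs t)"
    unfolding h(3) by (simp add: power2_eq_square algebra_simps)
  ultimately show ?thesis by (intro exI[of _ "h * (\<xi> * (\<xi> + xs t))"]) (simp add: mult.assoc)
qed

lemma outer_slope_bounds: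
  assumes t: "D \<le> \<bar>t\<bar>" "\<bar>t\<bar> \<le> T" "0 < D" and \<xi>: "0 < \<xi>" "\<xi> \<le> d" "\<bar>\<xi> - xs t\<bar> \<le> R" and R: "K * R \<le> l * D\<^sup>2 / 2"
  shows "l * D\<^sup>2 / 2 \<le> - fx \<xi> t \<and> - fx \<xi> t \<le> 2 * u"
proof -
  \<comment> \<open>\<open>\<partial>\<^sub>x f\<close> has Lipschitz constant \<open>K\<close>, and \<open>R\<close> is so small that at most half of the
    slope at \<open>xs\<close> is lost\<close>
  have "\<bar>fx \<xi> t - fx (xs t) t\<bar> \<le> K * \<bar>\<xi> - xs t\<bar>"
  proof -
    have "norm (fx \<xi> t - fx (xs t) t) \<le> K * norm (\<xi> - xs t)"
    proof (rule field_differentiable_bound[where S = "{- d..d}" and f' = "\<lambda>y. fxx y t"])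
      show "((\<lambda>y. fx y t) has_real_derivative fxx y t) (at y within {- d..d})" if "y \<in> {- d..d}" for y
        by (rule pdx_deriv[OF levels(2) that])
      show "norm (fxx y t) \<le> K" if "y \<in> {- d..d}" for y
        using Ck_bounded_bound[OF levels(3) that] by simp
    qed (use \<xi> xs_in in auto)
    then show ?thesis by simp
  qed
  also have "\<dots> \<le> K * R" using \<xi> K by (intro mult_left_mono) auto
  finally have 1: "\<bar>fx \<xi> t - fx (xs t) t\<bar> \<le> l * D\<^sup>2 / 2" using R by linarith
  have D2: "D\<^sup>2 \<le> (\<rho> t)\<^sup>2" using t rho(3)[of t] by (intro power_mono) auto
  have "(\<rho> t)\<^sup>2 \<le> 1" using rho_le_1[OF t(2)] rho(1)[of t] by (simp add: power_le_one)
  moreover from this D2 have "D\<^sup>2 \<le> 1" by linarith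
  then have "l * D\<^sup>2 \<le> 1 * 1" using lu by (intro mult_mono) auto
  moreover have "l * D\<^sup>2 \<le> l * (\<rho> t)\<^sup>2" using lu D2 by (intro mult_left_mono) auto
  moreover have "u * (\<rho> t)\<^sup>2 \<le> u * 1" using lu calculation(1) by (intro mult_left_mono) auto
  ultimately have "u * (\<rho> t)\<^sup>2 \<le> u * 1" "l * D\<^sup>2 \<le> l * (\<rho> t)\<^sup>2" "l * D\<^sup>2 \<le> 1 * 1" by blast+
  then show ?thesis using slope[OF t(2)] 1 lu by linarith
qed

text \<open>Away from the bifurcation \<open>\<xi>\<close> and \<open>xs\<close> are bounded above and below, so the mean
  value theorem for \<open>f\<close> and the bounds for its slope near \<open>xs\<close> are enough.\<close>

lemma chord_outer_region:
  assumes t: "D \<le> \<bar>t\<bar>" "\<bar>t\<bar> \<le> T" "0 < D" and \<xi>: "0 < \<xi>" "\<xi> \<le> d" "\<bar>\<xi> - xs t\<bar> \<le> R"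
    and R: "K * R \<le> l * D\<^sup>2 / 2" "R \<le> l * D / 2"
    and cC: "0 \<le> c" "c * (2 * d\<^sup>2) \<le> l * D\<^sup>2 / 2" "2 * u \<le> C * (l\<^sup>2 * D\<^sup>2 / 2)"
  shows "\<exists>k. c * \<xi> * (\<xi> + xs t) \<le> k \<and> k \<le> C * \<xi> * (\<xi> + xs t) \<and> f \<xi> t = - k * (\<xi> - xs t)"
proof -
  have "\<exists>k. l * D\<^sup>2 / 2 \<le> k \<and> k \<le> 2 * u \<and> f \<xi> t = - k * (\<xi> - xs t)"
  proof -
    have near: "\<exists>z. 0 < z \<and> z \<le> d \<and> \<bar>z - xs t\<bar> \<le> R \<and> f \<xi> t = fx z t * (\<xi> - xs t)"
    proof -
      consider "\<xi> < xs t" | "\<xi> = xs t" | "xs t < \<xi>" by linarith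
      then show ?thesis
      proof cases
        case 1
        obtain z where "\<xi> < z" "z < xs t" "f (xs t) t - f \<xi> t = (xs t - \<xi>) * fx z t"
          by (rule strip_mean_value[OF levels(1) _ 1 xs_le]) (use \<xi> d in auto)
        then show ?thesis using \<xi> f_xs[of t] xs_le[of t] by (intro exI[of _ z]) (auto simp: algebra_simps)
      next
        case 2
        then show ?thesis using \<xi> f_xs[of t] by (intro exI[of _ \<xi>]) auto
      next
        case 3
        obtain z where "xs t < z" "z < \<xi>" "f \<xi> t - f (xs t) t = (\<xi> - xs t) * fx z t"
          by (rule strip_mean_value[OF levels(1) _ 3 \<xi>(2)]) (use xs_pos[of t] d in auto)
        then show ?thesis using \<xi> f_xs[of t] xs_pos[of t] by (intro exI[of _ z]) (auto simp: algebra_simps)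
      qed
    qed
    then obtain z where "0 < z" "z \<le> d" "\<bar>z - xs t\<bar> \<le> R" "f \<xi> t = fx z t * (\<xi> - xs t)" by blast
    then show ?thesis using outer_slope_bounds[OF t _ _ _ R(1), of z] by (intro exI[of _ "- fx z t"]) auto
  qed
  then obtain k where k: "l * D\<^sup>2 / 2 \<le> k" "k \<le> 2 * u" "f \<xi> t = - k * (\<xi> - xs t)" by blast
  have "\<xi> * (\<xi> + xs t) \<le> d * (d + d)" using \<xi> xs_le[of t] xs_pos[of t] by (intro mult_mono) auto
  then have "c * (\<xi> * (\<xi> + xs t)) \<le> c * (2 * d\<^sup>2)" using cC by (intro mult_left_mono) (auto simp: power2_eq_square)
  moreover have "l * D \<le> xs t"
  proof -
    have "l * D \<le> l * \<rho> t" using t rho(3)[of t] lu by (intro mult_left_mono) auto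
    then show ?thesis using xs_b[OF t(2)] by linarith
  qed
  then have "l * D / 2 \<le> \<xi>" "l * D \<le> \<xi> + xs t" using \<xi> R by linarith+
  then have "l * D / 2 * (l * D) \<le> \<xi> * (\<xi> + xs t)" using lu t \<xi> by (intro mult_mono) auto
  moreover have "0 \<le> C"
  proof (rule ccontr)
    assume "\<not> 0 \<le> C"
    then have "C * (l\<^sup>2 * D\<^sup>2 / 2) \<le> 0" using mult_nonneg_nonneg[of "l\<^sup>2" "D\<^sup>2"] by (simp add: mult_le_0_iff)
    then show False using cC lu by linarith
  qed
  ultimately have "C * (l * D / 2 * (l * D)) \<le> C * (\<xi> * (\<xi> + xs t))" by (intro mult_left_mono) auto
  moreover have "l * D / 2 * (l * D) = l\<^sup>2 * D\<^sup>2 / 2" by (simp add: power2_eq_square)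
  ultimately have "C * (l\<^sup>2 * D\<^sup>2 / 2) \<le> C * (\<xi> * (\<xi> + xs t))" by simp
  then have "k \<le> C * (\<xi> * (\<xi> + xs t))" using k(2) cC(3) by linarith
  moreover have "c * (\<xi> * (\<xi> + xs t)) \<le> k"
    using k(1) cC(2) \<open>c * (\<xi> * (\<xi> + xs t)) \<le> c * (2 * d\<^sup>2)\<close> by linarith
  ultimately show ?thesis using k(3) by (intro exI[of _ k]) (simp only: mult.assoc conj_assoc)
qed

lemma f_neg_beyond: assumes y: "xs t < y" "y \<le> d" shows "f y t < 0"
proof (rule ccontr)
  assume pos: "\<not> f y t < 0"
  from has_real_derivative_neg_dec_right[OF pdx_deriv[OF levels(1) xs_in] astar_neg]
  obtain \<delta> where \<delta>: "0 < \<delta>" "\<And>h. 0 < h \<Longrightarrow> xs t + h \<in> {- d..d} \<Longrightarrow> h < \<delta> \<Longrightarrow> f (xs t + h) t < f (xs t) t" by blast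
  define h where "h = min (\<delta> / 2) (y - xs t)"
  have h: "0 < h" "xs t + h \<le> y" "h < \<delta>" using \<delta> y by (auto simp: h_def min_def)
  have neg: "f (xs t + h) t < 0" using \<delta>(2)[of h] h y xs_pos[of t] d f_xs[of t] by auto
  have "continuous_on {- d..d} (\<lambda>y. f y t)"
    by (rule DERIV_continuous_on[OF pdx_deriv[OF levels(1)]])
  then have "continuous_on {xs t + h..y} (\<lambda>y. f y t)"
    by (rule continuous_on_subset) (use h y xs_pos[of t] d in auto)
  then have "\<exists>z\<ge>xs t + h. z \<le> y \<and> f z t = 0"
    using IVT'[of "\<lambda>y. f y t" "xs t + h" 0 y] neg pos h by (simp add: not_less)
  then obtain z where "xs t + h \<le> z" "z \<le> y" "f z t = 0" by blast
  then show False using zeros[of z t] xs_pos[of t] h y d by auto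
qed

section \<open>From the drift to the slow passage hypotheses\<close>

text \<open>At time \<open>- T\<close> the equilibrium still decreases at a definite rate. Slightly
  earlier it was therefore higher by a definite amount and yet at most \<open>d\<close>. Quantitatively,
  \<open>\<partial>\<^sub>t f \<le> - w\<close> at \<open>(xs (- T), - T)\<close> makes \<open>f\<close> positive, at least \<open>w s0 / 2\<close>, at the same
  point a time \<open>s0\<close> earlier, and \<open>f\<close> has Lipschitz constant \<open>K\<close> in \<open>x\<close>.\<close>

lemma room_at_start:
  assumes s: "xs' (- T) \<le> - \<kappa>" "0 < \<kappa>"
  shows "xs (- T) + (l * T\<^sup>2 * \<kappa>)\<^sup>2 / (4 * K\<^sup>2) \<le> d"
proof -
  define w where "w = l * T\<^sup>2 * \<kappa>"
  have w0: "0 < w" using lu T s by (simp add: w_def)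
  have K0: "0 < K" using K1 by simp
  define x0 where "x0 = xs (- T)"
  have x0: "0 < x0" "x0 \<le> d" "x0 \<in> {- d..d}" using xs_range[of "- T"] xs_in[of "- T"] by (auto simp: x0_def)
  have ftw: "ft x0 (- T) \<le> - w"
  proof -
    have "l * T\<^sup>2 \<le> - fx x0 (- T)"
    proof -
      have "T\<^sup>2 \<le> (\<rho> (- T))\<^sup>2" using rho(3)[of "- T"] T by (intro power_mono) auto
      then have "l * T\<^sup>2 \<le> l * (\<rho> (- T))\<^sup>2" using lu by simp
      then show ?thesis using slope[of "- T"] T by (simp add: x0_def)
    qed
    then have "l * T\<^sup>2 * \<kappa> \<le> - fx x0 (- T) * - xs' (- T)"
      using s lu T astar_neg[of "- T"] by (intro mult_mono) (auto simp: x0_def)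
    also have "\<dots> = - ft x0 (- T)" using astar_neg[of "- T"] by (simp add: xs'_def x0_def)
    finally show ?thesis by (simp add: w_def)
  qed
  \<comment> \<open>short enough for \<open>\<partial>\<^sub>t f\<close> to stay below \<open>- w / 2\<close>, as \<open>\<bar>\<partial>\<^sub>t \<partial>\<^sub>t f\<bar> \<le> K\<close>\<close>
  define s0 where "s0 = w / (2 * K)"
  have s0: "0 < s0" "K * s0 = w / 2" using w0 K0 by (auto simp: s0_def)
  have f_low: "w * s0 / 2 \<le> f x0 (- T - s0)"
  proof -
    obtain z where z: "- T - s0 < z" "z < - T" "f x0 (- T) - f x0 (- T - s0) = (- T - (- T - s0)) * ft x0 z"
      using MVT2[of "- T - s0" "- T" "f x0" "ft x0"] pdt_deriv[OF levels(1) x0(3)] s0 by auto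
    have "norm (ft x0 z - ft x0 (- T)) \<le> K * norm (z - - T)"
    proof (rule field_differentiable_bound[where S = UNIV and f' = "ftt x0"])
      show "(ft x0 has_real_derivative ftt x0 y) (at y within UNIV)" for y
        using pdt_deriv[OF levels(5) x0(3)] by simp
      show "norm (ftt x0 y) \<le> K" for y using Ck_bounded_bound[OF levels(8) x0(3)] by simp
    qed auto
    also have "\<dots> \<le> K * s0" using z K by (intro mult_left_mono) auto
    finally have "\<bar>ft x0 z - ft x0 (- T)\<bar> \<le> w / 2" using s0(2) by simp
    moreover have "p \<le> - (w / 2)" if "\<bar>p - q\<bar> \<le> w / 2" "q \<le> - w" for p q
      using that by (simp add: abs_if split: if_splits)
    ultimately have "ft x0 z \<le> - (w / 2)" using ftw by blast
    then have "s0 * ft x0 z \<le> s0 * - (w / 2)" using s0 by (intro mult_left_mono) auto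
    then show ?thesis using z(3) f_xs[of "- T"] by (simp add: x0_def mult_ac)
  qed
  have pos: "0 < w * s0 / 2" using w0 s0 by simp
  define x1 where "x1 = xs (- T - s0)"
  have x1: "0 < x1" "x1 \<le> d" "x1 \<in> {- d..d}" "f x1 (- T - s0) = 0"
    using xs_range[of "- T - s0"] xs_in[of "- T - s0"] f_xs by (auto simp: x1_def)
  have "x0 \<le> x1"
    using f_neg_beyond[of "- T - s0" x0] x0 f_low pos by (auto simp: x1_def not_le intro: ccontr)
  moreover have "norm (f x0 (- T - s0) - f x1 (- T - s0)) \<le> K * norm (x0 - x1)"
  proof (rule field_differentiable_bound[where S = "{- d..d}" and f' = "\<lambda>y. fx y (- T - s0)"])
    show "((\<lambda>y. f y (- T - s0)) has_real_derivative fx y (- T - s0)) (at y within {- d..d})" if "y \<in> {- d..d}" for y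
      by (rule pdx_deriv[OF levels(1) that])
    show "norm (fx y (- T - s0)) \<le> K" if "y \<in> {- d..d}" for y using Ck_bounded_bound[OF levels(2) that] by simp
  qed (use x0 x1 in auto)
  ultimately have "w * s0 / 2 \<le> K * (x1 - x0)" using f_low x1(4) by simp
  then have "K * (w\<^sup>2 / (4 * K\<^sup>2)) \<le> K * (x1 - x0)" using K0 by (simp add: s0_def power2_eq_square)
  then have "w\<^sup>2 / (4 * K\<^sup>2) \<le> x1 - x0" by (rule mult_left_le_imp_le[OF _ K0])
  then show ?thesis using x1(2) unfolding w_def x0_def by linarith
qed

text \<open>The bounds are collected separately for \<open>\<bar>t\<bar> \<le> D\<close>, where the expansions at the
  origin apply, and for \<open>D \<le> \<bar>t\<bar> \<le> T\<close>, where everything is bounded away from zero.\<close>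

lemma slow_passage_of_snapshot:
  assumes \<eta>: "0 < \<eta>" "\<eta> < a1" "\<eta> \<le> b / 2" "K * (R0 + D) \<le> \<eta>"
    and R0: "0 < R0" "2 * R0 \<le> d"
    and D: "0 < D" "D < \<delta>0" "D \<le> T" "2 * u * D \<le> R0"
    and \<psi>_small: "K * (D + R0 * (1 + 2 * V)) \<le> a1"
    and \<kappa>: "0 < \<kappa>" "\<And>t. \<bar>t\<bar> \<le> T \<Longrightarrow> D / 2 \<le> \<bar>t - ts\<bar> \<Longrightarrow> \<kappa> \<le> \<bar>deriv xs t\<bar>"
    and R: "0 < R" "2 * R \<le> R0" "K * R \<le> l * D\<^sup>2 / 2" "R \<le> l * D / 2" "R \<le> (l * T\<^sup>2 * \<kappa>)\<^sup>2 / (4 * K\<^sup>2)"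
    and a0_small: "2 * K * u\<^sup>2 * sqrt a0 \<le> a1" "sqrt a0 \<le> D"
    and c: "0 < c" "c \<le> 1" "c \<le> l" "c \<le> a1 * (l / u)" "c \<le> \<kappa> * D" "c \<le> b / 2" "c * (2 * d\<^sup>2) \<le> l * D\<^sup>2 / 2" "c \<le> l * D\<^sup>2 / 2"
    and C: "1 \<le> C" "2 * u \<le> C" "3 * a1 * (u / l) \<le> C" "V \<le> C * (D / 2)" "2 * b \<le> C" "2 * u \<le> C * (l\<^sup>2 * D\<^sup>2 / 2)"
    and \<epsilon>: "0 < \<epsilon>"
    and sol: "\<And>t. \<bar>t\<bar> \<le> T \<Longrightarrow> (x has_real_derivative f (x t) t / \<epsilon>) (at t within {- T..T})"
    and ini: "c * \<epsilon> \<le> x (- T) - xs (- T)" "x (- T) - xs (- T) \<le> C * \<epsilon>"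
  shows "slow_passage T d D R R0 c C b a1 \<eta> \<epsilon> a0 ts f fx xs xs' x"
proof -
  have V0: "0 \<le> V" using K lu by (simp add: V_def)
  have R0d: "R0 < d" using R0 by linarith
  have rhoD: "\<rho> t \<le> D" if "\<bar>t\<bar> \<le> D" for t using that a0_small by (simp add: width_def)
  have xs_small: "xs t \<le> R0 / 2" if t: "\<bar>t\<bar> \<le> D" for t
  proof -
    have "u * \<rho> t \<le> u * D" using rhoD[OF t] lu by (intro mult_left_mono) auto
    then show ?thesis using xs_b[of t] t D by linarith
  qed
  have small: "K * (\<bar>t\<bar> + xs t * (1 + 2 * V)) \<le> a1" if t: "\<bar>t\<bar> \<le> D" for t
  proof -
    have "xs t \<le> R0" using xs_small[OF t] R0 by linarith
    then have "K * (\<bar>t\<bar> + xs t * (1 + 2 * V)) \<le> K * (D + R0 * (1 + 2 * V))"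
      using t K V0 by (intro mult_left_mono add_mono mult_right_mono) auto
    then show ?thesis using \<psi>_small by linarith
  qed
  have ts_sqrt: "K * u\<^sup>2 * a0 / a1 \<le> sqrt a0 / 2"
  proof -
    have "(2 * K * u\<^sup>2 * sqrt a0) * sqrt a0 \<le> a1 * sqrt a0" using a0_small a0 by (intro mult_right_mono) auto
    then have "2 * K * u\<^sup>2 * a0 \<le> a1 * sqrt a0" using a0 by (simp add: mult.assoc)
    then show ?thesis using coeffs by (simp add: pos_divide_le_eq mult.commute)
  qed
  have sq0: "0 < sqrt a0" using a0 by simp
  then have rD: "K * u\<^sup>2 * a0 / a1 \<le> D" using ts_sqrt a0_small by linarith
  have ts_sm: "\<bar>ts\<bar> \<le> sqrt a0 / 2" using ts_bound[OF D(1,3) small rD] ts_sqrt by linarith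
  then have tsD: "\<bar>ts\<bar> \<le> D" "\<bar>ts\<bar> \<le> D / 2" "- D < ts" "ts < D" using a0_small sq0 D(1) by linarith+
  have slope_big: "\<kappa> \<le> \<bar>xs' t\<bar>" if t: "D \<le> \<bar>t\<bar>" "\<bar>t\<bar> \<le> T" for t
  proof -
    have "D / 2 \<le> \<bar>t - ts\<bar>" using t tsD(2) by linarith
    then show ?thesis using \<kappa>(2)[OF t(2)] DERIV_imp_deriv[OF xs_deriv[OF t(2)]] by simp
  qed
  have \<psi>ts: "\<psi> ts = 0" using \<psi>_zero_iff[of ts] tsD D by auto
  have \<psi>D: "0 < \<psi> D" "\<psi> (- D) < 0"
  proof -
    have "0 < a1 * (D - ts)" "0 < a1 * (ts - - D)" using coeffs tsD by (auto intro!: mult_pos_pos)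
    then show "0 < \<psi> D" "\<psi> (- D) < 0"
      using \<psi>_increment[of D ts D, OF _ tsD(4) order_refl D(3) small] \<psi>_increment[of D "- D" ts, OF order_refl tsD(3) _ D(3) small] tsD \<psi>ts
      by auto
  qed
  have pos_out: "\<kappa> \<le> xs' t" if t: "D \<le> t" "t \<le> T" for t
    using slope_sign_right[OF D(1,3) tsD(4) \<psi>D(1) t] slope_big[of t] t D(1) by auto
  have neg_out: "xs' t \<le> - \<kappa>" if t: "- T \<le> t" "t \<le> - D" for t
    using slope_sign_left[OF D(1,3) tsD(3) \<psi>D(2) t] slope_big[of t] t D(1) by auto
  \<comment> \<open>away from the origin all quantities have order one, so a crude comparison
    suffices\<close>
  have cD: "c * w \<le> v * \<rho> t \<and> v * \<rho> t \<le> C * w"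
    if "\<kappa> \<le> v" "v \<le> V" "D / 2 \<le> w" "w \<le> 1" "D \<le> \<bar>t\<bar>" "\<bar>t\<bar> \<le> T" for v w t
  proof
    have "c * w \<le> c * 1" using c that by (intro mult_left_mono) auto
    also have "\<dots> \<le> \<kappa> * D" using c by simp
    also have "\<dots> \<le> v * \<rho> t" using that \<kappa>(1) D(1) rho(3)[of t] by (intro mult_mono) auto
    finally show "c * w \<le> v * \<rho> t" .
    have "v * \<rho> t \<le> V * 1" using that \<kappa>(1) V0 rho(1)[of t] rho_le_1[of t] by (intro mult_mono) auto
    also have "\<dots> \<le> C * (D / 2)" using C by simp
    also have "\<dots> \<le> C * w" using C that by (intro mult_left_mono) auto
    finally show "v * \<rho> t \<le> C * w" .
  qed
  have b0: "0 < b" using coeffs by (simp add: b_def)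
  show ?thesis
  proof
    show "0 < \<epsilon>" "0 < a0" "T < 1 / 2" "0 < D" "D \<le> T" "0 < R" "0 < R0" "2 * R \<le> R0" "0 < c" "c \<le> 1" "1 \<le> C"
      "0 < b" "0 < \<eta>" "\<eta> < a1" "\<bar>ts\<bar> \<le> sqrt a0 / 2"
      by (use \<epsilon> a0 T D R R0 c C b0 \<eta> ts_sm in linarith)+
    show "c * \<rho> t \<le> xs t \<and> xs t \<le> C * \<rho> t" if t: "\<bar>t\<bar> \<le> T" for t
    proof -
      have "c * \<rho> t \<le> l * \<rho> t" using c rho(1)[of t] by (intro mult_right_mono) auto
      moreover have "u * \<rho> t \<le> C * \<rho> t" using C lu rho(1)[of t] by (intro mult_right_mono) auto
      ultimately show ?thesis using xs_b[OF t] by linarith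
    qed
    show "xs t \<le> d" for t by (rule xs_le)
    show "xs t \<le> d - R" if t: "- T \<le> t" "t \<le> D" for t
    proof (cases "t < - D")
      case True
      have "xs t \<le> xs (- T)"
      proof (cases "t = - T")
        case False
        then have lt: "- T < t" using t by simp
        have "\<exists>z. - T < z \<and> z < t \<and> xs t - xs (- T) = (t - - T) * xs' z"
          using True D(1) by (intro MVT2[OF lt] xs_deriv) auto
        then obtain z where z: "- T < z" "z < t" "xs t - xs (- T) = (t - - T) * xs' z" by blast
        have "xs' z < 0" using neg_out[of z] z True \<kappa>(1) by auto
        then have "(t - - T) * xs' z \<le> 0" using lt by (intro mult_nonneg_nonpos) auto
        then show ?thesis using z(3) by linarith
      qed simp
      moreover have "xs (- T) + (l * T\<^sup>2 * \<kappa>)\<^sup>2 / (4 * K\<^sup>2) \<le> d"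
        by (rule room_at_start[OF neg_out \<kappa>(1)]) (use D in auto)
      ultimately show ?thesis using R by linarith
    next
      case False
      then show ?thesis using xs_small[of t] t R R0 by (simp add: abs_le_iff)
    qed
    show "xs t \<le> R0 / 2" if "\<bar>t\<bar> \<le> D" for t by (rule xs_small[OF that])
    show "(xs has_real_derivative xs' t) (at t)" if "\<bar>t\<bar> \<le> T" for t by (rule xs_deriv[OF that])
    show "c * (t - ts) \<le> xs' t * \<rho> t \<and> xs' t * \<rho> t \<le> C * (t - ts)" if t: "ts \<le> t" "t \<le> T" for t
    proof (cases "t \<le> D")
      case True
      then have "\<bar>t\<bar> \<le> D" using t tsD by auto
      from slopes_inner(1)[OF D(3) small tsD(1) this c(4) C(3) t(1)] show ?thesis .
    next
      case False
      then show ?thesis using pos_out[of t] xs'_bound[of t] t tsD T D(1) by (intro cD) auto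
    qed
    show "c * (ts - t) \<le> - xs' t * \<rho> t \<and> - xs' t * \<rho> t \<le> C * (ts - t)" if t: "- T \<le> t" "t \<le> ts" for t
    proof (cases "- D \<le> t")
      case True
      then have "\<bar>t\<bar> \<le> D" using t tsD by auto
      from slopes_inner(2)[OF D(3) small tsD(1) this c(4) C(3) t(2)] show ?thesis .
    next
      case False
      then show ?thesis using neg_out[of t] xs'_bound[of t] t tsD T D(1) by (intro cD) auto
    qed
    show "\<exists>k. c * \<xi> * (\<xi> + xs t) \<le> k \<and> k \<le> C * \<xi> * (\<xi> + xs t) \<and> f \<xi> t = - k * (\<xi> - xs t)"
      if t: "\<bar>t\<bar> \<le> T" and \<xi>: "0 < \<xi>" "\<xi> \<le> d" "\<bar>\<xi> - xs t\<bar> \<le> R" for \<xi> t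
    proof (cases "\<bar>t\<bar> \<le> D")
      case True
      have "\<xi> \<le> R0" "xs t \<le> R0" using xs_small[OF True] \<xi> R R0 by linarith+
      then show ?thesis by (intro chord_inner_region[OF True D(2) \<xi>(1) _ _ R0d \<eta>(4,3) c(6) C(5)])
    next
      case False
      then show ?thesis using c(1)
        by (intro chord_outer_region[OF _ t D(1) \<xi> R(3,4) _ c(7) C(6)]) auto
    qed
    show "\<bar>f \<xi> t - \<xi> * (a0 + a1 * t\<^sup>2 - b * \<xi>\<^sup>2)\<bar> \<le> \<eta> * \<xi> * (t\<^sup>2 + \<xi>\<^sup>2)"
      if "\<bar>t\<bar> \<le> D" "0 < \<xi>" "\<xi> \<le> R0" for \<xi> t
      by (rule normal_form_f(1)[OF that(1) D(2) that(2,3) less_imp_le[OF R0d] \<eta>(4)])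
    show "\<bar>fx \<xi> t - (a0 + a1 * t\<^sup>2 - 3 * b * \<xi>\<^sup>2)\<bar> \<le> \<eta> * (t\<^sup>2 + \<xi>\<^sup>2)"
      if "\<bar>t\<bar> \<le> D" "0 < \<xi>" "\<xi> \<le> R0" for \<xi> t
      by (rule normal_form_f(2)[OF that(1) D(2) that(2,3) less_imp_le[OF R0d] \<eta>(4)])
    show "c \<le> - fx \<xi> t \<and> - fx \<xi> t \<le> C"
      if "D \<le> \<bar>t\<bar>" "\<bar>t\<bar> \<le> T" "0 < \<xi>" "\<xi> \<le> d" "\<bar>\<xi> - xs t\<bar> \<le> R" for \<xi> t
      using outer_slope_bounds[OF that(1,2) D(1) that(3,4,5) R(3)] c C by linarith
    show "(x has_real_derivative f (x t) t / \<epsilon>) (at t within {- T..T})" if "\<bar>t\<bar> \<le> T" for t by (rule sol[OF that])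
    show "c * \<epsilon> \<le> x (- T) - xs (- T)" "x (- T) - xs (- T) \<le> C * \<epsilon>" by (rule ini)+
  qed
qed

end

section \<open>Asymptotic relations as the parameter tends to zero\<close>

lemma inner_scale_facts:
  assumes "0 < \<epsilon>" "0 < a0"
  shows "0 < inner_scale a0 \<epsilon>"
    and "min (\<epsilon> / a0) (\<epsilon> powr (1/3)) = \<epsilon> / (inner_scale a0 \<epsilon>)\<^sup>2"
    and "max (t\<^sup>2) (max a0 (\<epsilon> powr (2/3))) = (max (inner_scale a0 \<epsilon>) \<bar>t\<bar>)\<^sup>2"
    and "\<epsilon> powr (2/3) \<le> a0 \<Longrightarrow> inner_scale a0 \<epsilon> = sqrt a0"
    and "a0 \<le> \<epsilon> powr (2/3) \<Longrightarrow> inner_scale a0 \<epsilon> = \<epsilon> powr (1/3)"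
proof -
  define e where "e = \<epsilon> powr (1/3)"
  have e: "0 < e" "e ^ 3 = \<epsilon>" "\<epsilon> powr (2/3) = e\<^sup>2"
    using assms by (simp_all add: e_def powr_realpow[symmetric] powr_powr)
  have s: "0 < sqrt a0" "(sqrt a0)\<^sup>2 = a0" using assms by auto
  show mu: "0 < inner_scale a0 \<epsilon>" using s by (simp add: inner_scale_def less_max_iff_disj)
  have le: "e\<^sup>2 \<le> a0 \<longleftrightarrow> e \<le> sqrt a0" "a0 \<le> e\<^sup>2 \<longleftrightarrow> sqrt a0 \<le> e"
    using s e power_mono_iff[of e "sqrt a0" 2] power_mono_iff[of "sqrt a0" e 2] by simp_all
  show "\<epsilon> powr (2/3) \<le> a0 \<Longrightarrow> inner_scale a0 \<epsilon> = sqrt a0"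
    using le by (simp add: e inner_scale_def e_def[symmetric])
  show "a0 \<le> \<epsilon> powr (2/3) \<Longrightarrow> inner_scale a0 \<epsilon> = \<epsilon> powr (1/3)"
    using le by (simp add: e inner_scale_def e_def[symmetric])
  have mu2: "(inner_scale a0 \<epsilon>)\<^sup>2 = max a0 (e\<^sup>2)"
    using le s by (auto simp: inner_scale_def e_def[symmetric] max_def)
  show "max (t\<^sup>2) (max a0 (\<epsilon> powr (2/3))) = (max (inner_scale a0 \<epsilon>) \<bar>t\<bar>)\<^sup>2"
  proof -
    have "(max v \<bar>t\<bar>)\<^sup>2 = max (v\<^sup>2) (t\<^sup>2)" if "0 < v" for v
    proof (cases "v \<le> \<bar>t\<bar>")
      case True
      then have "v\<^sup>2 \<le> \<bar>t\<bar>\<^sup>2" using that by (intro power_mono) auto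
      then show ?thesis using True by (simp add: max_absorb2)
    next
      case False
      then have "\<bar>t\<bar>\<^sup>2 \<le> v\<^sup>2" by (intro power_mono) auto
      then show ?thesis using False by (simp add: max_absorb1)
    qed
    from this[OF mu] show ?thesis unfolding mu2 e(3) by (simp add: max.commute)
  qed
  have e_eq: "\<epsilon> / e\<^sup>2 = e" using e(1) by (simp add: e(2)[symmetric] power3_eq_cube power2_eq_square)
  show "min (\<epsilon> / a0) (\<epsilon> powr (1/3)) = \<epsilon> / (inner_scale a0 \<epsilon>)\<^sup>2"
  proof (cases "e\<^sup>2 \<le> a0")
    case True
    then have "\<epsilon> / a0 \<le> \<epsilon> / e\<^sup>2" using e assms by (intro divide_left_mono) auto
    then show ?thesis using True e_eq unfolding mu2 e_def[symmetric] by (simp add: max_absorb1 min_absorb1)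
  next
    case False
    then have "\<epsilon> / e\<^sup>2 \<le> \<epsilon> / a0" using e assms by (intro divide_left_mono) auto
    then show ?thesis using False e_eq unfolding mu2 e_def[symmetric] by (simp add: max_absorb2 min_absorb2)
  qed
qed

lemma snapshots_of_setting:
  assumes setting: "symmetric_setting d T a1 f3 a0 F xstar tstar"
  obtains K l u \<delta>0 where
    "\<forall>\<^sub>F \<epsilon> in at_right 0. symmetric_snapshot d K (F (a0 \<epsilon>)) T a1 f3 (a0 \<epsilon>) l u \<delta>0 (tstar \<epsilon>) (xstar \<epsilon>)"
    "1 \<le> K" "0 < l" "l \<le> 1" "1 \<le> u" "0 < \<delta>0"
proof -
  interpret symmetric_setting d T a1 f3 a0 F xstar tstar by (rule setting)
  obtain Ks where Ks: "\<forall>\<^sub>F \<epsilon> in at_right 0. Ck_bounded 4 d Ks (F (a0 \<epsilon>))" using smooth by blast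
  obtain Ka \<delta>0 where \<delta>0: "0 < \<delta>0" and Ka: "\<forall>\<^sub>F \<epsilon> in at_right 0. \<forall>t. \<bar>t\<bar> < \<delta>0 \<longrightarrow>
      \<bar>pdx d (F (a0 \<epsilon>)) 0 t - (a0 \<epsilon> + a1 * t\<^sup>2)\<bar> \<le> Ka * \<bar>t\<bar> ^ 3" using a_expansion by blast
  define K where "K = max 1 (max Ks Ka)"
  have K: "1 \<le> K" "Ks \<le> K" "Ka \<le> K" by (auto simp: K_def)
  obtain x1 x2 where x12: "0 < x1" "0 < x2" and xin: "\<forall>\<^sub>F \<epsilon> in at_right 0. \<forall>t\<in>{t. \<bar>t\<bar> \<le> sqrt (a0 \<epsilon>)}.
      x1 * sqrt (a0 \<epsilon>) \<le> xstar \<epsilon> t \<and> xstar \<epsilon> t \<le> x2 * sqrt (a0 \<epsilon>)"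
    using xstar_inner unfolding comparable_on_def by blast
  obtain x3 x4 where x34: "0 < x3" "0 < x4" and xmid: "\<forall>\<^sub>F \<epsilon> in at_right 0. \<forall>t\<in>{t. sqrt (a0 \<epsilon>) \<le> \<bar>t\<bar> \<and> \<bar>t\<bar> \<le> T}.
      x3 * \<bar>t\<bar> \<le> xstar \<epsilon> t \<and> xstar \<epsilon> t \<le> x4 * \<bar>t\<bar>"
    using xstar_middle unfolding comparable_on_def by blast
  obtain y1 y2 where y12: "0 < y1" "0 < y2" and yin: "\<forall>\<^sub>F \<epsilon> in at_right 0. \<forall>t\<in>{t. \<bar>t\<bar> \<le> sqrt (a0 \<epsilon>)}.
      y1 * a0 \<epsilon> \<le> pdx d (F (a0 \<epsilon>)) 0 t \<and> pdx d (F (a0 \<epsilon>)) 0 t \<le> y2 * a0 \<epsilon>"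
    using a_inner unfolding comparable_on_def by blast
  obtain y3 y4 where y34: "0 < y3" "0 < y4" and ymid: "\<forall>\<^sub>F \<epsilon> in at_right 0. \<forall>t\<in>{t. sqrt (a0 \<epsilon>) \<le> \<bar>t\<bar> \<and> \<bar>t\<bar> \<le> T}.
      y3 * t\<^sup>2 \<le> pdx d (F (a0 \<epsilon>)) 0 t \<and> pdx d (F (a0 \<epsilon>)) 0 t \<le> y4 * t\<^sup>2"
    using a_middle unfolding comparable_on_def by blast
  obtain z1 z2 where z12: "0 < z1" "0 < z2" and zall: "\<forall>\<^sub>F \<epsilon> in at_right 0. \<forall>t\<in>UNIV.
      z1 * pdx d (F (a0 \<epsilon>)) 0 t \<le> - pdx d (F (a0 \<epsilon>)) (xstar \<epsilon> t) t
      \<and> - pdx d (F (a0 \<epsilon>)) (xstar \<epsilon> t) t \<le> z2 * pdx d (F (a0 \<epsilon>)) 0 t"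
    using astar_comparable unfolding comparable_on_def by blast
  define l where "l = min 1 (min (min x1 x3) (z1 * min y1 y3))"
  define u where "u = max 1 (max (max x2 x4) (z2 * max y2 y4))"
  have l: "0 < l" "l \<le> 1" "l \<le> x1" "l \<le> x3" "l \<le> z1 * min y1 y3"
    using x12 x34 y12 y34 z12 by (simp_all add: l_def)
  have u: "1 \<le> u" "x2 \<le> u" "x4 \<le> u" "z2 * max y2 y4 \<le> u"
    by (simp_all add: u_def)
  have a0_le: "\<forall>\<^sub>F \<epsilon> in at_right 0. a0 \<epsilon> < 1" using order_tendstoD(2)[OF a0_tendsto, of 1] by simp
  have crit: "\<forall>\<^sub>F \<epsilon> in at_right 0. tstar \<epsilon> \<in> {-T..T} \<and>
        (\<forall>t\<in>{-T..T}. deriv (xstar \<epsilon>) t = 0 \<longleftrightarrow> t = tstar \<epsilon>)"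
    using xstar_critical by (simp add: deriv_vanishes_once_def)
  have "\<forall>\<^sub>F \<epsilon> in at_right 0. symmetric_snapshot d K (F (a0 \<epsilon>)) T a1 f3 (a0 \<epsilon>) l u \<delta>0 (tstar \<epsilon>) (xstar \<epsilon>)"
    using Ks Ka xin xmid yin ymid zall a0_le crit a0_pos odd_x xstar_cont xstar_range zeros astar_neg third_derivative
  proof eventually_elim
    case (elim \<epsilon>)
    have w: "\<bar>t\<bar> \<le> sqrt (a0 \<epsilon>) \<Longrightarrow> width (a0 \<epsilon>) t = sqrt (a0 \<epsilon>)" "sqrt (a0 \<epsilon>) \<le> \<bar>t\<bar> \<Longrightarrow> width (a0 \<epsilon>) t = \<bar>t\<bar>" for t
      by (simp_all add: width_def)
    have slope: "min y1 y3 * (width (a0 \<epsilon>) t)\<^sup>2 \<le> pdx d (F (a0 \<epsilon>)) 0 t \<and>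
       pdx d (F (a0 \<epsilon>)) 0 t \<le> max y2 y4 * (width (a0 \<epsilon>) t)\<^sup>2" if t: "\<bar>t\<bar> \<le> T" for t
    proof (cases "\<bar>t\<bar> \<le> sqrt (a0 \<epsilon>)")
      case True
      have w2: "(width (a0 \<epsilon>) t)\<^sup>2 = a0 \<epsilon>" using w(1)[OF True] elim(10) by simp
      have "min y1 y3 * a0 \<epsilon> \<le> y1 * a0 \<epsilon>" "y2 * a0 \<epsilon> \<le> max y2 y4 * a0 \<epsilon>" using elim(10) by (auto intro!: mult_right_mono)
      then show ?thesis using bspec[OF elim(5), of t] True unfolding w2 by simp
    next
      case False
      have w2: "(width (a0 \<epsilon>) t)\<^sup>2 = t\<^sup>2" using w(2)[of t] False by simp
      have "min y1 y3 * t\<^sup>2 \<le> y3 * t\<^sup>2" "y4 * t\<^sup>2 \<le> max y2 y4 * t\<^sup>2" by (auto intro!: mult_right_mono)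
      then show ?thesis using bspec[OF elim(6), of t] False t unfolding w2 by simp
    qed
    show ?case
    proof
      show "0 < d" by (rule d_pos)
      show "0 \<le> K" "1 \<le> K" using K by auto
      show "Ck_bounded 4 d K (F (a0 \<epsilon>))" by (rule Ck_bounded_mono[OF elim(1) K(2)])
      show "F (a0 \<epsilon>) x t = - F (a0 \<epsilon>) (- x) t" if "x \<in> {- d..d}" for x t using elim(11) that by blast
      show "0 < T" "T < 1 / 2" "0 < a1" "f3 < 0" by (rule T_range a1_pos f3_neg)+
      show "0 < a0 \<epsilon>" "a0 \<epsilon> \<le> 1" using elim(8,10) by auto
      show "0 < l" "l \<le> 1" "1 \<le> u" "0 < \<delta>0" using l u \<delta>0 by auto
      show "continuous_on UNIV (xstar \<epsilon>)" by (rule elim(12))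
      show "0 < xstar \<epsilon> t \<and> xstar \<epsilon> t \<le> d" for t using elim(13) by auto
      show "(F (a0 \<epsilon>) x t = 0) = (x = 0 \<or> x = xstar \<epsilon> t \<or> x = - xstar \<epsilon> t)" if "x \<in> {- d..d}" for x t
        using elim(14) that by blast
      show "pdx d (F (a0 \<epsilon>)) (xstar \<epsilon> t) t < 0" for t using elim(15) by blast
      show "pdx d (pdx d (pdx d (F (a0 \<epsilon>)))) 0 0 = f3" by (rule elim(16))
      show "\<bar>pdx d (F (a0 \<epsilon>)) 0 t - (a0 \<epsilon> + a1 * t\<^sup>2)\<bar> \<le> K * \<bar>t\<bar> ^ 3" if "\<bar>t\<bar> < \<delta>0" for t
      proof -
        have "Ka * \<bar>t\<bar> ^ 3 \<le> K * \<bar>t\<bar> ^ 3" using K by (intro mult_right_mono) auto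
        then show ?thesis using elim(2)[rule_format, OF that] by linarith
      qed
      show "l * width (a0 \<epsilon>) t \<le> xstar \<epsilon> t \<and> xstar \<epsilon> t \<le> u * width (a0 \<epsilon>) t" if t: "\<bar>t\<bar> \<le> T" for t
      proof (cases "\<bar>t\<bar> \<le> sqrt (a0 \<epsilon>)")
        case True
        have "l * sqrt (a0 \<epsilon>) \<le> x1 * sqrt (a0 \<epsilon>)" "x2 * sqrt (a0 \<epsilon>) \<le> u * sqrt (a0 \<epsilon>)"
          using l u elim(10) by (auto intro!: mult_right_mono)
        then show ?thesis using bspec[OF elim(3), of t] True unfolding w(1)[OF True] by simp
      next
        case False
        then have le: "sqrt (a0 \<epsilon>) \<le> \<bar>t\<bar>" by simp
        have "l * \<bar>t\<bar> \<le> x3 * \<bar>t\<bar>" "x4 * \<bar>t\<bar> \<le> u * \<bar>t\<bar>" using l u by (auto intro!: mult_right_mono)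
        then show ?thesis using bspec[OF elim(4), of t] le t unfolding w(2)[OF le] by simp
      qed
      show "l * (width (a0 \<epsilon>) t)\<^sup>2 \<le> - pdx d (F (a0 \<epsilon>)) (xstar \<epsilon> t) t \<and>
          - pdx d (F (a0 \<epsilon>)) (xstar \<epsilon> t) t \<le> u * (width (a0 \<epsilon>) t)\<^sup>2" if t: "\<bar>t\<bar> \<le> T" for t
      proof -
        have z: "z1 * pdx d (F (a0 \<epsilon>)) 0 t \<le> - pdx d (F (a0 \<epsilon>)) (xstar \<epsilon> t) t"
          "- pdx d (F (a0 \<epsilon>)) (xstar \<epsilon> t) t \<le> z2 * pdx d (F (a0 \<epsilon>)) 0 t" using elim(7) by auto
        have "l * (width (a0 \<epsilon>) t)\<^sup>2 \<le> z1 * min y1 y3 * (width (a0 \<epsilon>) t)\<^sup>2" using l by (intro mult_right_mono) auto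
        also have "\<dots> \<le> z1 * pdx d (F (a0 \<epsilon>)) 0 t" unfolding mult.assoc using slope[OF t] z12 by (intro mult_left_mono) auto
        finally have 1: "l * (width (a0 \<epsilon>) t)\<^sup>2 \<le> - pdx d (F (a0 \<epsilon>)) (xstar \<epsilon> t) t" using z by linarith
        have "z2 * pdx d (F (a0 \<epsilon>)) 0 t \<le> z2 * (max y2 y4 * (width (a0 \<epsilon>) t)\<^sup>2)" using slope[OF t] z12 by (intro mult_left_mono) auto
        also have "\<dots> \<le> u * (width (a0 \<epsilon>) t)\<^sup>2" unfolding mult.assoc[symmetric] using u by (intro mult_right_mono) auto
        finally show ?thesis using 1 z by linarith
      qed
      show "\<bar>tstar \<epsilon>\<bar> \<le> T" using elim(9) by auto
      show "(deriv (xstar \<epsilon>) t = 0) = (t = tstar \<epsilon>)" if "\<bar>t\<bar> \<le> T" for t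
        using elim(9) that by (auto simp: abs_le_iff)
    qed
  qed
  then show ?thesis using that K l u \<delta>0 by blast
qed

lemma inner_scale_tendsto:
  assumes "(a0 \<longlongrightarrow> 0) (at_right 0)"
  shows "((\<lambda>\<epsilon>. inner_scale (a0 \<epsilon>) \<epsilon>) \<longlongrightarrow> 0) (at_right 0)"
proof -
  have "((\<lambda>\<epsilon>::real. \<epsilon> powr (1/3)) \<longlongrightarrow> 0 powr (1/3)) (at_right 0)"
    by (rule tendsto_powr2) (auto intro: eventually_at_right_less simp: eventually_at_filter intro!: always_eventually)
  moreover have "((\<lambda>\<epsilon>. sqrt (a0 \<epsilon>)) \<longlongrightarrow> sqrt 0) (at_right 0)"
    by (rule tendsto_real_sqrt[OF assms])
  ultimately have "((\<lambda>\<epsilon>. max (sqrt (a0 \<epsilon>)) (\<epsilon> powr (1/3))) \<longlongrightarrow> max (sqrt 0) (0 powr (1/3))) (at_right 0)"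
    by (intro tendsto_max)
  then show ?thesis by (simp add: inner_scale_def)
qed

text \<open>The constants are chosen in the order \<open>\<eta>\<close>, \<open>R0\<close>, \<open>D\<close>, \<open>\<kappa>\<close>, \<open>R\<close> and then \<open>c\<close>,
  \<open>C\<close>: the tolerance of the normal form first, then the neighbourhood of the origin in which
  it holds, then the slope bound \<open>\<kappa>\<close> that the critical point hypothesis gives outside this
  neighbourhood, and last the width \<open>R\<close> of the tube around \<open>xs\<close>.\<close>

lemma profiles_of_setting:
  assumes setting: "symmetric_setting d T a1 f3 a0 F xstar tstar"
    and solution: "\<forall>\<^sub>F \<epsilon> in at_right 0. \<forall>t\<in>{-T..T}.
      (xdet \<epsilon> has_real_derivative F (a0 \<epsilon>) (xdet \<epsilon> t) t / \<epsilon>) (at t within {-T..T})"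
    and initial: "comparable_on (\<lambda>\<epsilon>. {-T}) (\<lambda>\<epsilon> t. xdet \<epsilon> t - xstar \<epsilon> t) (\<lambda>\<epsilon> t. \<epsilon>)"
  obtains k K N where "0 < k" "0 < K" "1 \<le> N"
    "\<forall>\<^sub>F \<epsilon> in at_right 0. passage_profile T k K N \<epsilon> (a0 \<epsilon>) (tstar \<epsilon>) (pdx d (F (a0 \<epsilon>))) (xstar \<epsilon>) (xdet \<epsilon>)"
proof -
  interpret symmetric_setting d T a1 f3 a0 F xstar tstar by (rule setting)
  obtain K l u \<delta>0 where
    snap: "\<forall>\<^sub>F \<epsilon> in at_right 0. symmetric_snapshot d K (F (a0 \<epsilon>)) T a1 f3 (a0 \<epsilon>) l u \<delta>0 (tstar \<epsilon>) (xstar \<epsilon>)"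
    and K: "1 \<le> K" and l: "0 < l" "l \<le> 1" and u: "1 \<le> u" and \<delta>0: "0 < \<delta>0"
    by (rule snapshots_of_setting[OF setting])
  obtain i1 i2 where i: "0 < i1" "0 < i2" and ini: "\<forall>\<^sub>F \<epsilon> in at_right 0. \<forall>t\<in>{-T}.
      i1 * \<epsilon> \<le> xdet \<epsilon> t - xstar \<epsilon> t \<and> xdet \<epsilon> t - xstar \<epsilon> t \<le> i2 * \<epsilon>"
    using initial unfolding comparable_on_def by blast
  define b where "b = - f3 / 6"
  define V where "V = K * (1 + u\<^sup>2) * u / l"
  have b0: "0 < b" using f3_neg by (simp add: b_def)
  have V0: "0 \<le> V" using K u l by (simp add: V_def)
  \<comment> \<open>\<open>W\<close> bounds the factor of \<open>\<eta>\<close> in the smallness condition for the linearization,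
    as \<open>\<eta> \<le> b\<close> and \<open>2 \<eta> \<le> a1\<close>\<close>
  define W where "W = 4 + 24 * b / a1"
  have W0: "0 < W" using b0 a1_pos by (simp add: W_def add_pos_pos)
  define \<eta> where "\<eta> = min (a1 / 2) (min (b / 2) (b / (40 * W)))"
  have \<eta>: "0 < \<eta>" "\<eta> \<le> a1 / 2" "\<eta> \<le> b / 2" "\<eta> * W \<le> b / 40"
  proof -
    show "0 < \<eta>" using b0 a1_pos W0 by (simp add: \<eta>_def)
    show "\<eta> \<le> a1 / 2" unfolding \<eta>_def by (rule min.cobounded1)
    show "\<eta> \<le> b / 2" unfolding \<eta>_def by (rule min.coboundedI2[OF min.cobounded1])
    have "\<eta> \<le> b / (40 * W)" unfolding \<eta>_def by (rule min.coboundedI2[OF min.cobounded2])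
    then have "\<eta> * W \<le> b / (40 * W) * W" using W0 by (intro mult_right_mono) auto
    then show "\<eta> * W \<le> b / 40" using W0 by simp
  qed
  have \<eta>a: "\<eta> < a1" using \<eta> a1_pos by linarith
  have eta: "\<eta> * (4 + 6 * (b + \<eta>) / (a1 - \<eta>)) \<le> (b + \<eta>) / 40"
  proof -
    have "6 * (b + \<eta>) / (a1 - \<eta>) \<le> 6 * (2 * b) / (a1 / 2)"
      using \<eta> b0 a1_pos by (intro frac_le) auto
    also have "\<dots> = 24 * b / a1" by simp
    finally have "4 + 6 * (b + \<eta>) / (a1 - \<eta>) \<le> W" by (simp add: W_def)
    then have "\<eta> * (4 + 6 * (b + \<eta>) / (a1 - \<eta>)) \<le> \<eta> * W" using \<eta> by (intro mult_left_mono) auto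
    also have "\<dots> \<le> b / 40" by (rule \<eta>(4))
    also have "\<dots> \<le> (b + \<eta>) / 40" using \<eta> by (intro divide_right_mono) auto
    finally show ?thesis .
  qed
  define R0 where "R0 = min (d / 2) (min (\<eta> / (2 * K)) (a1 / (K * (2 + 2 * V))))"
  have R0: "0 < R0" "2 * R0 \<le> d" "K * (2 * R0) \<le> \<eta>" "K * (R0 * (2 + 2 * V)) \<le> a1"
  proof -
    have KV: "0 < K" "0 < K * (2 + 2 * V)" using K V0 by (auto intro!: mult_pos_pos)
    show "0 < R0" using d_pos \<eta> a1_pos KV by (simp add: R0_def)
    have "R0 \<le> d / 2" unfolding R0_def by (rule min.cobounded1)
    then show "2 * R0 \<le> d" by simp
    have "R0 \<le> \<eta> / (2 * K)" unfolding R0_def by (rule min.coboundedI2[OF min.cobounded1])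
    then show "K * (2 * R0) \<le> \<eta>" using KV by (simp add: pos_le_divide_eq mult_ac)
    have "R0 \<le> a1 / (K * (2 + 2 * V))" unfolding R0_def by (rule min.coboundedI2[OF min.cobounded2])
    then have "R0 * (K * (2 + 2 * V)) \<le> a1" using KV(2) by (simp only: pos_le_divide_eq)
    then show "K * (R0 * (2 + 2 * V)) \<le> a1" by (simp only: mult_ac)
  qed
  define D where "D = min (\<delta>0 / 2) (min T (min (R0 / (2 * u)) (R0 * sqrt (b / (2 * a1)))))"
  have D: "0 < D" "D < \<delta>0" "D \<le> T" "2 * u * D \<le> R0" "D \<le> R0" "2 * a1 * D\<^sup>2 \<le> b * R0\<^sup>2"
  proof -
    show D0: "0 < D" using \<delta>0 T_range R0 u b0 a1_pos by (simp add: D_def)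
    have "D \<le> \<delta>0 / 2" unfolding D_def by (rule min.cobounded1)
    then show "D < \<delta>0" using \<delta>0 by linarith
    show "D \<le> T" unfolding D_def by (rule min.coboundedI2[OF min.cobounded1])
    have "D \<le> R0 / (2 * u)" unfolding D_def by (rule min.coboundedI2[OF min.coboundedI2[OF min.cobounded1]])
    then show uD: "2 * u * D \<le> R0" using u by (simp add: pos_le_divide_eq mult_ac)
    have "1 * D \<le> 2 * u * D" using u D0 by (intro mult_right_mono) auto
    then show "D \<le> R0" using uD by linarith
    have "D \<le> R0 * sqrt (b / (2 * a1))" unfolding D_def by (rule min.coboundedI2[OF min.coboundedI2[OF min.cobounded2]])
    then have "D\<^sup>2 \<le> (R0 * sqrt (b / (2 * a1)))\<^sup>2" using D0 by (intro power_mono) auto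
    also have "\<dots> = R0\<^sup>2 * (b / (2 * a1))" using b0 a1_pos by (simp add: power_mult_distrib)
    finally have "2 * a1 * D\<^sup>2 \<le> 2 * a1 * (R0\<^sup>2 * (b / (2 * a1)))" using a1_pos by (intro mult_left_mono) auto
    then show "2 * a1 * D\<^sup>2 \<le> b * R0\<^sup>2" using a1_pos by (simp add: mult_ac)
  qed
  have KR0: "K * (R0 + D) \<le> \<eta>"
  proof -
    have "K * (R0 + D) \<le> K * (2 * R0)" using D K by (intro mult_left_mono) auto
    then show ?thesis using R0 by linarith
  qed
  have KV: "K * (D + R0 * (1 + 2 * V)) \<le> a1"
  proof -
    have "D + R0 * (1 + 2 * V) \<le> R0 * (2 + 2 * V)" using D by (simp add: algebra_simps)
    then have "K * (D + R0 * (1 + 2 * V)) \<le> K * (R0 * (2 + 2 * V))" using K by (intro mult_left_mono) auto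
    then show ?thesis using R0 by linarith
  qed
  have room: "2 * (a1 - \<eta>) * D\<^sup>2 \<le> (b + \<eta>) * R0\<^sup>2"
  proof -
    have "2 * (a1 - \<eta>) * D\<^sup>2 \<le> 2 * a1 * D\<^sup>2" "b * R0\<^sup>2 \<le> (b + \<eta>) * R0\<^sup>2"
      using \<eta> by (auto intro!: mult_right_mono)
    then show ?thesis using D by linarith
  qed
  obtain \<kappa> where \<kappa>: "0 < \<kappa>" and crit: "\<forall>\<^sub>F \<epsilon> in at_right 0. \<forall>t\<in>{-T..T}.
      D / 2 \<le> \<bar>t - tstar \<epsilon>\<bar> \<longrightarrow> \<kappa> \<le> \<bar>deriv (xstar \<epsilon>) t\<bar>"
    using xstar_critical D(1) unfolding deriv_vanishes_once_def by (meson half_gt_zero)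
  define SR where "SR = {R0 / 2, l * D\<^sup>2 / 2 / K, l * D / 2, (l * T\<^sup>2 * \<kappa>)\<^sup>2 / (4 * K\<^sup>2)}"
  define R where "R = Min SR"
  have R: "0 < R" "2 * R \<le> R0" "K * R \<le> l * D\<^sup>2 / 2" "R \<le> l * D / 2" "R \<le> (l * T\<^sup>2 * \<kappa>)\<^sup>2 / (4 * K\<^sup>2)"
  proof -
    have fin: "finite SR" "SR \<noteq> {}" by (auto simp: SR_def)
    have "\<forall>y\<in>SR. 0 < y" using R0 l D K T_range \<kappa> by (auto simp: SR_def)
    then show "0 < R" unfolding R_def using fin by simp
    have le: "R \<le> y" if "y \<in> SR" for y unfolding R_def by (rule Min_le[OF fin(1) that])
    have "R \<le> R0 / 2" by (rule le) (simp add: SR_def)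
    then show "2 * R \<le> R0" by simp
    have "R \<le> l * D\<^sup>2 / 2 / K" by (rule le) (simp add: SR_def)
    then have "R * K \<le> l * D\<^sup>2 / 2" using K by (subst (asm) pos_le_divide_eq) auto
    then show "K * R \<le> l * D\<^sup>2 / 2" by (simp only: mult.commute)
    show "R \<le> l * D / 2" "R \<le> (l * T\<^sup>2 * \<kappa>)\<^sup>2 / (4 * K\<^sup>2)" by (rule le, simp add: SR_def)+
  qed
  define Sc where "Sc = {1, l, a1 * (l / u), \<kappa> * D, b / 2, l * D\<^sup>2 / 2 / (2 * d\<^sup>2), l * D\<^sup>2 / 2, i1}"
  define c where "c = Min Sc"
  have c: "0 < c" "c \<le> 1" "c \<le> l" "c \<le> a1 * (l / u)" "c \<le> \<kappa> * D" "c \<le> b / 2" "c * (2 * d\<^sup>2) \<le> l * D\<^sup>2 / 2"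
      "c \<le> l * D\<^sup>2 / 2" "c \<le> i1"
  proof -
    have fin: "finite Sc" "Sc \<noteq> {}" by (auto simp: Sc_def)
    have "\<forall>y\<in>Sc. 0 < y" using l u D a1_pos \<kappa> b0 d_pos i by (auto simp: Sc_def)
    then show "0 < c" unfolding c_def using fin by simp
    have le: "c \<le> y" if "y \<in> Sc" for y unfolding c_def by (rule Min_le[OF fin(1) that])
    show "c \<le> 1" "c \<le> l" "c \<le> a1 * (l / u)" "c \<le> \<kappa> * D" "c \<le> b / 2" "c \<le> l * D\<^sup>2 / 2" "c \<le> i1"
      by (rule le, simp add: Sc_def)+
    have "c \<le> l * D\<^sup>2 / 2 / (2 * d\<^sup>2)" by (rule le) (simp add: Sc_def)
    then show "c * (2 * d\<^sup>2) \<le> l * D\<^sup>2 / 2" using d_pos by (subst (asm) pos_le_divide_eq) auto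
  qed
  define SC where "SC = {1, 2 * u, 3 * a1 * (u / l), V / (D / 2), 2 * b, 2 * u / (l\<^sup>2 * D\<^sup>2 / 2), i2}"
  define C where "C = Max SC"
  have C: "1 \<le> C" "2 * u \<le> C" "3 * a1 * (u / l) \<le> C" "V \<le> C * (D / 2)" "2 * b \<le> C" "2 * u \<le> C * (l\<^sup>2 * D\<^sup>2 / 2)" "i2 \<le> C"
  proof -
    have fin: "finite SC" by (auto simp: SC_def)
    have le: "y \<le> C" if "y \<in> SC" for y unfolding C_def by (rule Max_ge[OF fin that])
    show "1 \<le> C" "2 * u \<le> C" "3 * a1 * (u / l) \<le> C" "2 * b \<le> C" "i2 \<le> C" by (rule le, simp add: SC_def)+
    have "V / (D / 2) \<le> C" by (rule le) (simp add: SC_def)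
    then show "V \<le> C * (D / 2)" using D by (subst (asm) pos_divide_le_eq) auto
    have "2 * u / (l\<^sup>2 * D\<^sup>2 / 2) \<le> C" by (rule le) (simp add: SC_def)
    then show "2 * u \<le> C * (l\<^sup>2 * D\<^sup>2 / 2)" using D l by (subst (asm) pos_divide_le_eq) auto
  qed
  have sqrt_lim: "((\<lambda>\<epsilon>. sqrt (a0 \<epsilon>)) \<longlongrightarrow> 0) (at_right 0)" using tendsto_real_sqrt[OF a0_tendsto] by simp
  have small1: "\<forall>\<^sub>F \<epsilon> in at_right 0. sqrt (a0 \<epsilon>) < D" using order_tendstoD(2)[OF sqrt_lim D(1)] .
  have Ku: "0 < 2 * K * u\<^sup>2" using K u by simp
  have small2: "\<forall>\<^sub>F \<epsilon> in at_right 0. sqrt (a0 \<epsilon>) < a1 / (2 * K * u\<^sup>2)"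
    by (rule order_tendstoD(2)[OF sqrt_lim]) (use Ku a1_pos in simp)
  have pos: "\<forall>\<^sub>F \<epsilon> in at_right 0. 0 < (\<epsilon>::real)" by (rule eventually_at_right_less)
  have sp: "\<forall>\<^sub>F \<epsilon> in at_right 0. slow_passage T d D R R0 c C b a1 \<eta> \<epsilon> (a0 \<epsilon>) (tstar \<epsilon>)
     (F (a0 \<epsilon>)) (pdx d (F (a0 \<epsilon>))) (xstar \<epsilon>) (symmetric_snapshot.xs' d (F (a0 \<epsilon>)) (xstar \<epsilon>)) (xdet \<epsilon>)"
    using snap crit small1 small2 pos solution ini
  proof eventually_elim
    case (elim \<epsilon>)
    interpret S: symmetric_snapshot d K "F (a0 \<epsilon>)" T a1 f3 "a0 \<epsilon>" l u \<delta>0 "tstar \<epsilon>" "xstar \<epsilon>" by (rule elim(1))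
    have bV: "S.b = b" "S.V = V" by (simp_all add: S.b_def b_def S.V_def V_def)
    have a0_small: "2 * K * u\<^sup>2 * sqrt (a0 \<epsilon>) \<le> a1"
      using elim(4) Ku by (simp add: pos_less_divide_eq mult.commute)
    have ini': "c * \<epsilon> \<le> xdet \<epsilon> (- T) - xstar \<epsilon> (- T)" "xdet \<epsilon> (- T) - xstar \<epsilon> (- T) \<le> C * \<epsilon>"
    proof -
      have "c * \<epsilon> \<le> i1 * \<epsilon>" "i2 * \<epsilon> \<le> C * \<epsilon>" using c C elim(5) by (auto intro!: mult_right_mono)
      then show "c * \<epsilon> \<le> xdet \<epsilon> (- T) - xstar \<epsilon> (- T)" "xdet \<epsilon> (- T) - xstar \<epsilon> (- T) \<le> C * \<epsilon>"
        using elim(7) by auto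
    qed
    have sol: "(xdet \<epsilon> has_real_derivative F (a0 \<epsilon>) (xdet \<epsilon> t) t / \<epsilon>) (at t within {- T..T})" if "\<bar>t\<bar> \<le> T" for t
      using elim(6) that by (auto simp: abs_le_iff)
    have crit': "\<kappa> \<le> \<bar>deriv (xstar \<epsilon>) t\<bar>" if "\<bar>t\<bar> \<le> T" "D / 2 \<le> \<bar>t - tstar \<epsilon>\<bar>" for t
      using elim(2) that by (auto simp: abs_le_iff)
    show ?case
      by (rule S.slow_passage_of_snapshot[unfolded bV, OF \<eta>(1) \<eta>a \<eta>(3) KR0 R0(1,2) D(1-4) KV \<kappa> crit' R a0_small
            less_imp_le[OF elim(3)] c(1-8) C(1-6) elim(5) sol ini'])
  qed
  obtain k K' N \<nu> where kKN: "0 < k" "0 < K'" "1 \<le> N" "0 < \<nu>" and prof: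
    "\<And>\<epsilon> a0 ts f fx xs xs' x.
       slow_passage T d D R R0 c C b a1 \<eta> \<epsilon> a0 ts f fx xs xs' x \<Longrightarrow> inner_scale a0 \<epsilon> \<le> \<nu> \<Longrightarrow>
       passage_profile T k K' N \<epsilon> a0 ts fx xs x"
    using slow_passage_asymptotics[OF c(1,2) C(1) D(1,3) T_range(2) R(1,2) b0 \<eta>(1) \<eta>a room eta] by blast
  have "\<forall>\<^sub>F \<epsilon> in at_right 0. inner_scale (a0 \<epsilon>) \<epsilon> < \<nu>"
    by (rule order_tendstoD(2)[OF inner_scale_tendsto[OF a0_tendsto] kKN(4)])
  then have "\<forall>\<^sub>F \<epsilon> in at_right 0. passage_profile T k K' N \<epsilon> (a0 \<epsilon>) (tstar \<epsilon>) (pdx d (F (a0 \<epsilon>))) (xstar \<epsilon>) (xdet \<epsilon>)"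
    using sp by eventually_elim (rule prof, auto)
  then show ?thesis using that kKN by blast
qed

theorem theorem2p1:
  fixes d T a1 f3 :: real
    and a0 :: "real \<Rightarrow> real"
    and F :: "real \<Rightarrow> real \<Rightarrow> real \<Rightarrow> real"
    and xstar :: "real \<Rightarrow> real \<Rightarrow> real"
    and tstar :: "real \<Rightarrow> real"
    and xdet :: "real \<Rightarrow> real \<Rightarrow> real"
  assumes setting: "symmetric_setting d T a1 f3 a0 F xstar tstar"
    and solution: "\<forall>\<^sub>F \<epsilon> in at_right 0. \<forall>t\<in>{-T..T}.
      (xdet \<epsilon> has_real_derivative F (a0 \<epsilon>) (xdet \<epsilon> t) t / \<epsilon>) (at t within {-T..T})"
    and initial: "comparable_on (\<lambda>\<epsilon>. {-T}) (\<lambda>\<epsilon> t. xdet \<epsilon> t - xstar \<epsilon> t) (\<lambda>\<epsilon> t. \<epsilon>)"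
  shows
    \<comment> \<open>(i)\<close>
    "(\<exists>tcross :: real \<Rightarrow> real.
        (\<forall>\<^sub>F \<epsilon> in at_right 0.
           tcross \<epsilon> \<in> {-T..T} \<and>
           xdet \<epsilon> (tcross \<epsilon>) = xstar \<epsilon> (tcross \<epsilon>) \<and>
           (\<forall>t\<in>{-T..<tcross \<epsilon>}. xstar \<epsilon> t < xdet \<epsilon> t) \<and>
           (\<forall>t\<in>{tcross \<epsilon><..T}. xdet \<epsilon> t < xstar \<epsilon> t)) \<and>
        comparable_on (\<lambda>\<epsilon>. UNIV) (\<lambda>\<epsilon> _. tcross \<epsilon> - tstar \<epsilon>)
          (\<lambda>\<epsilon> _. min (\<epsilon> / a0 \<epsilon>) (\<epsilon> powr (1/3))))
    \<and>
    (\<exists>c0>0.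
      \<comment> \<open>(ii)\<close>
      comparable_on (\<lambda>\<epsilon>. {-T..- c0 * max (sqrt (a0 \<epsilon>)) (\<epsilon> powr (1/3))})
        (\<lambda>\<epsilon> t. xdet \<epsilon> t - xstar \<epsilon> t) (\<lambda>\<epsilon> t. \<epsilon> / t\<^sup>2) \<and>
      comparable_on (\<lambda>\<epsilon>. {c0 * max (sqrt (a0 \<epsilon>)) (\<epsilon> powr (1/3))..T})
        (\<lambda>\<epsilon> t. - (xdet \<epsilon> t - xstar \<epsilon> t)) (\<lambda>\<epsilon> t. \<epsilon> / t\<^sup>2) \<and>
      comparable_on (\<lambda>\<epsilon>. {-T..- c0 * max (sqrt (a0 \<epsilon>)) (\<epsilon> powr (1/3))} \<union>
                          {c0 * max (sqrt (a0 \<epsilon>)) (\<epsilon> powr (1/3))..T})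
        xdet (\<lambda>\<epsilon> t. \<bar>t\<bar>) \<and>
      \<comment> \<open>(iii)\<close>
      comparable_on
        (\<lambda>\<epsilon>. {t. \<bar>t\<bar> \<le> c0 * max (sqrt (a0 \<epsilon>)) (\<epsilon> powr (1/3)) \<and> a0 \<epsilon> \<ge> \<epsilon> powr (2/3)})
        xdet (\<lambda>\<epsilon> t. sqrt (a0 \<epsilon>)) \<and>
      comparable_on
        (\<lambda>\<epsilon>. {t. \<bar>t\<bar> \<le> c0 * max (sqrt (a0 \<epsilon>)) (\<epsilon> powr (1/3)) \<and> a0 \<epsilon> \<le> \<epsilon> powr (2/3)})
        xdet (\<lambda>\<epsilon> t. \<epsilon> powr (1/3)))
    \<and>
    \<comment> \<open>(iv)\<close>
    comparable_on (\<lambda>\<epsilon>. {-T..T})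
      (\<lambda>\<epsilon> t. - pdx d (F (a0 \<epsilon>)) (xdet \<epsilon> t) t)
      (\<lambda>\<epsilon> t. max (t\<^sup>2) (max (a0 \<epsilon>) (\<epsilon> powr (2/3))))"
proof -
  have a0_pos: "\<forall>\<^sub>F \<epsilon> in at_right 0. 0 < a0 \<epsilon>" and a0_lim: "(a0 \<longlongrightarrow> 0) (at_right 0)" and T0: "0 < T"
    using setting by (simp_all add: symmetric_setting_def)
  obtain k K N where kK: "0 < k" "0 < K" "1 \<le> N" and prof:
    "\<forall>\<^sub>F \<epsilon> in at_right 0. passage_profile T k K N \<epsilon> (a0 \<epsilon>) (tstar \<epsilon>) (pdx d (F (a0 \<epsilon>))) (xstar \<epsilon>) (xdet \<epsilon>)"
    by (rule profiles_of_setting[OF setting solution initial])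
  define \<mu> where "\<mu> = (\<lambda>\<epsilon>. inner_scale (a0 \<epsilon>) \<epsilon>)"
  have mu: "max (sqrt (a0 \<epsilon>)) (\<epsilon> powr (1/3)) = \<mu> \<epsilon>" for \<epsilon> by (simp add: \<mu>_def inner_scale_def)
  have pos: "\<forall>\<^sub>F \<epsilon> in at_right 0. 0 < (\<epsilon>::real)" by (rule eventually_at_right_less)
  have TN: "0 < T / N" using T0 kK by simp
  have "\<forall>\<^sub>F \<epsilon> in at_right 0. \<mu> \<epsilon> < T / N"
    unfolding \<mu>_def by (rule order_tendstoD(2)[OF inner_scale_tendsto[OF a0_lim] TN])
  with prof a0_pos pos have good: "\<forall>\<^sub>F \<epsilon> in at_right 0.
      passage_profile T k K N \<epsilon> (a0 \<epsilon>) (tstar \<epsilon>) (pdx d (F (a0 \<epsilon>))) (xstar \<epsilon>) (xdet \<epsilon>)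
      \<and> 0 < a0 \<epsilon> \<and> 0 < \<epsilon> \<and> N * \<mu> \<epsilon> \<le> T \<and> 0 < \<mu> \<epsilon>"
  proof eventually_elim
    case (elim \<epsilon>)
    have "\<mu> \<epsilon> * N < T" using elim(4) kK by (simp add: pos_less_divide_eq)
    then show ?case using elim(1-3) inner_scale_facts(1)[OF elim(3,2)] by (simp add: \<mu>_def mult.commute)
  qed
  have comparable: "comparable_on I \<psi> \<phi>"
    if "0 < m" "0 < M" "\<And>\<epsilon> t. passage_profile T k K N \<epsilon> (a0 \<epsilon>) (tstar \<epsilon>) (pdx d (F (a0 \<epsilon>))) (xstar \<epsilon>) (xdet \<epsilon>)
      \<Longrightarrow> 0 < a0 \<epsilon> \<Longrightarrow> 0 < \<epsilon> \<Longrightarrow> N * \<mu> \<epsilon> \<le> T \<Longrightarrow> 0 < \<mu> \<epsilon> \<Longrightarrow> t \<in> I \<epsilon> \<Longrightarrow>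
        m * \<phi> \<epsilon> t \<le> \<psi> \<epsilon> t \<and> \<psi> \<epsilon> t \<le> M * \<phi> \<epsilon> t"
    for m M and I :: "real \<Rightarrow> real set" and \<psi> \<phi> :: "real \<Rightarrow> real \<Rightarrow> real"
  proof -
    have "\<forall>\<^sub>F \<epsilon> in at_right 0. \<forall>t\<in>I \<epsilon>. m * \<phi> \<epsilon> t \<le> \<psi> \<epsilon> t \<and> \<psi> \<epsilon> t \<le> M * \<phi> \<epsilon> t"
      using good by eventually_elim (use that(3) in blast)
    then show ?thesis unfolding comparable_on_def using that(1,2) by blast
  qed
  have N1: "\<mu> \<epsilon> \<le> N * \<mu> \<epsilon>" if "0 < \<mu> \<epsilon>" for \<epsilon> using kK that by simp
  have sandwich: "k * max (\<mu> \<epsilon>) \<bar>t\<bar> \<le> xdet \<epsilon> t \<and> xdet \<epsilon> t \<le> K * max (\<mu> \<epsilon>) \<bar>t\<bar>"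
    if "passage_profile T k K N \<epsilon> (a0 \<epsilon>) (tstar \<epsilon>) (pdx d (F (a0 \<epsilon>))) (xstar \<epsilon>) (xdet \<epsilon>)" "\<bar>t\<bar> \<le> T" for \<epsilon> t
    using that unfolding passage_profile_def \<mu>_def by blast
  have inner: "k * \<mu> \<epsilon> \<le> xdet \<epsilon> t \<and> xdet \<epsilon> t \<le> K * N * \<mu> \<epsilon>"
    if p: "passage_profile T k K N \<epsilon> (a0 \<epsilon>) (tstar \<epsilon>) (pdx d (F (a0 \<epsilon>))) (xstar \<epsilon>) (xdet \<epsilon>)"
      and m: "N * \<mu> \<epsilon> \<le> T" "0 < \<mu> \<epsilon>" and t: "\<bar>t\<bar> \<le> N * \<mu> \<epsilon>" for \<epsilon> t
  proof -
    have "k * \<mu> \<epsilon> \<le> k * max (\<mu> \<epsilon>) \<bar>t\<bar>" "K * max (\<mu> \<epsilon>) \<bar>t\<bar> \<le> K * (N * \<mu> \<epsilon>)"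
      using kK N1[OF m(2)] t by (auto intro!: mult_left_mono)
    then show ?thesis using sandwich[OF p, of t] t m by (simp add: mult.assoc)
  qed
  have part1: "\<exists>tcross :: real \<Rightarrow> real.
        (\<forall>\<^sub>F \<epsilon> in at_right 0.
           tcross \<epsilon> \<in> {-T..T} \<and>
           xdet \<epsilon> (tcross \<epsilon>) = xstar \<epsilon> (tcross \<epsilon>) \<and>
           (\<forall>t\<in>{-T..<tcross \<epsilon>}. xstar \<epsilon> t < xdet \<epsilon> t) \<and>
           (\<forall>t\<in>{tcross \<epsilon><..T}. xdet \<epsilon> t < xstar \<epsilon> t)) \<and>
        comparable_on (\<lambda>\<epsilon>. UNIV) (\<lambda>\<epsilon> _. tcross \<epsilon> - tstar \<epsilon>)
          (\<lambda>\<epsilon> _. min (\<epsilon> / a0 \<epsilon>) (\<epsilon> powr (1/3)))"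
  proof -
    define P where "P = (\<lambda>\<epsilon> tc. - T < tc \<and> tc < T \<and> xdet \<epsilon> tc = xstar \<epsilon> tc \<and>
       (\<forall>t. - T \<le> t \<and> t < tc \<longrightarrow> xstar \<epsilon> t < xdet \<epsilon> t) \<and> (\<forall>t. tc < t \<and> t \<le> T \<longrightarrow> xdet \<epsilon> t < xstar \<epsilon> t) \<and>
       k * (\<epsilon> / (\<mu> \<epsilon>)\<^sup>2) \<le> tc - tstar \<epsilon> \<and> tc - tstar \<epsilon> \<le> K * (\<epsilon> / (\<mu> \<epsilon>)\<^sup>2))"
    \<comment> \<open>the crossing time is a function of \<open>\<epsilon>\<close>; its value is arbitrary when \<open>\<epsilon>\<close> is not
      small\<close>
    define tcross where "tcross = (\<lambda>\<epsilon>. SOME tc. P \<epsilon> tc)"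
    have tc: "P \<epsilon> (tcross \<epsilon>)"
      if "passage_profile T k K N \<epsilon> (a0 \<epsilon>) (tstar \<epsilon>) (pdx d (F (a0 \<epsilon>))) (xstar \<epsilon>) (xdet \<epsilon>)" for \<epsilon>
    proof -
      have "\<exists>tc. P \<epsilon> tc" using that unfolding passage_profile_def P_def \<mu>_def by blast
      then show ?thesis unfolding tcross_def by (rule someI_ex)
    qed
    show ?thesis
    proof (intro exI[of _ tcross] conjI)
      show "\<forall>\<^sub>F \<epsilon> in at_right 0.
           tcross \<epsilon> \<in> {-T..T} \<and>
           xdet \<epsilon> (tcross \<epsilon>) = xstar \<epsilon> (tcross \<epsilon>) \<and>
           (\<forall>t\<in>{-T..<tcross \<epsilon>}. xstar \<epsilon> t < xdet \<epsilon> t) \<and>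
           (\<forall>t\<in>{tcross \<epsilon><..T}. xdet \<epsilon> t < xstar \<epsilon> t)"
        using good
      proof eventually_elim
        case (elim \<epsilon>)
        then have "P \<epsilon> (tcross \<epsilon>)" using tc by blast
        then show ?case by (simp add: P_def)
      qed
      show "comparable_on (\<lambda>\<epsilon>. UNIV) (\<lambda>\<epsilon> _. tcross \<epsilon> - tstar \<epsilon>) (\<lambda>\<epsilon> _. min (\<epsilon> / a0 \<epsilon>) (\<epsilon> powr (1/3)))"
      proof (rule comparable[OF kK(1,2)])
        fix \<epsilon> assume p: "passage_profile T k K N \<epsilon> (a0 \<epsilon>) (tstar \<epsilon>) (pdx d (F (a0 \<epsilon>))) (xstar \<epsilon>) (xdet \<epsilon>)"
          "0 < a0 \<epsilon>" "0 < \<epsilon>"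
        show "k * min (\<epsilon> / a0 \<epsilon>) (\<epsilon> powr (1/3)) \<le> tcross \<epsilon> - tstar \<epsilon> \<and>
            tcross \<epsilon> - tstar \<epsilon> \<le> K * min (\<epsilon> / a0 \<epsilon>) (\<epsilon> powr (1/3))"
          using tc[OF p(1)] unfolding inner_scale_facts(2)[OF p(3,2)] P_def \<mu>_def by blast
      qed
    qed
  qed
  have part2: "\<exists>c0>0.
      comparable_on (\<lambda>\<epsilon>. {-T..- c0 * max (sqrt (a0 \<epsilon>)) (\<epsilon> powr (1/3))})
        (\<lambda>\<epsilon> t. xdet \<epsilon> t - xstar \<epsilon> t) (\<lambda>\<epsilon> t. \<epsilon> / t\<^sup>2) \<and>
      comparable_on (\<lambda>\<epsilon>. {c0 * max (sqrt (a0 \<epsilon>)) (\<epsilon> powr (1/3))..T})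
        (\<lambda>\<epsilon> t. - (xdet \<epsilon> t - xstar \<epsilon> t)) (\<lambda>\<epsilon> t. \<epsilon> / t\<^sup>2) \<and>
      comparable_on (\<lambda>\<epsilon>. {-T..- c0 * max (sqrt (a0 \<epsilon>)) (\<epsilon> powr (1/3))} \<union>
                          {c0 * max (sqrt (a0 \<epsilon>)) (\<epsilon> powr (1/3))..T})
        xdet (\<lambda>\<epsilon> t. \<bar>t\<bar>) \<and>
      comparable_on
        (\<lambda>\<epsilon>. {t. \<bar>t\<bar> \<le> c0 * max (sqrt (a0 \<epsilon>)) (\<epsilon> powr (1/3)) \<and> a0 \<epsilon> \<ge> \<epsilon> powr (2/3)})
        xdet (\<lambda>\<epsilon> t. sqrt (a0 \<epsilon>)) \<and>
      comparable_on
        (\<lambda>\<epsilon>. {t. \<bar>t\<bar> \<le> c0 * max (sqrt (a0 \<epsilon>)) (\<epsilon> powr (1/3)) \<and> a0 \<epsilon> \<le> \<epsilon> powr (2/3)})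
        xdet (\<lambda>\<epsilon> t. \<epsilon> powr (1/3))"
    unfolding mu
  proof (intro exI[of _ N] conjI)
    show "0 < N" using kK by linarith
    show "comparable_on (\<lambda>\<epsilon>. {-T..- N * \<mu> \<epsilon>}) (\<lambda>\<epsilon> t. xdet \<epsilon> t - xstar \<epsilon> t) (\<lambda>\<epsilon> t. \<epsilon> / t\<^sup>2)"
      by (rule comparable[OF kK(1,2)]) (auto simp: passage_profile_def \<mu>_def)
    show "comparable_on (\<lambda>\<epsilon>. {N * \<mu> \<epsilon>..T}) (\<lambda>\<epsilon> t. - (xdet \<epsilon> t - xstar \<epsilon> t)) (\<lambda>\<epsilon> t. \<epsilon> / t\<^sup>2)"
      by (rule comparable[OF kK(1,2)]) (auto simp: passage_profile_def \<mu>_def)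
    show "comparable_on (\<lambda>\<epsilon>. {-T..- N * \<mu> \<epsilon>} \<union> {N * \<mu> \<epsilon>..T}) xdet (\<lambda>\<epsilon> t. \<bar>t\<bar>)"
    proof (rule comparable[OF kK(1,2)])
      fix \<epsilon> t assume p: "passage_profile T k K N \<epsilon> (a0 \<epsilon>) (tstar \<epsilon>) (pdx d (F (a0 \<epsilon>))) (xstar \<epsilon>) (xdet \<epsilon>)"
        and m: "0 < \<mu> \<epsilon>" and t: "t \<in> {-T..- N * \<mu> \<epsilon>} \<union> {N * \<mu> \<epsilon>..T}"
      have N\<mu>: "\<mu> \<epsilon> \<le> N * \<mu> \<epsilon>" by (rule N1[OF m])
      have "(- T \<le> t \<and> t \<le> - (N * \<mu> \<epsilon>)) \<or> (N * \<mu> \<epsilon> \<le> t \<and> t \<le> T)" using t by simp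
      then have "\<mu> \<epsilon> \<le> \<bar>t\<bar>" "\<bar>t\<bar> \<le> T" using N\<mu> m by (elim disjE conjE; linarith)+
      moreover from this have "max (\<mu> \<epsilon>) \<bar>t\<bar> = \<bar>t\<bar>" by simp
      ultimately show "k * \<bar>t\<bar> \<le> xdet \<epsilon> t \<and> xdet \<epsilon> t \<le> K * \<bar>t\<bar>" using sandwich[OF p, of t] by simp
    qed
    have KN: "0 < K * N" using kK by simp
    show "comparable_on (\<lambda>\<epsilon>. {t. \<bar>t\<bar> \<le> N * \<mu> \<epsilon> \<and> a0 \<epsilon> \<ge> \<epsilon> powr (2/3)}) xdet (\<lambda>\<epsilon> t. sqrt (a0 \<epsilon>))"
    proof (rule comparable[OF kK(1) KN])
      fix \<epsilon> t assume p: "passage_profile T k K N \<epsilon> (a0 \<epsilon>) (tstar \<epsilon>) (pdx d (F (a0 \<epsilon>))) (xstar \<epsilon>) (xdet \<epsilon>)"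
        and a: "0 < a0 \<epsilon>" "0 < \<epsilon>" and m: "N * \<mu> \<epsilon> \<le> T" "0 < \<mu> \<epsilon>"
        and t: "t \<in> {t. \<bar>t\<bar> \<le> N * \<mu> \<epsilon> \<and> a0 \<epsilon> \<ge> \<epsilon> powr (2/3)}"
      have "\<mu> \<epsilon> = sqrt (a0 \<epsilon>)" using inner_scale_facts(4)[OF a(2,1)] t by (simp add: \<mu>_def)
      then show "k * sqrt (a0 \<epsilon>) \<le> xdet \<epsilon> t \<and> xdet \<epsilon> t \<le> K * N * sqrt (a0 \<epsilon>)" using inner[OF p m, of t] t by simp
    qed
    show "comparable_on (\<lambda>\<epsilon>. {t. \<bar>t\<bar> \<le> N * \<mu> \<epsilon> \<and> a0 \<epsilon> \<le> \<epsilon> powr (2/3)}) xdet (\<lambda>\<epsilon> t. \<epsilon> powr (1/3))"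
    proof (rule comparable[OF kK(1) KN])
      fix \<epsilon> t assume p: "passage_profile T k K N \<epsilon> (a0 \<epsilon>) (tstar \<epsilon>) (pdx d (F (a0 \<epsilon>))) (xstar \<epsilon>) (xdet \<epsilon>)"
        and a: "0 < a0 \<epsilon>" "0 < \<epsilon>" and m: "N * \<mu> \<epsilon> \<le> T" "0 < \<mu> \<epsilon>"
        and t: "t \<in> {t. \<bar>t\<bar> \<le> N * \<mu> \<epsilon> \<and> a0 \<epsilon> \<le> \<epsilon> powr (2/3)}"
      have "\<mu> \<epsilon> = \<epsilon> powr (1/3)" using inner_scale_facts(5)[OF a(2,1)] t by (simp add: \<mu>_def)
      then show "k * \<epsilon> powr (1/3) \<le> xdet \<epsilon> t \<and> xdet \<epsilon> t \<le> K * N * \<epsilon> powr (1/3)" using inner[OF p m, of t] t by simp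
    qed
  qed
  have part3: "comparable_on (\<lambda>\<epsilon>. {-T..T})
      (\<lambda>\<epsilon> t. - pdx d (F (a0 \<epsilon>)) (xdet \<epsilon> t) t)
      (\<lambda>\<epsilon> t. max (t\<^sup>2) (max (a0 \<epsilon>) (\<epsilon> powr (2/3))))"
  proof (rule comparable[OF kK(1,2)])
    fix \<epsilon> t assume p: "passage_profile T k K N \<epsilon> (a0 \<epsilon>) (tstar \<epsilon>) (pdx d (F (a0 \<epsilon>))) (xstar \<epsilon>) (xdet \<epsilon>)"
      and a: "0 < a0 \<epsilon>" "0 < \<epsilon>" and t: "t \<in> {-T..T}"
    have "\<bar>t\<bar> \<le> T" using t by auto
    then show "k * max (t\<^sup>2) (max (a0 \<epsilon>) (\<epsilon> powr (2/3))) \<le> - pdx d (F (a0 \<epsilon>)) (xdet \<epsilon> t) t \<and>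
        - pdx d (F (a0 \<epsilon>)) (xdet \<epsilon> t) t \<le> K * max (t\<^sup>2) (max (a0 \<epsilon>) (\<epsilon> powr (2/3)))"
      unfolding inner_scale_facts(3)[OF a(2,1)] using p unfolding passage_profile_def by blast
  qed
  show ?thesis using part1 part2 part3 by blast
qed

end
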